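(* Assume (A1)-(A3) and (B1)-(B3) listed in the context. (i) There exists $\beta'=\beta'(D,K)>0$ such that for every $N\ge\lceil\beta'\log n\rceil$ we have $$\left\|\Phi(c_{1:n}\mid X_{1:n})-\tilde\Phi_N(\tilde c_{1:n}\mid X_{1:n})\right\|_{TV}\to0$$ in $Q^{(\infty)}$-probability as $n\to\infty$. (ii) Moreover, there exist $\alpha^*=\alpha^*(D,K)$ and $\beta=\beta(\alpha^* )>0$ such that if $\alpha>\alpha^*$ and $N<\lceil\beta\log n\rceil$ we have $$\left\|\Phi(c_{1:n}\mid X_{1:n})-\tilde\Phi_N(\tilde c_{1:n}\mid X_{1:n})\right\|_{TV}\to1$$ in $Q^{(\infty)}$-probability as $n\to\infty$.
   Context: Let $D\ge 1$, let $\|\cdot\|$ be the Euclidean norm, and let $f$ be a probability density on $\mathbb{R}^D$ (w.r.t. Lebesgue measure). For a probability measure $P$ on $\mathbb{R}^D$ write $Pf(x)=\int f(x-\theta)\,P(d\theta)$. Prior: $\alpha>0$ is the concentration parameter, $P_0$ is a probability measure on $\Theta\subset\mathbb{R}^D$, and $\Pi$ is the law of the Dirichlet process $P\sim \mathrm{DP}(\alpha,P_0)$ in stick-breaking form, $P=\sum_{k\ge1}w_k\delta_{\theta_k}$, $w_k=v_k\prod_{j=1}^{k-1}(1-v_j)$, $v_k$ i.i.d. $\mathrm{Beta}(1,\alpha)$, $\theta_k$ i.i.d. $P_0$, the two sequences being independent. Allocation variables: consider the model $X_i\mid P,c_i\sim f(\cdot-\theta_{c_i})$ independently, $c_i\mid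 P$ i.i.d. categorical on $\mathbb{N}=\{1,2,\dots\}$ with probabilities $(w_k)_{k\ge1}$, $P\sim\mathrm{DP}(\alpha,P_0)$. $\Phi(\cdot\mid X_{1:n})$ is the induced posterior law of $c_{1:n}=(c_1,\dots,c_n)$: $\Phi(c_{1:n}=k_{1:n}\mid X_{1:n})=\int\prod_{i=1}^n w_{k_i}f(X_i-\theta_{k_i})\,d\Pi\big/\int\prod_{i=1}^nPf(X_i)\,\Pi(dP)$. Truncated model: for an integer truncation level $N\ge1$ (which may depend on $n$), $\tilde\Pi_N$ is the law of $\tilde P=\sum_{k=1}^{N+1}\tilde w_k\delta_{\tilde\theta_k}$, where $\tilde w_k=\tilde v_k\prod_{j=1}^{k-1}(1-\tilde v_j)$ for $k\le N$ with $\tilde v_1,\dots,\tilde v_N$ i.i.d. $\mathrm{Beta}(1,\alpha)$, $\tilde w_{N+1}=1-\sum_{k=1}^N\tilde w_k$, and $\tilde\theta_1,\dots,\tilde\theta_{N+1}$ are i.i.d. $P_0$, independent of the $\tilde v_k$. $\tilde\Phi_N(\cdot\mid X_{1:n})$ is the posterior law of the allocation variables $\tilde c_{1:n}\in\{1,\dots,N+1\}^n$ in the model $X_i\mid\tilde P,\tilde c_i\sim f(\cdot-\tilde\theta_{\tilde c_i})$ independently, $\tilde c_i\mid\tilde P$ i.i.d. categorical with probabilities $(\tilde w_1,\dots,\tilde w_{N+1})$, $\tilde P\sim\tilde\Pi_N$. Assumptions: (A1) $X_1,X_2,\dots$ are i.i.d. from $Q(dx)=P^*f(x)\,dx$, where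 $P^*=\sum_{k=1}^K w_k^*\delta_{\theta_k^*}$, $K<\infty$, $(w_1^*,\dots,w_K^* )$ is a probability vector, and $P^*$ has exactly $K$ support points (the $\theta_k^*$ are distinct and $w_k^*>0$). (A2) $\Theta\subset\mathbb{R}^D$ is compact and $\theta_k^*\in\Theta$ for all $k=1,\dots,K$. (A3) $P_0$ has a continuous bounded density $p_0$ on $\Theta$ w.r.t. Lebesgue measure, with $p_0(\theta_k^* )>0$ for all $k=1,\dots,K$. (B1) $f\in C^3(\mathbb{R}^D)$ and there is a constant $F$ with $0<f(x)<F$ for all $x$. (B2) There are $R>0$, $\gamma\ge0$ with $\|\nabla\log f(x)\|\le R(1+\|x\|)^\gamma$ and $\|\nabla^2\log f(x)\|\le R(1+\|x\|)^\gamma$ for all $x$, and $\int e^{M\|x\|^\gamma}f(x)\,dx<\infty$ for every $M>0$. (B3) There are $C,r>0$ with $\|\nabla^g f(x)\|\le C(1+\|x\|)^{-(D+r)}$ for all $x$ and $g=1,2,3$. $Q^{(\infty)}$ is the law of the i.i.d. sequence $(X_i)_{i\ge1}$, $X_{1:n}=(X_1,\dots,X_n)$, $\lceil\cdot\rceil$ is the ceiling, and $\|\cdot\|_{TV}$ is the total variation distance (with values in $[0,1]$) between probability laws on $\mathbb{N}^n$.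
   Formalization: In (i), β' may also depend on α (a β' uniform in α is impossible); in (A3), Θ is also assumed to have positive lower Lebesgue density at each θ_k*, since otherwise p_0(θ_k* )>0 says nothing about P_0 (e.g. at isolated points of Θ). *)

theory Defs
  imports "HOL-Probability.Probability"
begin

text \<open>Iterated partial derivatives; the list of coordinates is the multi-index.\<close>

fun partials :: "'d list \<Rightarrow> (real^'d \<Rightarrow> real) \<Rightarrow> real^'d \<Rightarrow> real" where
  "partials [] f = f"
| "partials (i # is) f = (\<lambda>x. frechet_derivative (partials is f) (at x) (axis i 1))"

definition C_k_on_UNIV :: "nat \<Rightarrow> (real^'d \<Rightarrow> real) \<Rightarrow> bool" where
  "C_k_on_UNIV m f \<longleftrightarrow>
     (\<forall>is. length is < m \<longrightarrow> partials is f differentiable_on UNIV) \<and>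
     (\<forall>is. length is \<le> m \<longrightarrow> continuous_on UNIV (partials is f))"

text \<open>Euclidean (Frobenius) norm of the tensor of all derivatives of order \<open>g\<close>.
  Any other tensor norm is equivalent to it, with constants depending on the dimension and
  on \<open>g\<close> only; the bounds below hold up to an unspecified constant.\<close>

definition deriv_norm :: "nat \<Rightarrow> (real^'d \<Rightarrow> real) \<Rightarrow> real^'d \<Rightarrow> real" where
  "deriv_norm g f x = sqrt (\<Sum>is\<in>{is. length is = g}. (partials is f x)\<^sup>2)"

definition smooth_bounded_kernel :: "(real^'d \<Rightarrow> real) \<Rightarrow> bool" where
  "smooth_bounded_kernel f \<longleftrightarrow> C_k_on_UNIV 3 f \<and> (\<exists>F. \<forall>x. 0 < f x \<and> f x < F)"

definition log_deriv_growth :: "(real^'d \<Rightarrow> real) \<Rightarrow> bool" where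
  "log_deriv_growth f \<longleftrightarrow>
     (\<exists>R>0. \<exists>\<gamma>\<ge>0.
        (\<forall>x. deriv_norm 1 (\<lambda>y. ln (f y)) x \<le> R * (1 + norm x) powr \<gamma>) \<and>
        (\<forall>x. deriv_norm 2 (\<lambda>y. ln (f y)) x \<le> R * (1 + norm x) powr \<gamma>) \<and>
        (\<forall>M>0. integrable lborel (\<lambda>x. exp (M * norm x powr \<gamma>) * f x)))"

definition deriv_decay :: "(real^'d \<Rightarrow> real) \<Rightarrow> bool" where
  "deriv_decay f \<longleftrightarrow>
     (\<exists>C>0. \<exists>r>0. \<forall>x. \<forall>g\<in>{1, 2, 3}.
        deriv_norm g f x \<le> C * (1 + norm x) powr (- (real CARD('d) + r)))"

text \<open>\<open>discrete_measure I w t\<close> is the measure \<open>\<Sum>k\<in>I. w k * \<delta>\<^bsub>t k\<^esub>\<close>.\<close>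

definition discrete_measure :: "nat set \<Rightarrow> (nat \<Rightarrow> real) \<Rightarrow> (nat \<Rightarrow> real^'d) \<Rightarrow> (real^'d) measure" where
  "discrete_measure I w t = distr (point_measure I (\<lambda>k. ennreal (w k))) borel t"

definition mixture :: "(real^'d \<Rightarrow> real) \<Rightarrow> (real^'d) measure \<Rightarrow> real^'d \<Rightarrow> real" where
  "mixture f P x = (\<integral>\<theta>. f (x - \<theta>) \<partial>P)"

text \<open>Labels start at \<open>0\<close>: the label \<open>k\<close> here is the label \<open>k + 1\<close> of the usual notation on
  \<open>{1, 2, \<dots>}\<close>. Accordingly, truncation at level \<open>N\<close> keeps the \<open>N + 1\<close> labels \<open>0, \<dots>, N\<close>.\<close>

definition beta_law :: "real \<Rightarrow> real \<Rightarrow> real measure" where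
  "beta_law a b = density lborel
     (\<lambda>x. ennreal (indicator {0<..<1} x * (x powr (a - 1) * (1 - x) powr (b - 1) / Beta a b)))"

definition stick_weight :: "(nat \<Rightarrow> real) \<Rightarrow> nat \<Rightarrow> real" where
  "stick_weight v k = v k * (\<Prod>j<k. 1 - v j)"

definition trunc_weight :: "nat \<Rightarrow> (nat \<Rightarrow> real) \<Rightarrow> nat \<Rightarrow> real" where
  "trunc_weight N v k =
     (if k < N then stick_weight v k
      else if k = N then 1 - (\<Sum>j<N. stick_weight v j) else 0)"

text \<open>Laws of the pair (sticks, atoms). The Dirichlet process \<open>DP(\<alpha>, P0)\<close> is the law of
  \<open>discrete_measure UNIV (stick_weight v) t\<close> for \<open>(v, t)\<close> distributed as \<open>dp_sticks \<alpha> P0\<close>, and its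
  truncation is the law of \<open>discrete_measure UNIV (trunc_weight N v) t\<close> for \<open>(v, t)\<close> distributed as
  \<open>trunc_sticks \<alpha> P0 N\<close>.\<close>

definition dp_sticks :: "real \<Rightarrow> (real^'d) measure \<Rightarrow> ((nat \<Rightarrow> real) \<times> (nat \<Rightarrow> real^'d)) measure" where
  "dp_sticks \<alpha> P0 = (\<Pi>\<^sub>M k\<in>UNIV. beta_law 1 \<alpha>) \<Otimes>\<^sub>M (\<Pi>\<^sub>M k\<in>UNIV. P0)"

definition trunc_sticks ::
  "real \<Rightarrow> (real^'d) measure \<Rightarrow> nat \<Rightarrow> ((nat \<Rightarrow> real) \<times> (nat \<Rightarrow> real^'d)) measure" where
  "trunc_sticks \<alpha> P0 N = (\<Pi>\<^sub>M k\<in>{..<N}. beta_law 1 \<alpha>) \<Otimes>\<^sub>M (\<Pi>\<^sub>M k\<in>{..N}. P0)"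

text \<open>\<open>S\<close> is the law of (sticks, atoms) and \<open>W\<close> turns sticks into weights. The result is a law on
  \<open>{..<n} \<rightarrow>\<^sub>E UNIV\<close>, the extensional copy of the \<open>n\<close>-tuples of labels; only the first \<open>n\<close> terms of
  the data \<open>x\<close> are used. Integrals of functions of the mixing measure with respect to its law are
  written as integrals over \<open>S\<close>. In the truncated model the labels above \<open>N\<close> have weight, hence
  posterior mass, zero.\<close>

definition allocation_posterior ::
  "(real^'d \<Rightarrow> real) \<Rightarrow> ((nat \<Rightarrow> real) \<times> (nat \<Rightarrow> real^'d)) measure \<Rightarrow>
   ((nat \<Rightarrow> real) \<Rightarrow> nat \<Rightarrow> real) \<Rightarrow> nat \<Rightarrow> (nat \<Rightarrow> real^'d) \<Rightarrow> (nat \<Rightarrow> nat) measure" where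
  "allocation_posterior f S W n x =
     point_measure ({..<n} \<rightarrow>\<^sub>E UNIV) (\<lambda>c. ennreal
       ((\<integral>(v, t). (\<Prod>i<n. W v (c i) * f (x i - t (c i))) \<partial>S) /
        (\<integral>(v, t). (\<Prod>i<n. mixture f (discrete_measure UNIV (W v) t) (x i)) \<partial>S)))"

definition dp_allocation ::
  "(real^'d \<Rightarrow> real) \<Rightarrow> real \<Rightarrow> (real^'d) measure \<Rightarrow> nat \<Rightarrow> (nat \<Rightarrow> real^'d) \<Rightarrow> (nat \<Rightarrow> nat) measure" where
  "dp_allocation f \<alpha> P0 n x = allocation_posterior f (dp_sticks \<alpha> P0) stick_weight n x"

definition trunc_allocation ::
  "(real^'d \<Rightarrow> real) \<Rightarrow> real \<Rightarrow> (real^'d) measure \<Rightarrow> nat \<Rightarrow> nat \<Rightarrow> (nat \<Rightarrow> real^'d) \<Rightarrow>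
   (nat \<Rightarrow> nat) measure" where
  "trunc_allocation f \<alpha> P0 N n x = allocation_posterior f (trunc_sticks \<alpha> P0 N) (trunc_weight N) n x"

definition tv_dist :: "'a measure \<Rightarrow> 'a measure \<Rightarrow> real" where
  "tv_dist \<mu> \<nu> = (SUP A\<in>sets \<mu>. \<bar>measure \<mu> A - measure \<nu> A\<bar>)"

definition conv_in_prob :: "'a measure \<Rightarrow> (nat \<Rightarrow> 'a \<Rightarrow> real) \<Rightarrow> real \<Rightarrow> bool" where
  "conv_in_prob M Y c \<longleftrightarrow>
     (\<forall>n. Y n \<in> borel_measurable M) \<and>
     (\<forall>\<epsilon>>0. (\<lambda>n. measure M {x \<in> space M. \<epsilon> < \<bar>Y n x - c\<bar>}) \<longlonglongrightarrow> 0)"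

definition true_mixing :: "nat \<Rightarrow> (nat \<Rightarrow> real) \<Rightarrow> (nat \<Rightarrow> real^'d) \<Rightarrow> bool" where
  "true_mixing K ws ts \<longleftrightarrow>
     (\<forall>k<K. 0 < ws k) \<and> (\<Sum>k<K. ws k) = 1 \<and> inj_on ts {..<K}"

definition data_law ::
  "(real^'d \<Rightarrow> real) \<Rightarrow> nat \<Rightarrow> (nat \<Rightarrow> real) \<Rightarrow> (nat \<Rightarrow> real^'d) \<Rightarrow> (nat \<Rightarrow> real^'d) measure" where
  "data_law f K ws ts = (\<Pi>\<^sub>M i\<in>UNIV. density lborel
     (\<lambda>x. ennreal (mixture f (discrete_measure {..<K} ws ts) x)))"

definition base_density_on :: "(real^'d) set \<Rightarrow> (real^'d \<Rightarrow> real) \<Rightarrow> (real^'d) measure \<Rightarrow> bool" where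
  "base_density_on \<Theta> p0 P0 \<longleftrightarrow>
     prob_space P0 \<and> P0 = density lborel (\<lambda>\<theta>. ennreal (indicator \<Theta> \<theta> * p0 \<theta>)) \<and>
     continuous_on \<Theta> p0 \<and> bounded (p0 ` \<Theta>) \<and> (\<forall>\<theta>\<in>\<Theta>. 0 \<le> p0 \<theta>)"

text \<open>\<open>\<Theta>\<close> has positive lower Lebesgue density at \<open>\<theta>\<close>. This holds at interior points of \<open>\<Theta>\<close>, and at
  every point of \<open>\<Theta>\<close> if \<open>\<Theta>\<close> is, e.g., a convex body. Without it the
  value of a density on \<open>\<Theta>\<close> at \<open>\<theta>\<close> is meaningless: at an isolated point of \<open>\<Theta>\<close> it can be chosen
  freely without changing the measure.\<close>

definition lower_density_pos :: "(real^'d) set \<Rightarrow> real^'d \<Rightarrow> bool" where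
  "lower_density_pos \<Theta> \<theta> \<longleftrightarrow>
     (\<exists>c>0. \<forall>\<epsilon>\<in>{0<..1}. c * \<epsilon> ^ CARD('d) \<le> measure lborel (\<Theta> \<inter> ball \<theta> \<epsilon>))"

definition mixture_assumptions ::
  "(real^'d \<Rightarrow> real) \<Rightarrow> (real^'d) set \<Rightarrow> (real^'d) measure \<Rightarrow>
   nat \<Rightarrow> (nat \<Rightarrow> real) \<Rightarrow> (nat \<Rightarrow> real^'d) \<Rightarrow> bool" where
  "mixture_assumptions f \<Theta> P0 K ws ts \<longleftrightarrow>
     prob_space (density lborel (\<lambda>x. ennreal (f x))) \<and>
     smooth_bounded_kernel f \<and> log_deriv_growth f \<and> deriv_decay f \<and>
     true_mixing K ws ts \<and>
     compact \<Theta> \<and> (\<forall>k<K. ts k \<in> \<Theta>) \<and>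
     (\<exists>p0. base_density_on \<Theta> p0 P0 \<and> (\<forall>k<K. 0 < p0 (ts k))) \<and>
     (\<forall>k<K. lower_density_pos \<Theta> (ts k))"

end

theory Submission
  imports Defs
begin

text \<open>
  The Dirichlet process and its truncation can be built from the same sticks and atoms: the weights
  with labels below \<open>N\<close> coincide, and the truncated prior lumps the rest of the stick,
  \<open>stick_rest N v = (\<Prod>j<N. 1 - v j)\<close>, into the label \<open>N\<close>. Hence the two posteriors of the
  allocations give proportional weights to the tuples with all labels below \<open>N\<close>, and their distance is
  controlled by the posterior mass of the other tuples (\<open>tv_le_overflow\<close>). In the opposite direction
  the truncated posterior is carried by the tuples with all labels at most \<open>N\<close>, so the distance is
  close to one as soon as the untruncated posterior hardly charges them (\<open>tv_ge_underflow\<close>).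

  Both events are rare under the prior, and a rare event stays rare under the posterior if its prior
  probability is of smaller order than the evidence. To make this precise, write \<open>q\<close> for the true
  density. The integrated likelihood of an event, divided by \<open>\<Prod>i<n. q (x i)\<close>, has expectation equal to
  the prior probability of the event (\<open>expectation_box\<close>), and the reciprocal
  \<open>(\<Prod>i<n. q (x i)) / evidence n x\<close> has expectation at most \<open>C * n powr (mass_exponent / 2)\<close>
  (\<open>evidence_bound\<close>). By Markov's inequality for both factors, the posterior probability of the event
  is small in probability once the product of these two expectations tends to zero
  (\<open>prob_product_small\<close>).

  The bound on the reciprocal evidence is where the truth enters. By the Cauchy-Schwarz inequality,
  \<open>(emeasure S B)\<^sup>2 / evidence\<close> is at most the prior integral over \<open>B\<close> of the reciprocal
  likelihood (\<open>evidence_cauchy_schwarz\<close>). For a single observation, the ratio of \<open>q\<close> to the mixture density has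
  as its expectation one plus the chi-square divergence. The growth condition on the logarithmic
  gradient of the kernel bounds this divergence by a multiple of \<open>\<eta>\<^sup>2\<close> if the weights and atoms are \<open>\<eta>\<close>-close to the true ones
  (\<open>chi_square_bound\<close>). With \<open>\<eta>\<close> of order \<open>n powr (- 1 / 2)\<close> the \<open>n\<close>-fold product stays bounded, and
  such neighbourhoods have prior mass of order at least \<open>n powr (- mass_exponent / 2)\<close> (\<open>near_mass\<close>), where
  \<open>mass_exponent = \<alpha> + (K - 1) + K * CARD('d)\<close>. The summand \<open>\<alpha>\<close> is the price for the \<open>K\<close>-th stick
  to take nearly all of the remaining mass.

  It remains to compute the two prior probabilities. Some label is at least \<open>N\<close> with probability at most
  \<open>n * (\<alpha> / (\<alpha> + 1)) ^ N\<close>, which beats any power of \<open>n\<close> if \<open>N\<close> is a large multiple of \<open>ln n\<close>.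
  All labels are at most \<open>N\<close> with probability equal to the expectation of
  \<open>(1 - stick_rest (Suc N) v) ^ n\<close>, which is at most a constant times
  \<open>n powr (- s) * (\<alpha> / (\<alpha> - s)) ^ Suc N\<close> for each \<open>s < \<alpha>\<close>. The decay is thus nearly
  \<open>n powr (- \<alpha>)\<close> when \<open>N\<close> is at most \<open>ln n\<close>, up to a factor that is polynomial in \<open>n\<close> with a degree
  depending on the ratio \<open>s / \<alpha>\<close> only, whereas the evidence costs \<open>n powr (\<alpha> / 2)\<close> times a power that does not
  involve \<open>\<alpha>\<close>; so the decay wins for all large \<open>\<alpha>\<close>. Here it matters that the neighbourhoods
  have radius \<open>n powr (- 1 / 2)\<close> and not \<open>1 / n\<close>.
\<close>

section \<open>Total variation between laws on a countable set\<close>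

text \<open>The counting measure on a finite product of countable sets is the product of the counting measures,
so that expanding a product of series is an instance of the product formula for integrals.\<close>

lemma nn_integral_count_space_PiE_prod:
  fixes h :: "'i \<Rightarrow> 'b::countable \<Rightarrow> ennreal"
  assumes "finite I"
  shows "(\<integral>\<^sup>+c. (\<Prod>i\<in>I. h i (c i)) \<partial>count_space (I \<rightarrow>\<^sub>E UNIV)) =
    (\<Prod>i\<in>I. \<integral>\<^sup>+k. h i k \<partial>count_space UNIV)"
proof -
  interpret product_sigma_finite "\<lambda>_::'i. count_space (UNIV :: 'b set)"
    by (simp add: product_sigma_finite_def sigma_finite_measure_count_space_countable)
  have "count_space (I \<rightarrow>\<^sub>E (UNIV :: 'b set)) = PiM I (\<lambda>_. count_space UNIV)"
    using assms by (subst count_space_PiM_finite) auto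
  then show ?thesis
    using assms by (simp add: product_nn_integral_prod)
qed

lemma emeasure_point_measure_nn_integral:
  assumes "A \<subseteq> C"
  shows "emeasure (point_measure C p) A = (\<integral>\<^sup>+c. indicator A c * p c \<partial>count_space C)"
  using assms unfolding point_measure_def
  by (subst emeasure_density) (auto simp: mult.commute)

text \<open>The supremum in the total variation distance is attained at the set where the first density exceeds
the second. A supremum over uncountably many sets becomes a countable sum, which is what makes the
distance between posteriors a measurable function of the data.\<close>

lemma tv_dist_point_measure:
  fixes p q :: "'a \<Rightarrow> ennreal"
  assumes p: "prob_space (point_measure C p)" and q: "prob_space (point_measure C q)"
  defines "B \<equiv> {c \<in> C. q c < p c}"
  shows "tv_dist (point_measure C p) (point_measure C q) =
    measure (point_measure C p) B - measure (point_measure C q) B"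
proof -
  let ?P = "point_measure C p" and ?Q = "point_measure C q"
  interpret P: prob_space ?P by fact
  interpret Q: prob_space ?Q by fact
  have le: "measure ?P A - measure ?Q A \<le> measure ?P B - measure ?Q B" if A: "A \<subseteq> C" for A
  proof -
    have "emeasure ?P A + emeasure ?Q B =
        (\<integral>\<^sup>+c. indicator A c * p c + indicator B c * q c \<partial>count_space C)"
      using A by (subst nn_integral_add) (auto simp: emeasure_point_measure_nn_integral B_def)
    also have "\<dots> \<le> (\<integral>\<^sup>+c. indicator B c * p c + indicator A c * q c \<partial>count_space C)"
      by (intro nn_integral_mono)
        (auto simp: B_def indicator_def not_less intro: add_mono less_imp_le)
    also have "\<dots> = emeasure ?P B + emeasure ?Q A"
      using A by (subst nn_integral_add) (auto simp: emeasure_point_measure_nn_integral B_def)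
    finally show ?thesis
      unfolding P.emeasure_eq_measure Q.emeasure_eq_measure
      by (simp flip: ennreal_plus)
  qed
  have "\<bar>measure ?P A - measure ?Q A\<bar> \<le> measure ?P B - measure ?Q B" if A: "A \<in> sets ?P" for A
  proof -
    have AC: "A \<subseteq> C" using A by (simp add: sets_point_measure)
    have "measure ?P (C - A) = 1 - measure ?P A" "measure ?Q (C - A) = 1 - measure ?Q A"
      using P.prob_compl[of A] Q.prob_compl[of A] AC
      by (simp_all add: sets_point_measure space_point_measure)
    then show ?thesis using le[OF AC] le[of "C - A"] by auto
  qed
  moreover have "B \<in> sets ?P" by (auto simp: sets_point_measure B_def)
  moreover have "measure ?P B - measure ?Q B \<le> \<bar>measure ?P B - measure ?Q B\<bar>" by simp
  ultimately show ?thesis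
    unfolding tv_dist_def
    by (intro antisym cSUP_least) (auto intro!: cSUP_upper2 bdd_aboveI2)
qed

text \<open>On subsets of \<open>L\<close> the two laws differ by their normalisation only, and the normalisations differ by no
more than the masses outside \<open>L\<close>.\<close>

lemma tv_dist_le_of_agree:
  fixes P Q :: "'a measure"
  assumes "prob_space P" "prob_space Q" and s: "sets P = sets Q" and L: "L \<in> sets P"
    and agree: "\<And>A. A \<in> sets P \<Longrightarrow> A \<subseteq> L \<Longrightarrow> measure P A * measure Q L = measure Q A * measure P L"
  shows "tv_dist P Q \<le> 2 * (measure P (space P - L) + measure Q (space Q - L))"
proof -
  interpret P: prob_space P by fact
  interpret Q: prob_space Q by fact
  have [simp]: "space Q = space P" using s by (metis sets_eq_imp_space_eq)
  have pq: "measure P (space P - L) = 1 - measure P L" "measure Q (space P - L) = 1 - measure Q L"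
    using P.prob_compl[of L] Q.prob_compl[of L] L s by simp_all
  have main: "\<bar>measure P A - measure Q A\<bar> \<le> 2 * (measure P (space P - L) + measure Q (space P - L))"
    if A: "A \<in> sets P" for A
  proof -
    have PA: "measure P A = measure P (A \<inter> L) + measure P (A - L)"
      and QA: "measure Q A = measure Q (A \<inter> L) + measure Q (A - L)"
      using P.finite_measure_Union[of "A \<inter> L" "A - L"] Q.finite_measure_Union[of "A \<inter> L" "A - L"] A L s
      by (auto simp: Int_Diff_Un)
    have sm: "measure P (A - L) \<le> measure P (space P - L)" "measure Q (A - L) \<le> measure Q (space P - L)"
      using A L s sets.sets_into_space[OF A]
      by (auto intro!: P.finite_measure_mono Q.finite_measure_mono)
    define a b where "a = measure P (A \<inter> L)" and "b = measure Q (A \<inter> L)"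
    have ab: "a * measure Q L = b * measure P L" unfolding a_def b_def
      using A L s by (intro agree) auto
    have le: "0 \<le> a" "a \<le> 1" "0 \<le> b" "b \<le> 1" unfolding a_def b_def by auto
    have "a - b = a * (1 - measure Q L) - b * (1 - measure P L)"
      using ab by (simp add: algebra_simps)
    moreover have "a * (1 - measure Q L) \<le> 1 - measure Q L" "b * (1 - measure P L) \<le> 1 - measure P L"
      using le by (auto intro!: mult_left_le_one_le)
    moreover have "0 \<le> a * (1 - measure Q L)" "0 \<le> b * (1 - measure P L)"
      using le by auto
    ultimately have ab_le: "a - b \<le> (1 - measure Q L) + (1 - measure P L)"
        "b - a \<le> (1 - measure Q L) + (1 - measure P L)"
      by (smt (verit) P.prob_le_1 Q.prob_le_1)+
    define u v x y where "u = measure P (A - L)" and "v = measure Q (A - L)"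
      and "x = measure P (space P - L)" and "y = measure Q (space P - L)"
    have "0 \<le> u" "0 \<le> v" by (simp_all add: u_def v_def)
    then have "\<bar>(a + u) - (b + v)\<bar> \<le> 2 * (x + y)"
      using sm ab_le pq unfolding u_def[symmetric] v_def[symmetric] x_def[symmetric] y_def[symmetric]
      by (simp add: abs_le_iff)
    then show ?thesis
      using PA QA unfolding a_def b_def u_def v_def x_def y_def by simp
  qed
  show ?thesis unfolding tv_dist_def
    by (rule cSUP_least) (use main in auto)
qed

lemma tv_dist_bounds:
  assumes "prob_space P" "prob_space Q" "sets P = sets Q" "L \<in> sets P"
  shows "\<bar>measure P L - measure Q L\<bar> \<le> tv_dist P Q" "tv_dist P Q \<le> 1"
proof -
  interpret P: prob_space P by fact
  interpret Q: prob_space Q by fact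
  have b: "\<bar>measure P A - measure Q A\<bar> \<le> 1" for A
    by (smt (verit) P.prob_le_1 Q.prob_le_1 measure_nonneg)
  show "\<bar>measure P L - measure Q L\<bar> \<le> tv_dist P Q" unfolding tv_dist_def
    using assms by (intro cSUP_upper) (auto intro!: bdd_aboveI2[OF b])
  show "tv_dist P Q \<le> 1" unfolding tv_dist_def
    by (rule cSUP_least) (use b in auto)
qed

section \<open>Random mixtures and the posterior of the allocations\<close>

text \<open>The common frame of the two priors: a probability space \<open>S\<close> that carries random weights \<open>w\<close> and
random atoms \<open>t\<close>. Nonnegativity and normalisation of the weights hold almost surely only, since
sticks outside the open unit interval are a null event and not an impossible one.\<close>

locale random_mixture = prob_space S for S :: "'s measure" +
  fixes w :: "'s \<Rightarrow> nat \<Rightarrow> real" and t :: "'s \<Rightarrow> nat \<Rightarrow> real^'d"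
    and f :: "real^'d \<Rightarrow> real" and F :: real
  assumes w_meas [measurable]: "\<And>k. (\<lambda>s. w s k) \<in> borel_measurable S"
    and t_meas [measurable]: "\<And>k. (\<lambda>s. t s k) \<in> borel_measurable S"
    and w_nonneg: "AE s in S. \<forall>k. 0 \<le> w s k"
    and w_sum: "AE s in S. (\<Sum>k. ennreal (w s k)) = 1"
    and f_meas [measurable]: "f \<in> borel_measurable borel"
    and f_pos: "\<And>y. 0 < f y" and f_le: "\<And>y. f y \<le> F"
begin

text \<open>Likelihoods are extended nonnegative numbers, so that sums over labels and integrals over the prior
and the data may be exchanged freely. The set \<open>L\<close> restricts the labels that may generate the observation.\<close>

definition label_lik :: "nat set \<Rightarrow> 's \<Rightarrow> real^'d \<Rightarrow> ennreal" where
  "label_lik L s y = (\<Sum>k. indicator L k * (ennreal (w s k) * ennreal (f (y - t s k))))"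

text \<open>The joint weight of the data and of the label tuples in the box \<open>Pi\<^sub>E {..<n} L\<close>; dividing it by the
evidence gives the posterior mass of the box.\<close>

definition box :: "nat \<Rightarrow> (nat \<Rightarrow> nat set) \<Rightarrow> (nat \<Rightarrow> real^'d) \<Rightarrow> ennreal" where
  "box n L x = (\<integral>\<^sup>+s. (\<Prod>i<n. label_lik (L i) s (x i)) \<partial>S)"

definition evidence :: "nat \<Rightarrow> (nat \<Rightarrow> real^'d) \<Rightarrow> ennreal" where
  "evidence n x = box n (\<lambda>_. UNIV) x"

definition label_post :: "nat \<Rightarrow> (nat \<Rightarrow> real^'d) \<Rightarrow> (nat \<Rightarrow> nat) \<Rightarrow> ennreal" where
  "label_post n x c = box n (\<lambda>i. {c i}) x / evidence n x"

definition posterior :: "nat \<Rightarrow> (nat \<Rightarrow> real^'d) \<Rightarrow> (nat \<Rightarrow> nat) measure" where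
  "posterior n x = point_measure ({..<n} \<rightarrow>\<^sub>E UNIV) (label_post n x)"

lemma label_lik_singleton: "label_lik {k} s y = ennreal (w s k) * ennreal (f (y - t s k))"
proof -
  have "label_lik {k} s y = (\<Sum>j\<in>{k}. indicator {k} j * (ennreal (w s j) * ennreal (f (y - t s j))))"
    unfolding label_lik_def by (rule suminf_finite) auto
  then show ?thesis by simp
qed

lemma label_lik_measurable [measurable]:
  "(\<lambda>z. label_lik L (fst z) (snd z)) \<in> borel_measurable (S \<Otimes>\<^sub>M borel)"
  unfolding label_lik_def by measurable

lemma label_lik_measurable' [measurable]:
  assumes [measurable]: "g \<in> M \<rightarrow>\<^sub>M S" "h \<in> borel_measurable M"
  shows "(\<lambda>z. label_lik L (g z) (h z)) \<in> borel_measurable M"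
  using measurable_compose[OF measurable_Pair[OF assms] label_lik_measurable[of L]] by simp

text \<open>Summing the joint weights of single tuples amounts, by Tonelli's theorem, to expanding the product over the
observations of the sums over the labels.\<close>

lemma nn_integral_count_space_box:
  "(\<integral>\<^sup>+c. (\<Prod>i<n. indicator (L i) (c i)) * box n (\<lambda>i. {c i}) x
      \<partial>count_space ({..<n} \<rightarrow>\<^sub>E UNIV)) = box n L x"
proof -
  have cnt: "countable ({..<n} \<rightarrow>\<^sub>E (UNIV :: nat set))"
    by (rule countable_PiE) auto
  interpret C: sigma_finite_measure "count_space ({..<n} \<rightarrow>\<^sub>E (UNIV :: nat set))"
    using cnt by (rule sigma_finite_measure_count_space_countable)
  have meas: "(\<lambda>(c, s). \<Prod>i<n. indicator (L i) (c i) * label_lik {c i} s (x i)) \<in>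
      borel_measurable (count_space ({..<n} \<rightarrow>\<^sub>E UNIV) \<Otimes>\<^sub>M S)"
  proof (rule measurable_pair_measure_countable1[OF cnt])
    fix c :: "nat \<Rightarrow> nat"
    show "(\<lambda>s. case (c, s) of (c, s) \<Rightarrow> \<Prod>i<n. indicator (L i) (c i) * label_lik {c i} s (x i))
        \<in> borel_measurable S"
      unfolding prod.case by measurable
  qed
  have "(\<integral>\<^sup>+c. (\<Prod>i<n. indicator (L i) (c i)) * box n (\<lambda>i. {c i}) x
      \<partial>count_space ({..<n} \<rightarrow>\<^sub>E UNIV)) =
    (\<integral>\<^sup>+c. \<integral>\<^sup>+s. (\<Prod>i<n. indicator (L i) (c i) * label_lik {c i} s (x i)) \<partial>S
      \<partial>count_space ({..<n} \<rightarrow>\<^sub>E UNIV))"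
    by (intro nn_integral_cong)
      (simp add: box_def prod.distrib nn_integral_cmult del: indicator_eq_0_iff)
  also have "\<dots> = (\<integral>\<^sup>+s. \<integral>\<^sup>+c. (\<Prod>i<n. indicator (L i) (c i) * label_lik {c i} s (x i))
      \<partial>count_space ({..<n} \<rightarrow>\<^sub>E UNIV) \<partial>S)"
    by (rule pair_sigma_finite.Fubini'[OF pair_sigma_finite.intro, symmetric])
      (use meas C.sigma_finite_measure_axioms sigma_finite_measure_axioms in \<open>auto simp: split_beta'\<close>)
  also have "\<dots> = box n L x"
    unfolding box_def
  proof (intro nn_integral_cong)
    fix s
    show "(\<integral>\<^sup>+c. (\<Prod>i<n. indicator (L i) (c i) * label_lik {c i} s (x i))
        \<partial>count_space ({..<n} \<rightarrow>\<^sub>E UNIV)) = (\<Prod>i<n. label_lik (L i) s (x i))"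
      by (subst nn_integral_count_space_PiE_prod[where h="\<lambda>i k. indicator (L i) k * label_lik {k} s (x i)"])
        (auto simp: nn_integral_count_space_nat label_lik_singleton label_lik_def[where L="L _"])
  qed
  finally show ?thesis .
qed

text \<open>The bounds make every posterior well defined: the evidence is finite because the kernel is bounded,
and positive because the kernel is positive and some weight is.\<close>

lemma label_lik_bounds:
  "AE s in S. \<forall>y. label_lik L s y \<le> ennreal F \<and> 0 < label_lik UNIV s y"
  using w_nonneg w_sum
proof eventually_elim
  case (elim s)
  have pos: "0 < label_lik UNIV s y" for y
  proof (rule ccontr)
    assume "\<not> 0 < label_lik UNIV s y"
    then have "label_lik UNIV s y = 0" by (simp add: not_less)
    then have "ennreal (w s k) * ennreal (f (y - t s k)) = 0" for k
      by (auto simp: label_lik_def suminf_eq_zero_iff)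
    then have "ennreal (w s k) = 0" for k
      using f_pos[of "y - t s k"] by (metis ennreal_eq_0_iff mult_eq_0_iff not_le)
    then show False using elim(2) by simp
  qed
  have "label_lik L s y \<le> (\<Sum>k. ennreal (w s k) * ennreal F)" for y
    unfolding label_lik_def
    by (intro suminf_le) (auto simp: indicator_def intro!: mult_left_mono ennreal_leI f_le)
  with elim pos show ?case by auto
qed

lemma box_le: "box n L x \<le> ennreal F ^ n"
proof -
  have "box n L x \<le> (\<integral>\<^sup>+s. ennreal F ^ n \<partial>S)"
    unfolding box_def
  proof (intro nn_integral_mono_AE)
    have "AE s in S. \<forall>i. \<forall>y. label_lik (L i) s y \<le> ennreal F \<and> 0 < label_lik UNIV s y"
      unfolding AE_all_countable using label_lik_bounds by auto
    then show "AE s in S. (\<Prod>i<n. label_lik (L i) s (x i)) \<le> ennreal F ^ n"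
    proof eventually_elim
      case (elim s)
      then have "(\<Prod>i<n. label_lik (L i) s (x i)) \<le> (\<Prod>i<n. ennreal F)"
        by (intro prod_mono_ennreal) auto
      then show ?case by simp
    qed
  qed
  then show ?thesis by (simp add: emeasure_space_1)
qed

lemma box_finite: "box n L x < \<infinity>"
  using box_le[of n L x] by (rule le_less_trans) (simp add: power_less_top_ennreal)

lemma evidence_pos: "0 < evidence n x"
proof (rule ccontr)
  assume "\<not> 0 < evidence n x"
  then have "evidence n x = 0" by (simp add: not_less)
  then have "AE s in S. (\<Prod>i<n. label_lik UNIV s (x i)) = 0"
    unfolding evidence_def box_def by (subst (asm) nn_integral_0_iff_AE) auto
  moreover have "AE s in S. \<forall>y. label_lik UNIV s y \<le> ennreal F \<and> 0 < label_lik UNIV s y"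
    by (rule label_lik_bounds)
  ultimately have "AE s in S. False"
  proof eventually_elim
    case (elim s)
    then show ?case by (auto simp: prod_zero_iff less_le)
  qed
  then show False by simp
qed

lemma evidence_finite: "evidence n x < \<infinity>"
  unfolding evidence_def by (rule box_finite)

lemma emeasure_posterior:
  "emeasure (posterior n x) (Pi\<^sub>E {..<n} L) = box n L x / evidence n x"
proof -
  have "emeasure (posterior n x) (Pi\<^sub>E {..<n} L) =
    (\<integral>\<^sup>+c. indicator (Pi\<^sub>E {..<n} L) c * label_post n x c \<partial>count_space ({..<n} \<rightarrow>\<^sub>E UNIV))"
    unfolding posterior_def by (rule emeasure_point_measure_nn_integral) (auto simp: PiE_iff)
  also have "\<dots> = (\<integral>\<^sup>+c. (\<Prod>i<n. indicator (L i) (c i)) *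
      box n (\<lambda>i. {c i}) x / evidence n x \<partial>count_space ({..<n} \<rightarrow>\<^sub>E UNIV))"
  proof (rule nn_integral_cong)
    fix c assume "c \<in> space (count_space ({..<n} \<rightarrow>\<^sub>E (UNIV::nat set)))"
    then have c: "c \<in> {..<n} \<rightarrow>\<^sub>E UNIV" by simp
    have "(\<Prod>i<n. indicator (L i) (c i) :: ennreal) = indicator (Pi\<^sub>E {..<n} L) c"
      using c by (auto simp: indicator_def PiE_iff intro!: prod.neutral prod_zero)
    then show "indicator (Pi\<^sub>E {..<n} L) c * label_post n x c =
      (\<Prod>i<n. indicator (L i) (c i)) * box n (\<lambda>i. {c i}) x / evidence n x"
      using c by (simp add: label_post_def ennreal_times_divide)
  qed
  also have "\<dots> = box n L x / evidence n x"
    by (subst nn_integral_divide) (auto simp: nn_integral_count_space_box)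
  finally show ?thesis .
qed

lemma prob_space_posterior: "prob_space (posterior n x)"
proof
  have "space (posterior n x) = {..<n} \<rightarrow>\<^sub>E UNIV"
    by (simp add: posterior_def space_point_measure)
  then show "emeasure (posterior n x) (space (posterior n x)) = 1"
    using emeasure_posterior[of n x "\<lambda>_. UNIV"] evidence_pos[of n x] evidence_finite[of n x]
    by (simp flip: evidence_def)
qed

lemma space_posterior: "space (posterior n x) = {..<n} \<rightarrow>\<^sub>E UNIV"
  by (simp add: posterior_def space_point_measure)

lemma sets_posterior: "sets (posterior n x) = Pow ({..<n} \<rightarrow>\<^sub>E UNIV)"
  by (simp add: posterior_def sets_point_measure)

lemma box_measurable [measurable]:
  "box n L \<in> borel_measurable (PiM UNIV (\<lambda>_. borel))"
  unfolding box_def by measurable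

lemma evidence_measurable [measurable]:
  "evidence n \<in> borel_measurable (PiM UNIV (\<lambda>_. borel))"
  unfolding evidence_def by measurable

lemma label_post_measurable [measurable]:
  "(\<lambda>x. label_post n x c) \<in> borel_measurable (PiM UNIV (\<lambda>_. borel))"
  unfolding label_post_def by measurable

end

text \<open>This identity holds for every \<open>w\<close>, also on the null event where some weights are negative or
not summable: negative weights are cut off by \<open>ennreal\<close>, and the Bochner integral of a nonnegative function
with infinite integral is \<open>0 = enn2real \<top>\<close>. So the likelihood depends on the sticks in a measurable way everywhere.\<close>

lemma mixture_discrete:
  assumes [measurable]: "f \<in> borel_measurable borel" and f: "\<And>y. 0 \<le> f y"
  shows "mixture f (discrete_measure UNIV w u) y =
    enn2real (\<Sum>k. ennreal (w k) * ennreal (f (y - u k)))"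
proof -
  have "mixture f (discrete_measure UNIV w u) y =
    (\<integral>k. f (y - u k) \<partial>point_measure UNIV (\<lambda>k. ennreal (w k)))"
    unfolding mixture_def discrete_measure_def by (subst integral_distr) auto
  also have "\<dots> = enn2real (\<integral>\<^sup>+k. ennreal (f (y - u k)) \<partial>point_measure UNIV (\<lambda>k. ennreal (w k)))"
    using f by (intro integral_eq_nn_integral) auto
  also have "(\<integral>\<^sup>+k. ennreal (f (y - u k)) \<partial>point_measure UNIV (\<lambda>k. ennreal (w k))) =
    (\<Sum>k. ennreal (w k) * ennreal (f (y - u k)))"
    unfolding point_measure_def
    by (subst nn_integral_density) (auto simp: nn_integral_count_space_nat)
  finally show ?thesis .
qed

text \<open>Numerator and denominator of the posterior are Bochner integrals of almost surely nonnegative bounded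
functions, hence they agree with the nonnegative integrals of the present frame.\<close>

lemma allocation_posterior_eq:
  fixes W :: "(nat \<Rightarrow> real) \<Rightarrow> nat \<Rightarrow> real" and f :: "real^'d \<Rightarrow> real"
  assumes "random_mixture S (\<lambda>s. W (fst s)) snd f F"
  shows "allocation_posterior f S W n x = random_mixture.posterior S (\<lambda>s. W (fst s)) snd f n x"
proof -
  interpret random_mixture S "\<lambda>s. W (fst s)" snd f F by fact
  have mix: "mixture f (discrete_measure UNIV (W v) u) y = enn2real (label_lik UNIV (v, u) y)"
    for v u y
    using f_pos by (subst mixture_discrete) (auto simp: label_lik_def less_imp_le)
  have num: "(\<integral>(v, u). (\<Prod>i<n. W v (c i) * f (x i - u (c i))) \<partial>S) = enn2real (box n (\<lambda>i. {c i}) x)" for c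
  proof -
    have "AE s in S. 0 \<le> (\<Prod>i<n. W (fst s) (c i) * f (x i - snd s (c i)))"
      using w_nonneg by eventually_elim (auto intro!: prod_nonneg mult_nonneg_nonneg less_imp_le[OF f_pos])
    then have "(\<integral>s. (\<Prod>i<n. W (fst s) (c i) * f (x i - snd s (c i))) \<partial>S) =
      enn2real (\<integral>\<^sup>+s. ennreal (\<Prod>i<n. W (fst s) (c i) * f (x i - snd s (c i))) \<partial>S)"
      by (intro integral_eq_nn_integral) measurable
    also have "(\<integral>\<^sup>+s. ennreal (\<Prod>i<n. W (fst s) (c i) * f (x i - snd s (c i))) \<partial>S) = box n (\<lambda>i. {c i}) x"
      unfolding box_def
    proof (intro nn_integral_cong_AE)
      show "AE s in S. ennreal (\<Prod>i<n. W (fst s) (c i) * f (x i - snd s (c i))) =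
          (\<Prod>i<n. label_lik {c i} s (x i))"
        using w_nonneg
      proof eventually_elim
        case (elim s)
        then show ?case
          using less_imp_le[OF f_pos]
          by (subst prod_ennreal[symmetric]) (auto simp: label_lik_singleton ennreal_mult)
      qed
    qed
    finally show ?thesis by (simp add: split_beta')
  qed
  have den: "(\<integral>(v, u). (\<Prod>i<n. mixture f (discrete_measure UNIV (W v) u) (x i)) \<partial>S) =
    enn2real (evidence n x)"
  proof -
    have "(\<integral>s. (\<Prod>i<n. enn2real (label_lik UNIV s (x i))) \<partial>S) =
      enn2real (\<integral>\<^sup>+s. ennreal (\<Prod>i<n. enn2real (label_lik UNIV s (x i))) \<partial>S)"
      by (intro integral_eq_nn_integral) (auto intro!: prod_nonneg)
    also have "(\<integral>\<^sup>+s. ennreal (\<Prod>i<n. enn2real (label_lik UNIV s (x i))) \<partial>S) = evidence n x"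
      unfolding evidence_def box_def
    proof (intro nn_integral_cong_AE)
      show "AE s in S. ennreal (\<Prod>i<n. enn2real (label_lik UNIV s (x i))) =
          (\<Prod>i<n. label_lik UNIV s (x i))"
        using label_lik_bounds[of UNIV]
      proof eventually_elim
        case (elim s)
        then have "label_lik UNIV s y < top" for y
          by (meson ennreal_less_top le_less_trans)
        then show ?case
          by (subst prod_ennreal[symmetric]) auto
      qed
    qed
    finally show ?thesis by (simp add: mix split_beta')
  qed
  have "ennreal (enn2real (box n (\<lambda>i. {c i}) x) / enn2real (evidence n x)) = label_post n x c" for c
  proof -
    have "0 < enn2real (evidence n x)"
      using evidence_pos[of n x] evidence_finite[of n x] by (simp add: enn2real_positive_iff)
    then have "ennreal (enn2real (box n (\<lambda>i. {c i}) x) / enn2real (evidence n x)) =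
      ennreal (enn2real (box n (\<lambda>i. {c i}) x)) / ennreal (enn2real (evidence n x))"
      by (simp add: divide_ennreal)
    then show ?thesis
      using box_finite[of n "\<lambda>i. {c i}" x] evidence_finite[of n x] by (simp add: label_post_def)
  qed
  then show ?thesis
    unfolding allocation_posterior_def posterior_def num den by simp
qed

text \<open>The set where one posterior weight exceeds the other depends on the data, but the number of tuples
is countable, so measurability can be checked for each tuple separately.\<close>

lemma tv_dist_posterior_measurable:
  fixes f :: "real^'d \<Rightarrow> real"
  assumes "random_mixture S w t f F" "random_mixture S' w' t' f F"
  shows "(\<lambda>x. tv_dist (random_mixture.posterior S w t f n x) (random_mixture.posterior S' w' t' f n x))
    \<in> borel_measurable (PiM UNIV (\<lambda>_. borel))"
proof -
  interpret A: random_mixture S w t f F by fact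
  interpret B: random_mixture S' w' t' f F by fact
  let ?C = "{..<n} \<rightarrow>\<^sub>E (UNIV :: nat set)"
  let ?A = "\<lambda>x. {c \<in> ?C. B.label_post n x c < A.label_post n x c}"
  have cnt: "countable ?C" by (rule countable_PiE) auto
  interpret C: sigma_finite_measure "count_space ?C"
    using cnt by (rule sigma_finite_measure_count_space_countable)
  have tv: "tv_dist (A.posterior n x) (B.posterior n x) =
      enn2real (\<integral>\<^sup>+c. indicator (?A x) c * A.label_post n x c \<partial>count_space ?C) -
      enn2real (\<integral>\<^sup>+c. indicator (?A x) c * B.label_post n x c \<partial>count_space ?C)" for x
    using tv_dist_point_measure[OF A.prob_space_posterior[unfolded A.posterior_def]
        B.prob_space_posterior[unfolded B.posterior_def], of n x x]
    unfolding A.posterior_def B.posterior_def measure_def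
    by (subst (asm) (1 2) emeasure_point_measure_nn_integral) auto
  have m: "(\<lambda>x. \<integral>\<^sup>+c. indicator (?A x) c * g x c \<partial>count_space ?C) \<in>
      borel_measurable (PiM UNIV (\<lambda>_. borel))"
    if [measurable]: "\<And>c. (\<lambda>x. g x c) \<in> borel_measurable (PiM UNIV (\<lambda>_. borel))"
    for g :: "(nat \<Rightarrow> real^'d) \<Rightarrow> (nat \<Rightarrow> nat) \<Rightarrow> ennreal"
  proof -
    have "(\<lambda>(c, x). indicator (?A x) c * g x c) \<in>
        borel_measurable (count_space ?C \<Otimes>\<^sub>M PiM UNIV (\<lambda>_. borel))"
      by (rule measurable_pair_measure_countable1[OF cnt]) (simp add: indicator_def cong: conj_cong)
    then have "(\<lambda>(x, c). indicator (?A x) c * g x c) \<in>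
        borel_measurable (PiM UNIV (\<lambda>_. borel) \<Otimes>\<^sub>M count_space ?C)"
      by (subst (asm) measurable_pair_swap_iff) (simp add: split_beta')
    then show ?thesis by (rule C.borel_measurable_nn_integral)
  qed
  show ?thesis unfolding tv
    using m[OF A.label_post_measurable] m[OF B.label_post_measurable] by measurable
qed

section \<open>Stick breaking\<close>

lemma nn_integral_PiM_prod:
  assumes M: "\<And>i. prob_space (M i)" and J: "finite J" "J \<subseteq> I"
    and h: "\<And>i. i \<in> J \<Longrightarrow> h i \<in> borel_measurable (M i)"
  shows "(\<integral>\<^sup>+x. (\<Prod>i\<in>J. h i (x i)) \<partial>PiM I M) = (\<Prod>i\<in>J. \<integral>\<^sup>+y. h i y \<partial>M i)"
proof -
  interpret M: prob_space "M i" for i by (rule M)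
  interpret product_prob_space M I by unfold_locales
  note h[measurable]
  have "(\<integral>\<^sup>+x. (\<Prod>i\<in>J. h i (x i)) \<partial>PiM I M) =
    (\<integral>\<^sup>+x. (\<Prod>i\<in>J. h i (x i)) \<partial>distr (PiM I M) (PiM J M) (\<lambda>x. restrict x J))"
    using J by (subst nn_integral_distr) (auto intro!: measurable_restrict_subset)
  also have "\<dots> = (\<Prod>i\<in>J. \<integral>\<^sup>+y. h i y \<partial>M i)"
    using J h by (subst distr_PiM_restrict_finite) (auto simp: product_nn_integral_prod)
  finally show ?thesis .
qed

lemma sets_beta_law [simp, measurable_cong]: "sets (beta_law a b) = sets borel"
  by (simp add: beta_law_def)

lemma space_beta_law [simp]: "space (beta_law a b) = UNIV"
  by (simp add: beta_law_def)

text \<open>It is convenient to work with the rest \<open>1 - v\<close> of a stick, which has the density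
\<open>\<alpha> * u powr (\<alpha> - 1)\<close> on the unit interval.\<close>

lemma nn_integral_beta_law_one:
  fixes \<alpha> :: real
  assumes \<alpha>: "0 < \<alpha>" and [measurable]: "g \<in> borel_measurable borel"
  shows "(\<integral>\<^sup>+v. g (1 - v) \<partial>beta_law 1 \<alpha>) =
    (\<integral>\<^sup>+u. ennreal (indicator {0<..<1} u * (\<alpha> * u powr (\<alpha> - 1))) * g u \<partial>lborel)"
proof -
  have B: "Beta 1 \<alpha> = 1 / \<alpha>"
    using \<alpha> Gamma_plus1[of \<alpha>] Gamma_real_pos[of \<alpha>]
    by (simp add: Beta_def add.commute field_simps nonpos_Ints_def less_imp_neq[symmetric])
  have "(\<integral>\<^sup>+v. g (1 - v) \<partial>beta_law 1 \<alpha>) =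
    (\<integral>\<^sup>+v. ennreal (indicator {0<..<1} v * (v powr (1 - 1) * (1 - v) powr (\<alpha> - 1) / Beta 1 \<alpha>)) * g (1 - v)
      \<partial>lborel)"
    unfolding beta_law_def by (subst nn_integral_density) auto
  also have "\<dots> = (\<integral>\<^sup>+v. ennreal (indicator {0<..<1} (1 - v) * (\<alpha> * (1 - v) powr (\<alpha> - 1))) * g (1 - v)
      \<partial>lborel)"
    by (intro nn_integral_cong) (auto simp: indicator_def B mult.commute)
  also have "\<dots> = (\<integral>\<^sup>+u. ennreal (indicator {0<..<1} u * (\<alpha> * u powr (\<alpha> - 1))) * g u \<partial>lborel)"
    by (subst (2) nn_integral_real_affine[where c="-1" and t=1]) auto
  finally show ?thesis .
qed

lemma nn_integral_powr_Icc:
  fixes a c :: real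
  assumes "-1 < a" "0 \<le> c"
  shows "(\<integral>\<^sup>+u. ennreal (indicator {0..c} u * u powr a) \<partial>lborel) = ennreal (c powr (a + 1) / (a + 1))"
  using nn_integral_has_integral_lebesgue[OF _ has_integral_powr_from_0[OF assms]] by simp

text \<open>The case \<open>s = 1\<close> shows that the unallocated mass decays geometrically, negative \<open>s\<close> show that it
is not too small; and \<open>s = 0\<close> is the normalisation of the density.\<close>

lemma beta_law_moment:
  fixes \<alpha> s :: real
  assumes \<alpha>: "0 < \<alpha>" and s: "0 < \<alpha> + s"
  shows "(\<integral>\<^sup>+v. ennreal ((1 - v) powr s) \<partial>beta_law 1 \<alpha>) = ennreal (\<alpha> / (\<alpha> + s))"
proof -
  have "(\<integral>\<^sup>+v. ennreal ((1 - v) powr s) \<partial>beta_law 1 \<alpha>) =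
    (\<integral>\<^sup>+u. ennreal (indicator {0<..<1} u * (\<alpha> * u powr (\<alpha> - 1))) * ennreal (u powr s) \<partial>lborel)"
    using \<alpha> by (subst nn_integral_beta_law_one) auto
  also have "\<dots> = (\<integral>\<^sup>+u. ennreal \<alpha> * ennreal (indicator {0..1} u * u powr (\<alpha> + s - 1)) \<partial>lborel)"
  proof (intro nn_integral_cong_AE)
    have "AE u in lborel. u \<noteq> (0::real)" "AE u in lborel. u \<noteq> (1::real)"
      using AE_lborel_singleton by auto
    then show "AE u in lborel. ennreal (indicator {0<..<1} u * (\<alpha> * u powr (\<alpha> - 1))) * ennreal (u powr s) =
        ennreal \<alpha> * ennreal (indicator {0..1} u * u powr (\<alpha> + s - 1))"
    proof eventually_elim
      case (elim u)
      have "u powr (\<alpha> - 1) * u powr s = u powr (\<alpha> + s - 1)"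
        by (subst powr_add[symmetric]) (simp add: algebra_simps)
      then show ?case
        using elim \<alpha> by (auto simp: indicator_def ennreal_mult[symmetric] mult.assoc)
    qed
  qed
  also have "\<dots> = ennreal \<alpha> * ennreal (1 powr (\<alpha> + s) / (\<alpha> + s))"
    using nn_integral_powr_Icc[of "\<alpha> + s - 1" 1] s by (simp add: nn_integral_cmult)
  also have "\<dots> = ennreal (\<alpha> / (\<alpha> + s))"
    using \<alpha> s by (simp add: ennreal_mult[symmetric])
  finally show ?thesis .
qed

lemma prob_space_beta_law: "0 < \<alpha> \<Longrightarrow> prob_space (beta_law 1 \<alpha>)"
proof
  assume \<alpha>: "0 < \<alpha>"
  have "emeasure (beta_law 1 \<alpha>) UNIV = (\<integral>\<^sup>+v. 1 \<partial>beta_law 1 \<alpha>)" by simp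
  also have "\<dots> = (\<integral>\<^sup>+u. ennreal (indicator {0<..<1} u * (\<alpha> * u powr (\<alpha> - 1))) * 1 \<partial>lborel)"
    using \<alpha> by (subst nn_integral_beta_law_one[where g="\<lambda>_. 1", OF \<alpha>]) auto
  also have "\<dots> = (\<integral>\<^sup>+u. ennreal (indicator {0<..<1} u * (\<alpha> * u powr (\<alpha> - 1))) * ennreal (u powr 0) \<partial>lborel)"
    by (intro nn_integral_cong) (auto simp: indicator_def)
  also have "\<dots> = 1"
    using \<alpha> beta_law_moment[of \<alpha> 0]
    by (subst nn_integral_beta_law_one[symmetric]) auto
  finally show "emeasure (beta_law 1 \<alpha>) (space (beta_law 1 \<alpha>)) = 1" by simp
qed

lemma AE_beta_law: "AE v in beta_law 1 \<alpha>. 0 < v \<and> v < 1"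
  unfolding beta_law_def by (subst AE_density) (auto simp: indicator_def)

lemma emeasure_beta_law_Icc:
  assumes "\<And>v. a \<le> v \<and> v \<le> b \<longleftrightarrow> 1 - v \<in> A"
  shows "emeasure (beta_law 1 \<alpha>) {a..b} = (\<integral>\<^sup>+v. indicator A (1 - v) \<partial>beta_law 1 \<alpha>)"
proof -
  have "emeasure (beta_law 1 \<alpha>) {a..b} = (\<integral>\<^sup>+v. indicator {a..b} v \<partial>beta_law 1 \<alpha>)"
    by (rule nn_integral_indicator[symmetric]) simp
  also have "\<dots> = (\<integral>\<^sup>+v. indicator A (1 - v) \<partial>beta_law 1 \<alpha>)"
    using assms by (intro nn_integral_cong) (auto simp: indicator_def)
  finally show ?thesis .
qed

text \<open>The exponent \<open>\<alpha>\<close>, in contrast to the exponent \<open>1\<close> at inner points, is the source of the dependence of the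
evidence on \<open>\<alpha>\<close>.\<close>

lemma emeasure_beta_law_top:
  assumes \<alpha>: "0 < \<alpha>" and \<delta>: "0 < \<delta>" "\<delta> \<le> 1"
  shows "emeasure (beta_law 1 \<alpha>) {1 - \<delta>..1} = ennreal (\<delta> powr \<alpha>)"
proof -
  have "emeasure (beta_law 1 \<alpha>) {1 - \<delta>..1} = (\<integral>\<^sup>+v. indicator {0..\<delta>} (1 - v) \<partial>beta_law 1 \<alpha>)"
    by (rule emeasure_beta_law_Icc) auto
  also have "\<dots> = (\<integral>\<^sup>+u. ennreal (indicator {0<..<1} u * (\<alpha> * u powr (\<alpha> - 1))) * indicator {0..\<delta>} u \<partial>lborel)"
    using \<alpha> by (subst nn_integral_beta_law_one) auto
  also have "\<dots> = (\<integral>\<^sup>+u. ennreal \<alpha> * ennreal (indicator {0..\<delta>} u * u powr (\<alpha> - 1)) \<partial>lborel)"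
  proof (intro nn_integral_cong_AE)
    have "AE u in lborel. u \<noteq> (0::real)" "AE u in lborel. u \<noteq> (1::real)"
      using AE_lborel_singleton by auto
    then show "AE u in lborel. ennreal (indicator {0<..<1} u * (\<alpha> * u powr (\<alpha> - 1))) * indicator {0..\<delta>} u =
        ennreal \<alpha> * ennreal (indicator {0..\<delta>} u * u powr (\<alpha> - 1))"
      by eventually_elim (use \<alpha> \<delta> in \<open>auto simp: indicator_def ennreal_mult\<close>)
  qed
  also have "\<dots> = ennreal \<alpha> * ennreal (\<delta> powr \<alpha> / \<alpha>)"
    using nn_integral_powr_Icc[of "\<alpha> - 1" \<delta>] \<alpha> \<delta> by (simp add: nn_integral_cmult)
  also have "\<dots> = ennreal (\<delta> powr \<alpha>)"
    using \<alpha> by (simp add: ennreal_mult[symmetric])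
  finally show ?thesis .
qed

lemma emeasure_beta_law_inner:
  assumes \<alpha>: "0 < \<alpha>" and a: "0 < a" "a < 1"
  shows "\<exists>c>0. \<forall>\<delta>. 0 < \<delta> \<and> \<delta> \<le> a / 2 \<longrightarrow> ennreal (c * \<delta>) \<le> emeasure (beta_law 1 \<alpha>) {a - \<delta>..a}"
proof -
  \<comment> \<open>In terms of \<open>u = 1 - v\<close> the density \<open>\<alpha> * u powr (\<alpha> - 1)\<close> is monotone, so on \<open>{1 - a..1}\<close> it is at
    least the smaller of its values at the two end points.\<close>
  define c where "c = \<alpha> * min ((1 - a) powr (\<alpha> - 1)) 1"
  have c: "0 < c" using \<alpha> a by (simp add: c_def)
  have "ennreal (c * \<delta>) \<le> emeasure (beta_law 1 \<alpha>) {a - \<delta>..a}" if \<delta>: "0 < \<delta>" "\<delta> \<le> a / 2" for \<delta>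
  proof -
    have "ennreal (c * \<delta>) = (\<integral>\<^sup>+u. ennreal c * indicator {1 - a..1 - a + \<delta>} u \<partial>lborel)"
      using c \<delta> by (subst nn_integral_cmult_indicator) (auto simp: ennreal_mult)
    also have "\<dots> \<le> (\<integral>\<^sup>+u. ennreal (indicator {0<..<1} u * (\<alpha> * u powr (\<alpha> - 1))) *
        indicator {1 - a..1 - a + \<delta>} u \<partial>lborel)"
    proof (intro nn_integral_mono)
      fix u
      have "c \<le> \<alpha> * u powr (\<alpha> - 1)" if u: "1 - a \<le> u" "u \<le> 1 - a + \<delta>"
      proof (cases "1 \<le> \<alpha>")
        case True
        then have "(1 - a) powr (\<alpha> - 1) \<le> u powr (\<alpha> - 1)" using a u by (intro powr_mono2) auto
        then show ?thesis using \<alpha> by (auto simp: c_def min_def intro!: mult_left_mono)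
      next
        case False
        then have "1 powr (\<alpha> - 1) \<le> u powr (\<alpha> - 1)" using a u \<delta> by (intro powr_mono2') auto
        then show ?thesis using \<alpha> by (auto simp: c_def min_def intro!: mult_left_mono)
      qed
      then show "ennreal c * indicator {1 - a..1 - a + \<delta>} u \<le>
          ennreal (indicator {0<..<1} u * (\<alpha> * u powr (\<alpha> - 1))) * indicator {1 - a..1 - a + \<delta>} u"
        using a \<delta> by (auto simp: indicator_def intro!: ennreal_leI)
    qed
    also have "\<dots> = (\<integral>\<^sup>+v. indicator {1 - a..1 - a + \<delta>} (1 - v) \<partial>beta_law 1 \<alpha>)"
      using \<alpha> by (subst nn_integral_beta_law_one) auto
    also have "\<dots> = emeasure (beta_law 1 \<alpha>) {a - \<delta>..a}"
      by (rule emeasure_beta_law_Icc[symmetric]) auto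
    finally show ?thesis .
  qed
  with c show ?thesis by blast
qed

definition stick_rest :: "nat \<Rightarrow> (nat \<Rightarrow> real) \<Rightarrow> real" where
  "stick_rest N v = (\<Prod>j<N. 1 - v j)"

lemma sum_stick_weight: "(\<Sum>k<N. stick_weight v k) = 1 - stick_rest N v"
  by (induction N) (auto simp: stick_rest_def stick_weight_def algebra_simps)

lemma stick_rest_measurable [measurable]:
  "stick_rest N \<in> borel_measurable (PiM UNIV (\<lambda>_. beta_law 1 \<alpha>))"
  unfolding stick_rest_def by measurable

lemma stick_weight_measurable [measurable]:
  "(\<lambda>v. stick_weight v k) \<in> borel_measurable (PiM UNIV (\<lambda>_. beta_law 1 \<alpha>))"
  unfolding stick_weight_def by measurable

lemma AE_sticks:
  assumes "0 < \<alpha>"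
  shows "AE v in PiM UNIV (\<lambda>_::nat. beta_law 1 \<alpha>). \<forall>j. 0 < v j \<and> v j < 1"
proof -
  interpret prob_space "beta_law 1 \<alpha>" using assms by (rule prob_space_beta_law)
  interpret product_prob_space "\<lambda>_::nat. beta_law 1 \<alpha>" UNIV by unfold_locales
  show ?thesis
    unfolding AE_all_countable using AE_component[OF _ AE_beta_law] by auto
qed

lemma nn_integral_stick_rest_powr:
  assumes \<alpha>: "0 < \<alpha>" and s: "0 < \<alpha> + s"
  shows "(\<integral>\<^sup>+v. ennreal (stick_rest N v powr s) \<partial>PiM UNIV (\<lambda>_. beta_law 1 \<alpha>)) =
    ennreal ((\<alpha> / (\<alpha> + s)) ^ N)"
proof -
  have "(\<integral>\<^sup>+v. ennreal (stick_rest N v powr s) \<partial>PiM UNIV (\<lambda>_. beta_law 1 \<alpha>)) =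
    (\<integral>\<^sup>+v. (\<Prod>j<N. ennreal ((1 - v j) powr s)) \<partial>PiM UNIV (\<lambda>_. beta_law 1 \<alpha>))"
  proof (intro nn_integral_cong_AE)
    show "AE v in PiM UNIV (\<lambda>_. beta_law 1 \<alpha>).
        ennreal (stick_rest N v powr s) = (\<Prod>j<N. ennreal ((1 - v j) powr s))"
      using AE_sticks[OF \<alpha>]
    proof eventually_elim
      case (elim v)
      then show ?case unfolding stick_rest_def
        by (subst prod_ennreal) (auto simp: prod_powr_distrib less_imp_le)
    qed
  qed
  also have "\<dots> = (\<Prod>j<N. ennreal (\<alpha> / (\<alpha> + s)))"
    using \<alpha> s by (subst nn_integral_PiM_prod) (auto simp: prob_space_beta_law beta_law_moment)
  also have "\<dots> = ennreal ((\<alpha> / (\<alpha> + s)) ^ N)"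
    using \<alpha> s by (subst prod_ennreal) auto
  finally show ?thesis .
qed

lemma stick_rest_bounds:
  assumes "\<forall>j. 0 < v j \<and> v j < (1::real)"
  shows "0 < stick_rest N v" "stick_rest N v \<le> 1" "0 < stick_weight v k"
  using assms
  by (auto simp: stick_rest_def stick_weight_def less_imp_le intro!: prod_pos prod_le_1 mult_pos_pos)

lemma sum_ennreal_stick_weight:
  assumes "\<forall>j. 0 < v j \<and> v j < (1::real)"
  shows "(\<Sum>k<N. ennreal (stick_weight v k)) = ennreal (1 - stick_rest N v)"
  using stick_rest_bounds[OF assms] by (subst sum_ennreal) (auto simp: sum_stick_weight less_imp_le)

text \<open>The missing mass \<open>1 - (\<Sum>k. stick_weight v k)\<close> is below \<open>stick_rest N v\<close> for every \<open>N\<close>, so its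
expectation is below a geometric sequence and vanishes.\<close>

lemma AE_suminf_stick_weight:
  assumes \<alpha>: "0 < \<alpha>"
  shows "AE v in PiM UNIV (\<lambda>_::nat. beta_law 1 \<alpha>). (\<Sum>k. ennreal (stick_weight v k)) = 1"
proof -
  let ?V = "PiM UNIV (\<lambda>_::nat. beta_law 1 \<alpha>)" and ?d = "\<lambda>v. 1 - (\<Sum>k. ennreal (stick_weight v k))"
  have part: "AE v in ?V. (\<Sum>k. ennreal (stick_weight v k)) \<le> 1 \<and> (\<forall>N. ?d v \<le> ennreal (stick_rest N v powr 1))"
    using AE_sticks[OF \<alpha>]
  proof eventually_elim
    case (elim v)
    note r = stick_rest_bounds[OF elim]
    have "(\<Sum>k. ennreal (stick_weight v k)) \<le> 1"
      using r(1) by (intro suminf_le_const summableI)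
        (simp add: sum_ennreal_stick_weight[OF elim] less_imp_le)
    moreover have "?d v \<le> ennreal (stick_rest N v powr 1)" for N
    proof -
      have "ennreal (1 - stick_rest N v) \<le> (\<Sum>k. ennreal (stick_weight v k))"
        unfolding sum_ennreal_stick_weight[OF elim, symmetric] by (rule sum_le_suminf) auto
      then have "?d v \<le> 1 - ennreal (1 - stick_rest N v)" by (rule ennreal_minus_mono[OF order_refl])
      also have "\<dots> = ennreal (stick_rest N v powr 1)"
        using r(1,2)[of N] by (simp add: ennreal_1[symmetric] ennreal_minus del: ennreal_1)
      finally show ?thesis .
    qed
    ultimately show ?case by blast
  qed
  have "(\<integral>\<^sup>+v. ?d v \<partial>?V) \<le> ennreal ((\<alpha> / (\<alpha> + 1)) ^ N)" for N
  proof -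
    have "(\<integral>\<^sup>+v. ?d v \<partial>?V) \<le> (\<integral>\<^sup>+v. ennreal (stick_rest N v powr 1) \<partial>?V)"
      by (intro nn_integral_mono_AE) (use part in eventually_elim, auto)
    then show ?thesis using nn_integral_stick_rest_powr[of \<alpha> 1 N] \<alpha> by simp
  qed
  moreover have "(\<lambda>N. ennreal ((\<alpha> / (\<alpha> + 1)) ^ N)) \<longlonglongrightarrow> ennreal 0"
    using \<alpha> by (intro tendsto_ennrealI LIMSEQ_power_zero) auto
  ultimately have "(\<integral>\<^sup>+v. ?d v \<partial>?V) \<le> 0"
    by (intro LIMSEQ_le_const[where X="\<lambda>N. ennreal ((\<alpha> / (\<alpha> + 1)) ^ N)"]) auto
  then have "(\<integral>\<^sup>+v. ?d v \<partial>?V) = 0" by simp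
  then have "AE v in ?V. ?d v = 0"
    by (subst (asm) nn_integral_0_iff_AE) auto
  with part show ?thesis
    by eventually_elim (auto simp: diff_eq_0_iff_ennreal intro!: antisym)
qed

lemma trunc_weight_eq: "k < N \<Longrightarrow> trunc_weight N v k = stick_weight v k"
  by (simp add: trunc_weight_def)

lemma trunc_weight_sum_nonneg:
  assumes "\<forall>j. 0 < v j \<and> v j < (1::real)"
  shows "0 \<le> trunc_weight N v k" "(\<Sum>k. ennreal (trunc_weight N v k)) = 1"
proof -
  show nn: "0 \<le> trunc_weight N v k" for k
    using stick_rest_bounds[OF assms] by (auto simp: trunc_weight_def sum_stick_weight less_imp_le)
  have "(\<Sum>k. ennreal (trunc_weight N v k)) = (\<Sum>k\<in>{..N}. ennreal (trunc_weight N v k))"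
    by (rule suminf_finite) (auto simp: trunc_weight_def)
  also have "\<dots> = ennreal (\<Sum>k\<in>{..N}. trunc_weight N v k)"
    using nn by (subst sum_ennreal) auto
  also have "(\<Sum>k\<in>{..N}. trunc_weight N v k) = 1"
    by (simp add: lessThan_Suc_atMost[symmetric] trunc_weight_def)
  finally show "(\<Sum>k. ennreal (trunc_weight N v k)) = 1" by simp
qed

text \<open>Both priors are realised on the space of the Dirichlet process; the truncated one ignores all but
finitely many coordinates.\<close>

locale dp_prior =
  fixes \<alpha> :: real and P0 :: "(real^'d) measure" and f :: "real^'d \<Rightarrow> real" and F :: real
  assumes \<alpha>: "0 < \<alpha>" and P0: "prob_space P0" and sets_P0 [simp, measurable_cong]: "sets P0 = sets borel"
    and f_meas [measurable]: "f \<in> borel_measurable borel"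
    and f_pos: "\<And>y. 0 < f y" and f_le: "\<And>y. f y \<le> F"
begin

abbreviation "V \<equiv> PiM (UNIV :: nat set) (\<lambda>_. beta_law 1 \<alpha>)"
abbreviation "T \<equiv> PiM (UNIV :: nat set) (\<lambda>_. P0)"

lemma prob_V: "prob_space V" by (intro prob_space_PiM prob_space_beta_law \<alpha>)
lemma prob_T: "prob_space T" by (intro prob_space_PiM P0)

lemma space_P0 [simp]: "space P0 = UNIV"
  using sets_P0 by (metis sets_eq_imp_space_eq space_borel)

lemma dp_sticks_eq: "dp_sticks \<alpha> P0 = V \<Otimes>\<^sub>M T"
  by (simp add: dp_sticks_def)

sublocale V: prob_space V by (rule prob_V)
sublocale T: prob_space T by (rule prob_T)
sublocale VT: pair_prob_space V T ..

lemma prob_dp: "prob_space (dp_sticks \<alpha> P0)"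
  unfolding dp_sticks_eq by unfold_locales

lemma fst_meas [measurable]: "fst \<in> measurable (dp_sticks \<alpha> P0) V"
  and snd_meas [measurable]: "snd \<in> measurable (dp_sticks \<alpha> P0) T"
  by (simp_all add: dp_sticks_eq)

lemma distr_dp_fst: "distr (dp_sticks \<alpha> P0) V fst = V"
  unfolding dp_sticks_eq by (rule T.distr_pair_fst)

lemma AE_dp: "AE v in V. P v \<Longrightarrow> AE s in dp_sticks \<alpha> P0. P (fst s)"
proof -
  assume a: "AE v in V. P v"
  have "AE v in distr (dp_sticks \<alpha> P0) V fst. P v"
    by (subst distr_dp_fst) (rule a)
  then show ?thesis
    by (rule AE_distrD[rotated]) simp
qed

lemma nn_integral_dp: "g \<in> borel_measurable V \<Longrightarrow> (\<integral>\<^sup>+s. g (fst s) \<partial>dp_sticks \<alpha> P0) = (\<integral>\<^sup>+v. g v \<partial>V)"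
proof -
  assume [measurable]: "g \<in> borel_measurable V"
  have "(\<integral>\<^sup>+v. g v \<partial>distr (dp_sticks \<alpha> P0) V fst) = (\<integral>\<^sup>+s. g (fst s) \<partial>dp_sticks \<alpha> P0)"
    by (rule nn_integral_distr) auto
  then show ?thesis by (subst (asm) distr_dp_fst) simp
qed

lemma AE_sticks_dp: "AE s in dp_sticks \<alpha> P0. \<forall>j. 0 < fst s j \<and> fst s j < 1"
  by (intro AE_dp AE_sticks \<alpha>)

lemma atom_meas: "(\<lambda>s. snd s k) \<in> borel_measurable (dp_sticks \<alpha> P0)"
proof -
  have "(\<lambda>t. t k) \<in> measurable T P0" by measurable
  from measurable_compose[OF snd_meas this] show ?thesis by (simp cong: measurable_cong_sets)
qed

lemma random_mixture_dp: "random_mixture (dp_sticks \<alpha> P0) (\<lambda>s. stick_weight (fst s)) snd f F"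
proof -
  interpret D: prob_space "dp_sticks \<alpha> P0" by (rule prob_dp)
  show ?thesis
  proof
    show "AE s in dp_sticks \<alpha> P0. \<forall>k. 0 \<le> stick_weight (fst s) k"
      using AE_sticks_dp by eventually_elim (auto dest: stick_rest_bounds(3) intro: less_imp_le)
    show "AE s in dp_sticks \<alpha> P0. (\<Sum>k. ennreal (stick_weight (fst s) k)) = 1"
      by (intro AE_dp AE_suminf_stick_weight \<alpha>)
  qed (use f_pos f_le atom_meas in auto)
qed

lemma random_mixture_trunc: "random_mixture (dp_sticks \<alpha> P0) (\<lambda>s. trunc_weight N (fst s)) snd f F"
proof -
  interpret D: prob_space "dp_sticks \<alpha> P0" by (rule prob_dp)
  show ?thesis
  proof
    show "AE s in dp_sticks \<alpha> P0. \<forall>k. 0 \<le> trunc_weight N (fst s) k"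
      using AE_sticks_dp by eventually_elim (auto intro: trunc_weight_sum_nonneg(1))
    show "AE s in dp_sticks \<alpha> P0. (\<Sum>k. ennreal (trunc_weight N (fst s) k)) = 1"
      using AE_sticks_dp by eventually_elim (auto intro: trunc_weight_sum_nonneg(2))
    show "(\<lambda>s. trunc_weight N (fst s) k) \<in> borel_measurable (dp_sticks \<alpha> P0)" for k
      unfolding trunc_weight_def by measurable
  qed (use f_pos f_le atom_meas in auto)
qed

end

section \<open>The truncated prior as a function of the untruncated one\<close>

text \<open>Outside the index set the coordinates of an extensional function are the constant \<open>undefined\<close>. This
covers the labels above the truncation level, which carry no atom.\<close>

lemma PiM_component_measurable_any:
  assumes "\<And>i. space (M i) = UNIV"
  shows "(\<lambda>x. x k) \<in> measurable (PiM I M) (M k)"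
proof (cases "k \<in> I")
  case True
  then show ?thesis by (rule measurable_component_singleton)
next
  case False
  have "(\<lambda>_. undefined) \<in> measurable (PiM I M) (M k)"
    by (rule measurable_const) (use assms[of k] in simp)
  moreover have "x k = undefined" if "x \<in> space (PiM I M)" for x
    using that False by (simp add: space_PiM PiE_arb[of x I])
  ultimately show ?thesis by (subst measurable_cong[where g="\<lambda>_. undefined"]) simp_all
qed

lemma trunc_weight_restrict: "trunc_weight N (restrict v {..<N}) k = trunc_weight N v k"
proof -
  have r: "stick_weight (restrict v {..<N}) j = stick_weight v j" if j: "j < N" for j
  proof -
    have "(\<Prod>i<j. 1 - restrict v {..<N} i) = (\<Prod>i<j. 1 - v i)"
      using j by (intro prod.cong) auto
    then show ?thesis using j by (simp add: stick_weight_def)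
  qed
  have "(\<Sum>j<N. stick_weight (restrict v {..<N}) j) = (\<Sum>j<N. stick_weight v j)"
    by (intro sum.cong refl r) simp
  then show ?thesis using r by (simp add: trunc_weight_def)
qed

lemma trunc_weight_measurable [measurable]:
  "(\<lambda>v. trunc_weight N v k) \<in> borel_measurable (PiM {..<N} (\<lambda>_. beta_law 1 \<alpha>))"
proof -
  let ?M = "PiM {..<N} (\<lambda>_. beta_law 1 \<alpha>)"
  have c: "(\<lambda>v. v j) \<in> borel_measurable ?M" for j
  proof -
    have "(\<lambda>v. v j) \<in> measurable ?M (beta_law 1 \<alpha>)"
      by (rule PiM_component_measurable_any) (rule space_beta_law)
    then show ?thesis
      unfolding measurable_cong_sets[OF refl sets_beta_law] .
  qed
  have s: "(\<lambda>v. stick_weight v j) \<in> borel_measurable ?M" for j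
    unfolding stick_weight_def
    by (intro borel_measurable_times borel_measurable_prod borel_measurable_diff borel_measurable_const c)
  have r: "(\<lambda>v. 1 - (\<Sum>j<N. stick_weight v j)) \<in> borel_measurable ?M"
    by (intro borel_measurable_diff borel_measurable_sum borel_measurable_const s)
  consider "k < N" | "k = N" | "N < k" by linarith
  then show ?thesis
    by cases (simp_all add: trunc_weight_def s r)
qed

context dp_prior
begin

lemma trunc_sticks_distr:
  "trunc_sticks \<alpha> P0 N = distr (dp_sticks \<alpha> P0) (trunc_sticks \<alpha> P0 N)
    (\<lambda>(v, t). (restrict v {..<N}, restrict t {..N}))"
proof -
  interpret B: prob_space "beta_law 1 \<alpha>" using \<alpha> by (rule prob_space_beta_law)
  interpret BV: product_prob_space "\<lambda>_::nat. beta_law 1 \<alpha>" UNIV by unfold_locales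
  interpret A: prob_space P0 by (rule P0)
  interpret AT: product_prob_space "\<lambda>_::nat. P0" UNIV by unfold_locales
  have v: "distr V (PiM {..<N} (\<lambda>_. beta_law 1 \<alpha>)) (\<lambda>v. restrict v {..<N}) = PiM {..<N} (\<lambda>_. beta_law 1 \<alpha>)"
    by (rule BV.distr_PiM_restrict_finite) auto
  have t: "distr T (PiM {..N} (\<lambda>_. P0)) (\<lambda>t. restrict t {..N}) = PiM {..N} (\<lambda>_. P0)"
    by (rule AT.distr_PiM_restrict_finite) auto
  have "sigma_finite_measure (distr T (PiM {..N} (\<lambda>_. P0)) (\<lambda>t. restrict t {..N}))"
    unfolding t by (intro prob_space_imp_sigma_finite prob_space_PiM P0)
  then have "distr V (PiM {..<N} (\<lambda>_. beta_law 1 \<alpha>)) (\<lambda>v. restrict v {..<N}) \<Otimes>\<^sub>M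
      distr T (PiM {..N} (\<lambda>_. P0)) (\<lambda>t. restrict t {..N}) =
    distr (V \<Otimes>\<^sub>M T) (PiM {..<N} (\<lambda>_. beta_law 1 \<alpha>) \<Otimes>\<^sub>M PiM {..N} (\<lambda>_. P0))
      (\<lambda>(v, t). (restrict v {..<N}, restrict t {..N}))"
    by (intro pair_measure_distr) (auto intro!: measurable_restrict_subset)
  then show ?thesis unfolding v t by (simp add: trunc_sticks_def dp_sticks_eq)
qed

text \<open>The restriction maps transport the law of all sticks and atoms to the law of the first ones. The
integrands are unchanged because atoms with labels above \<open>N\<close> occur with weight zero only.\<close>

lemma trunc_allocation_eq:
  "trunc_allocation f \<alpha> P0 N n x = allocation_posterior f (dp_sticks \<alpha> P0) (trunc_weight N) n x"
proof -
  let ?S = "trunc_sticks \<alpha> P0 N" and ?r = "\<lambda>(v, t). (restrict v {..<N}, restrict t {..N})"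
  have fst_m [measurable]: "fst \<in> measurable ?S (PiM {..<N} (\<lambda>_. beta_law 1 \<alpha>))"
    and snd_m [measurable]: "snd \<in> measurable ?S (PiM {..N} (\<lambda>_. P0))"
    by (simp_all add: trunc_sticks_def)
  have [measurable]: "(\<lambda>s. snd s k) \<in> borel_measurable ?S" for k
    using measurable_compose[OF snd_m PiM_component_measurable_any[of "\<lambda>_. P0" k "{..N}"]]
    by (simp only: measurable_cong_sets[OF refl sets_P0] space_P0 simp_thms)
  have r_m [measurable]: "?r \<in> measurable (dp_sticks \<alpha> P0) ?S"
    unfolding trunc_sticks_def dp_sticks_eq split_beta'
    by (intro measurable_Pair measurable_compose[OF measurable_fst measurable_restrict_subset]
        measurable_compose[OF measurable_snd measurable_restrict_subset]) auto
  have int: "(\<integral>s. G s \<partial>?S) = (\<integral>s. G (?r s) \<partial>dp_sticks \<alpha> P0)"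
    if "G \<in> borel_measurable ?S" for G :: "(nat \<Rightarrow> real) \<times> (nat \<Rightarrow> real^'d) \<Rightarrow> real"
    by (subst trunc_sticks_distr) (rule integral_distr[OF r_m that])
  have zero: "trunc_weight N v k = 0 \<or> k \<le> N" for v k
    by (auto simp: trunc_weight_def)
  have f0: "0 \<le> f y" for y using f_pos[of y] by simp
  have num: "(\<integral>(v, u). (\<Prod>i<n. trunc_weight N v (c i) * f (x i - u (c i))) \<partial>?S) =
    (\<integral>(v, u). (\<Prod>i<n. trunc_weight N v (c i) * f (x i - u (c i))) \<partial>dp_sticks \<alpha> P0)" for c
  proof -
    have "(\<integral>s. (\<Prod>i<n. trunc_weight N (fst s) (c i) * f (x i - snd s (c i))) \<partial>?S) =
      (\<integral>s. (\<Prod>i<n. trunc_weight N (fst (?r s)) (c i) * f (x i - snd (?r s) (c i))) \<partial>dp_sticks \<alpha> P0)"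
      by (rule int) measurable
    also have "\<dots> = (\<integral>s. (\<Prod>i<n. trunc_weight N (fst s) (c i) * f (x i - snd s (c i))) \<partial>dp_sticks \<alpha> P0)"
    proof (intro Bochner_Integration.integral_cong refl prod.cong)
      fix s i
      show "trunc_weight N (fst (?r s)) (c i) * f (x i - snd (?r s) (c i)) =
        trunc_weight N (fst s) (c i) * f (x i - snd s (c i))"
        using zero[of "fst s" "c i"] by (auto simp: split_beta' trunc_weight_restrict)
    qed
    finally show ?thesis by (simp add: split_beta')
  qed
  have den: "(\<integral>(v, u). (\<Prod>i<n. mixture f (discrete_measure UNIV (trunc_weight N v) u) (x i)) \<partial>?S) =
    (\<integral>(v, u). (\<Prod>i<n. mixture f (discrete_measure UNIV (trunc_weight N v) u) (x i)) \<partial>dp_sticks \<alpha> P0)"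
  proof -
    let ?m = "\<lambda>s y. enn2real (\<Sum>k. ennreal (trunc_weight N (fst s) k) * ennreal (f (y - snd s k)))"
    have "(\<integral>s. (\<Prod>i<n. ?m s (x i)) \<partial>?S) = (\<integral>s. (\<Prod>i<n. ?m (?r s) (x i)) \<partial>dp_sticks \<alpha> P0)"
      by (rule int) measurable
    also have "\<dots> = (\<integral>s. (\<Prod>i<n. ?m s (x i)) \<partial>dp_sticks \<alpha> P0)"
    proof (intro Bochner_Integration.integral_cong refl prod.cong arg_cong[where f=enn2real] suminf_cong)
      fix s i k
      show "ennreal (trunc_weight N (fst (?r s)) k) * ennreal (f (x i - snd (?r s) k)) =
        ennreal (trunc_weight N (fst s) k) * ennreal (f (x i - snd s k))"
        using zero[of "fst s" k] by (auto simp: split_beta' trunc_weight_restrict)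
    qed
    finally show ?thesis using f0 by (simp add: split_beta' mixture_discrete)
  qed
  show ?thesis
    unfolding trunc_allocation_def allocation_posterior_def num den ..
qed

end

section \<open>Expectations under the data law\<close>

lemma prod_divide_ennreal:
  fixes a b :: "'i \<Rightarrow> ennreal"
  assumes "\<And>i. i \<in> I \<Longrightarrow> 0 < b i \<and> b i < top"
  shows "(\<Prod>i\<in>I. a i) / (\<Prod>i\<in>I. b i) = (\<Prod>i\<in>I. a i / b i)"
  using assms
proof (induction I rule: infinite_finite_induct)
  case (insert i I)
  have "(\<Prod>i\<in>I. b i) < top"
    using insert.prems by (fastforce simp: less_top[symmetric] ennreal_prod_eq_top)
  then have "inverse (b i * (\<Prod>i\<in>I. b i)) = inverse (b i) * inverse (\<Prod>i\<in>I. b i)"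
    using insert.prems[of i] by (intro ennreal_inverse_mult) auto
  then show ?case
    using insert by (simp add: divide_ennreal_def ac_simps)
qed auto

lemma nn_integral_lborel_translate:
  fixes h :: "'a::euclidean_space \<Rightarrow> ennreal"
  assumes [measurable]: "h \<in> borel_measurable borel"
  shows "(\<integral>\<^sup>+y. h (y - c) \<partial>lborel) = (\<integral>\<^sup>+y. h y \<partial>lborel)"
proof -
  have "(\<integral>\<^sup>+y. h y \<partial>lborel) = (\<integral>\<^sup>+y. h y \<partial>distr lborel borel ((+) (- c)))"
    by (simp only: lborel_distr_plus)
  also have "\<dots> = (\<integral>\<^sup>+y. h (y - c) \<partial>lborel)"
    by (subst nn_integral_distr) auto
  finally show ?thesis ..
qed

text \<open>The random mixture serves as a model for independent observations with the density \<open>q\<close>; all expectations over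
the data are with respect to \<open>q\<close>.\<close>

locale mixture_data = random_mixture S w t f F
  for S :: "'s measure" and w t and f :: "real^'d \<Rightarrow> real" and F +
  fixes q :: "real^'d \<Rightarrow> real"
  assumes q_meas [measurable]: "q \<in> borel_measurable borel" and q_pos: "\<And>y. 0 < q y"
    and q_int: "(\<integral>\<^sup>+y. ennreal (q y) \<partial>lborel) = 1"
    and f_int: "(\<integral>\<^sup>+y. ennreal (f y) \<partial>lborel) = 1"
begin

abbreviation "Q \<equiv> PiM (UNIV :: nat set) (\<lambda>_. density lborel (\<lambda>x. ennreal (q x)))"

lemma prob_Q1: "prob_space (density lborel (\<lambda>x. ennreal (q x)))"
  by (rule prob_spaceI) (simp add: emeasure_density q_int)

sublocale Q: prob_space Q by (intro prob_space_PiM prob_Q1)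
sublocale SQ: pair_prob_space S Q ..

lemma sets_Q [measurable_cong, simp]: "sets Q = sets (PiM UNIV (\<lambda>_. borel))"
  by (intro sets_PiM_cong) auto

lemma nn_integral_Q_prod:
  assumes [measurable]: "\<And>i. h i \<in> borel_measurable borel"
  shows "(\<integral>\<^sup>+x. (\<Prod>i<n. h i (x i)) \<partial>Q) = (\<Prod>i<n. \<integral>\<^sup>+y. h i y * ennreal (q y) \<partial>lborel)"
  by (subst nn_integral_PiM_prod)
    (auto simp: prob_Q1 nn_integral_density mult.commute)

lemma nn_integral_label_lik:
  "(\<integral>\<^sup>+y. label_lik L s y \<partial>lborel) = (\<Sum>k. indicator L k * ennreal (w s k))"
proof -
  have "(\<integral>\<^sup>+y. label_lik L s y \<partial>lborel) =
    (\<Sum>k. \<integral>\<^sup>+y. indicator L k * (ennreal (w s k) * ennreal (f (y - t s k))) \<partial>lborel)"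
    unfolding label_lik_def by (rule nn_integral_suminf) measurable
  also have "\<dots> = (\<Sum>k. indicator L k * (ennreal (w s k) * (\<integral>\<^sup>+y. ennreal (f (y - t s k)) \<partial>lborel)))"
    by (intro suminf_cong) (simp add: nn_integral_cmult)
  also have "\<dots> = (\<Sum>k. indicator L k * ennreal (w s k))"
    by (subst nn_integral_lborel_translate[where h="\<lambda>y. ennreal (f y)"]) (auto simp: f_int)
  finally show ?thesis .
qed

lemma label_lik_borel [measurable]: "label_lik L s \<in> borel_measurable borel"
  unfolding label_lik_def by measurable

text \<open>Dividing by the true density turns the expectation over the data into Lebesgue measure, and the
kernels integrate to one. What remains is the prior probability of the box.\<close>

lemma expectation_box:
  "(\<integral>\<^sup>+x. box n L x / (\<Prod>i<n. ennreal (q (x i))) \<partial>Q) =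
    (\<integral>\<^sup>+s. (\<Prod>i<n. \<Sum>k. indicator (L i) k * ennreal (w s k)) \<partial>S)"
proof -
  have "(\<integral>\<^sup>+x. box n L x / (\<Prod>i<n. ennreal (q (x i))) \<partial>Q) =
    (\<integral>\<^sup>+x. \<integral>\<^sup>+s. (\<Prod>i<n. label_lik (L i) s (x i) / ennreal (q (x i))) \<partial>S \<partial>Q)"
    unfolding box_def
    by (intro nn_integral_cong, subst nn_integral_divide[symmetric])
      (auto intro!: nn_integral_cong prod_divide_ennreal simp: q_pos)
  also have "\<dots> = (\<integral>\<^sup>+s. \<integral>\<^sup>+x. (\<Prod>i<n. label_lik (L i) s (x i) / ennreal (q (x i))) \<partial>Q \<partial>S)"
    by (rule SQ.Fubini') measurable
  also have "\<dots> = (\<integral>\<^sup>+s. (\<Prod>i<n. \<Sum>k. indicator (L i) k * ennreal (w s k)) \<partial>S)"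
  proof (intro nn_integral_cong)
    fix s
    have "(\<integral>\<^sup>+y. label_lik (L i) s y / ennreal (q y) * ennreal (q y) \<partial>lborel) =
        (\<Sum>k. indicator (L i) k * ennreal (w s k))" for i
      using q_pos unfolding nn_integral_label_lik[symmetric]
      by (intro nn_integral_cong) (simp add: ennreal_divide_times ennreal_times_divide mult_divide_eq_ennreal less_imp_neq[symmetric])
    then show "(\<integral>\<^sup>+x. (\<Prod>i<n. label_lik (L i) s (x i) / ennreal (q (x i))) \<partial>Q) =
        (\<Prod>i<n. \<Sum>k. indicator (L i) k * ennreal (w s k))"
      by (subst nn_integral_Q_prod[where h="\<lambda>i y. label_lik (L i) s y / ennreal (q y)"]) auto
  qed
  finally show ?thesis .
qed

text \<open>With \<open>h\<close> the likelihood, \<open>emeasure S B\<close> is the integral of \<open>sqrt h * (1 / sqrt h)\<close> over \<open>B\<close>; the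
evidence dominates the integral of \<open>h\<close> over \<open>B\<close>.\<close>

lemma evidence_cauchy_schwarz:
  assumes B [measurable]: "B \<in> sets S"
  shows "(emeasure S B)\<^sup>2 / evidence n x \<le>
    (\<integral>\<^sup>+s. indicator B s * (1 / (\<Prod>i<n. label_lik UNIV s (x i))) \<partial>S)"
proof -
  let ?h = "\<lambda>s. \<Prod>i<n. label_lik UNIV s (x i)"
  let ?g1 = "\<lambda>s. indicator B s * ennreal (sqrt (enn2real (?h s)))"
  let ?g2 = "\<lambda>s. indicator B s * ennreal (1 / sqrt (enn2real (?h s)))"
  have h: "AE s in S. 0 < ?h s \<and> ?h s < top"
    using label_lik_bounds[of UNIV]
  proof eventually_elim
    case (elim s)
    then have "label_lik UNIV s y < top" "0 < label_lik UNIV s y" for y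
      by (auto intro: le_less_trans ennreal_less_top)
    then have "label_lik UNIV s y < top" "label_lik UNIV s y \<noteq> 0" for y
      by (simp_all add: zero_less_iff_neq_zero)
    then show ?case
      by (auto simp: ennreal_prod_eq_top less_top[symmetric] zero_less_iff_neq_zero)
  qed
  have "(emeasure S B)\<^sup>2 = (\<integral>\<^sup>+s. ?g1 s * ?g2 s \<partial>S)\<^sup>2"
  proof -
    have "emeasure S B = (\<integral>\<^sup>+s. indicator B s \<partial>S)" by simp
    also have "\<dots> = (\<integral>\<^sup>+s. ?g1 s * ?g2 s \<partial>S)"
    proof (intro nn_integral_cong_AE)
      show "AE s in S. indicator B s = ?g1 s * ?g2 s"
        using h
      proof eventually_elim
        case (elim s)
        then have "0 < enn2real (?h s)" by (simp add: enn2real_positive_iff)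
        then show ?case by (auto simp: indicator_def ennreal_mult[symmetric])
      qed
    qed
    finally show ?thesis by simp
  qed
  also have "\<dots> \<le> (\<integral>\<^sup>+s. (?g1 s)\<^sup>2 \<partial>S) * (\<integral>\<^sup>+s. (?g2 s)\<^sup>2 \<partial>S)"
    by (rule Cauchy_Schwarz_nn_integral) measurable
  also have "(\<integral>\<^sup>+s. (?g1 s)\<^sup>2 \<partial>S) \<le> evidence n x"
    unfolding evidence_def box_def
  proof (intro nn_integral_mono_AE)
    show "AE s in S. (?g1 s)\<^sup>2 \<le> ?h s"
      using h by eventually_elim (auto simp: indicator_def ennreal_power)
  qed
  also have "(\<integral>\<^sup>+s. (?g2 s)\<^sup>2 \<partial>S) = (\<integral>\<^sup>+s. indicator B s * (1 / ?h s) \<partial>S)"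
  proof (intro nn_integral_cong_AE)
    show "AE s in S. (?g2 s)\<^sup>2 = indicator B s * (1 / ?h s)"
      using h
    proof eventually_elim
      case (elim s)
      define r where "r = enn2real (?h s)"
      have r: "0 < r" "?h s = ennreal r" using elim by (simp_all add: enn2real_positive_iff r_def)
      have "1 / ennreal r = ennreal (1 / r)" using divide_ennreal[of 1 r] r(1) by simp
      with r show ?case unfolding r(2)
        by (auto simp: indicator_def ennreal_power power_divide)
    qed
  qed
  finally have "(emeasure S B)\<^sup>2 \<le> evidence n x *
      (\<integral>\<^sup>+s. indicator B s * (1 / ?h s) \<partial>S)"
    by (simp add: mult_right_mono)
  then show ?thesis
    using evidence_pos[of n x] evidence_finite[of n x]
    by (intro divide_le_posI_ennreal) (auto simp: mult.commute)
qed

text \<open>After exchanging the integrals over \<open>B\<close> and over the data, the observations separate into \<open>n\<close> equal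
factors. The hypothesis bounds such a factor, which is one plus a chi-square divergence.\<close>

lemma expectation_inverse_evidence:
  assumes B [measurable]: "B \<in> sets S" and pos: "0 < emeasure S B"
    and chi: "\<And>s. s \<in> B \<Longrightarrow> (\<integral>\<^sup>+y. ennreal (q y) / label_lik UNIV s y * ennreal (q y) \<partial>lborel) \<le> M"
  shows "(\<integral>\<^sup>+x. (\<Prod>i<n. ennreal (q (x i))) / evidence n x \<partial>Q) \<le> M ^ n / emeasure S B"
proof -
  let ?h = "\<lambda>s x. \<Prod>i<n. label_lik UNIV s (x i)" and ?q = "\<lambda>x. \<Prod>i<n. ennreal (q (x i))"
  have bnd: "AE s in S. \<forall>y. label_lik UNIV s y < top \<and> 0 < label_lik UNIV s y"
    using label_lik_bounds[of UNIV] by eventually_elim (auto intro: le_less_trans ennreal_less_top)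
  have "(emeasure S B)\<^sup>2 * (\<integral>\<^sup>+x. ?q x / evidence n x \<partial>Q) =
    (\<integral>\<^sup>+x. ?q x * ((emeasure S B)\<^sup>2 / evidence n x) \<partial>Q)"
    by (subst nn_integral_cmult[symmetric]) (auto simp: ennreal_times_divide mult.commute intro!: nn_integral_cong)
  also have "\<dots> \<le> (\<integral>\<^sup>+x. ?q x * (\<integral>\<^sup>+s. indicator B s * (1 / ?h s x) \<partial>S) \<partial>Q)"
    by (intro nn_integral_mono mult_left_mono evidence_cauchy_schwarz B) auto
  also have "\<dots> = (\<integral>\<^sup>+x. \<integral>\<^sup>+s. indicator B s * (?q x / ?h s x) \<partial>S \<partial>Q)"
    by (intro nn_integral_cong, subst nn_integral_cmult[symmetric])
      (auto intro!: nn_integral_cong simp: ennreal_times_divide mult.commute mult.left_commute)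
  also have "\<dots> = (\<integral>\<^sup>+s. \<integral>\<^sup>+x. indicator B s * (?q x / ?h s x) \<partial>Q \<partial>S)"
    by (rule SQ.Fubini') measurable
  also have "\<dots> \<le> (\<integral>\<^sup>+s. indicator B s * M ^ n \<partial>S)"
  proof (intro nn_integral_mono_AE)
    show "AE s in S. (\<integral>\<^sup>+x. indicator B s * (?q x / ?h s x) \<partial>Q) \<le> indicator B s * M ^ n"
      using bnd
    proof eventually_elim
      case (elim s)
      have "(\<integral>\<^sup>+x. ?q x / ?h s x \<partial>Q) \<le> M ^ n" if "s \<in> B"
      proof -
        have "(\<integral>\<^sup>+x. ?q x / ?h s x \<partial>Q) = (\<integral>\<^sup>+x. (\<Prod>i<n. ennreal (q (x i)) / label_lik UNIV s (x i)) \<partial>Q)"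
          using elim by (intro nn_integral_cong prod_divide_ennreal) auto
        also have "\<dots> = (\<Prod>i<n. \<integral>\<^sup>+y. ennreal (q y) / label_lik UNIV s y * ennreal (q y) \<partial>lborel)"
          by (rule nn_integral_Q_prod[where h="\<lambda>i y. ennreal (q y) / label_lik UNIV s y"]) measurable
        also have "\<dots> \<le> (\<Prod>i<n. M)" using chi[OF that] by (intro prod_mono_ennreal) auto
        finally show ?thesis by simp
      qed
      then show ?case by (auto simp: indicator_def)
    qed
  qed
  also have "\<dots> = emeasure S B * M ^ n"
    by (subst nn_integral_multc) auto
  finally have "emeasure S B * (emeasure S B * (\<integral>\<^sup>+x. ?q x / evidence n x \<partial>Q)) \<le> emeasure S B * M ^ n"
    by (simp add: power2_eq_square mult.assoc)
  then have "emeasure S B * (\<integral>\<^sup>+x. ?q x / evidence n x \<partial>Q) \<le> M ^ n"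
    using pos emeasure_finite[of B] by (subst (asm) ennreal_mult_le_mult_iff) auto
  then have "(\<integral>\<^sup>+x. ?q x / evidence n x \<partial>Q) * emeasure S B / emeasure S B \<le> M ^ n / emeasure S B"
    by (intro divide_right_mono_ennreal) (simp add: mult.commute)
  then show ?thesis
    using pos emeasure_finite[of B] by (subst (asm) mult_divide_eq_ennreal) auto
qed

end

section \<open>The chi-square divergence of nearby mixtures\<close>

lemma partial_le_deriv_norm:
  fixes h :: "real^'d \<Rightarrow> real"
  shows "\<bar>frechet_derivative h (at x) (axis i 1)\<bar> \<le> deriv_norm 1 h x"
proof -
  have fin: "finite {is :: 'd list. length is = 1}"
    using finite_lists_length_eq[of "UNIV :: 'd set" 1] by simp
  have "(partials [i] h x)\<^sup>2 \<le> (\<Sum>is\<in>{is. length is = 1}. (partials is h x)\<^sup>2)"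
    by (rule member_le_sum) (use fin in auto)
  then have "sqrt ((partials [i] h x)\<^sup>2) \<le> deriv_norm 1 h x"
    unfolding deriv_norm_def by (rule real_sqrt_le_mono)
  then show ?thesis by simp
qed

lemma has_derivative_le_deriv_norm:
  fixes h :: "real^'d \<Rightarrow> real"
  assumes "h differentiable (at x)"
  shows "norm (frechet_derivative h (at x) z) \<le> real CARD('d) * deriv_norm 1 h x * norm z"
proof -
  let ?D = "frechet_derivative h (at x)"
  have lin: "linear ?D" using assms by (rule linear_frechet_derivative)
  have "?D z = ?D (\<Sum>i\<in>UNIV. z $ i *\<^sub>R axis i 1)"
    by (simp add: scalar_mult_eq_scaleR[symmetric] basis_expansion)
  also have "\<dots> = (\<Sum>i\<in>UNIV. z $ i *\<^sub>R ?D (axis i 1))"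
    by (simp add: linear_sum[OF lin] linear_scale[OF lin])
  finally have "norm (?D z) \<le> (\<Sum>i\<in>UNIV. norm (z $ i *\<^sub>R ?D (axis i 1)))"
    by (simp add: norm_sum)
  also have "\<dots> \<le> (\<Sum>i\<in>(UNIV :: 'd set). norm z * deriv_norm 1 h x)"
    by (intro sum_mono)
      (auto simp: abs_mult simp del: One_nat_def intro!: mult_mono component_le_norm_cart partial_le_deriv_norm)
  finally show ?thesis by (simp add: mult_ac)
qed

text \<open>The logarithm of the kernel is Lipschitz on balls by the mean value theorem; the Lipschitz constant on
the ball around \<open>x\<close> grows like \<open>norm x powr \<gamma>\<close>, of which all exponential moments exist.\<close>

lemma kernel_ratio_exists:
  fixes f :: "real^'d \<Rightarrow> real"
  assumes sm: "smooth_bounded_kernel f" and ld: "log_deriv_growth f" and \<rho>: "0 < \<rho>"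
  shows "\<exists>g. g \<in> borel_measurable borel \<and> (\<forall>x. 0 \<le> g x) \<and>
    (\<forall>x \<theta> \<theta>'. norm \<theta> \<le> \<rho> \<longrightarrow> norm \<theta>' \<le> \<rho> \<longrightarrow>
      f (x - \<theta>) \<le> exp (g x * norm (\<theta> - \<theta>')) * f (x - \<theta>')) \<and>
    (\<forall>M>0. (\<integral>\<^sup>+x. ennreal (exp (M * g x) * f x) \<partial>lborel) < \<infinity>)"
proof -
  from ld obtain R \<gamma> where R: "0 < R" and \<gamma>: "0 \<le> \<gamma>"
    and D1: "\<And>x. deriv_norm 1 (\<lambda>y. ln (f y)) x \<le> R * (1 + norm x) powr \<gamma>"
    and int: "\<And>M. 0 < M \<Longrightarrow> integrable lborel (\<lambda>x. exp (M * norm x powr \<gamma>) * f x)"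
    unfolding log_deriv_growth_def by blast
  from sm have pos: "0 < f x" for x unfolding smooth_bounded_kernel_def by blast
  have "C_k_on_UNIV 3 f" using sm unfolding smooth_bounded_kernel_def by blast
  then have "partials [] f differentiable_on UNIV"
    unfolding C_k_on_UNIV_def by (metis list.size(3) zero_less_numeral)
  then have fd: "f differentiable (at x)" for x by (simp add: differentiable_on_def)
  define h where "h = (\<lambda>y. ln (f y))"
  have hd: "h differentiable (at x)" for x
  proof -
    from fd[of x] obtain f' where "(f has_derivative f') (at x)" by (auto simp: differentiable_def)
    then have "(h has_derivative (\<lambda>z. f' z * inverse (f x))) (at x)"
      unfolding h_def using pos[of x] by (auto intro!: derivative_eq_intros simp: divide_inverse mult.commute)
    then show ?thesis by (auto simp: differentiable_def)
  qed
  define d where "d = real CARD('d)"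
  have d: "0 < d" by (simp add: d_def)
  define a b where "a = d * R * (2 * (1 + \<rho>)) powr \<gamma>" and "b = d * R * 2 powr \<gamma>"
  have ab: "0 < a" "0 < b" using R d \<rho> by (auto simp: a_def b_def)
  define g where "g = (\<lambda>x :: real^'d. a + b * norm x powr \<gamma>)"
  \<comment> \<open>The constants come from \<open>1 + norm y \<le> 2 * max (1 + \<rho>) (norm x)\<close>: the maximum of the two
    powers is replaced by their sum.\<close>
  have grad: "onorm (frechet_derivative h (at y)) \<le> g x" if y: "norm y \<le> norm x + \<rho>" for x y
  proof (rule onorm_le)
    fix z :: "real^'d"
    have "(1 + norm y) powr \<gamma> \<le> (2 * (1 + \<rho>)) powr \<gamma> + (2 * norm x) powr \<gamma>"
    proof (cases "norm x \<le> 1 + \<rho>")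
      case True
      then have "(1 + norm y) powr \<gamma> \<le> (2 * (1 + \<rho>)) powr \<gamma>"
        using y \<gamma> \<rho> by (intro powr_mono2) auto
      then show ?thesis by (smt (verit) powr_ge_zero)
    next
      case False
      then have "(1 + norm y) powr \<gamma> \<le> (2 * norm x) powr \<gamma>"
        using y \<gamma> \<rho> by (intro powr_mono2) auto
      then show ?thesis by (smt (verit) powr_ge_zero)
    qed
    then have "d * R * (1 + norm y) powr \<gamma> \<le> d * R * ((2 * (1 + \<rho>)) powr \<gamma> + (2 * norm x) powr \<gamma>)"
      using d R by (intro mult_left_mono) auto
    also have "\<dots> = g x"
      using \<rho> by (simp add: g_def a_def b_def powr_mult algebra_simps)
    finally have "d * R * (1 + norm y) powr \<gamma> \<le> g x" .
    moreover have "d * deriv_norm 1 h y \<le> d * (R * (1 + norm y) powr \<gamma>)"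
      using D1[of y] d unfolding h_def by (intro mult_left_mono) auto
    ultimately have "d * deriv_norm 1 h y \<le> g x" by (simp add: mult.assoc)
    then have "d * deriv_norm 1 h y * norm z \<le> g x * norm z" by (intro mult_right_mono) auto
    then show "norm (frechet_derivative h (at y) z) \<le> g x * norm z"
      using has_derivative_le_deriv_norm[OF hd, of y z] by (simp add: d_def)
  qed
  have g1: "g \<in> borel_measurable borel" unfolding g_def by measurable
  have g2: "0 \<le> g x" for x
    unfolding g_def by (intro add_nonneg_nonneg mult_nonneg_nonneg) (use ab in auto)
  have g3: "f (x - \<theta>) \<le> exp (g x * norm (\<theta> - \<theta>')) * f (x - \<theta>')"
    if \<theta>: "norm \<theta> \<le> \<rho>" "norm \<theta>' \<le> \<rho>" for x \<theta> \<theta>'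
  proof -
    have "norm (h (x - \<theta>) - h (x - \<theta>')) \<le> g x * norm ((x - \<theta>) - (x - \<theta>'))"
    proof (rule differentiable_bound[where S="cball x \<rho>" and f'="\<lambda>y. frechet_derivative h (at y)"])
      fix y assume y: "y \<in> cball x \<rho>"
      show "(h has_derivative frechet_derivative h (at y)) (at y within cball x \<rho>)"
          by (rule has_derivative_at_withinI[OF frechet_derivative_works[THEN iffD1, OF hd]])
      have "norm y \<le> norm x + \<rho>"
        using y norm_triangle_ineq2[of y x] by (simp add: dist_norm norm_minus_commute)
      then show "onorm (frechet_derivative h (at y)) \<le> g x" by (rule grad)
    qed (use \<theta> in \<open>auto simp: dist_norm\<close>)
    then have "ln (f (x - \<theta>)) \<le> ln (f (x - \<theta>')) + g x * norm (\<theta> - \<theta>')"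
      by (simp add: h_def norm_minus_commute)
    then have "exp (ln (f (x - \<theta>))) \<le> exp (ln (f (x - \<theta>')) + g x * norm (\<theta> - \<theta>'))" by simp
    then show ?thesis using pos by (simp add: exp_add mult.commute)
  qed
  have g4: "(\<integral>\<^sup>+x. ennreal (exp (M * g x) * f x) \<partial>lborel) < \<infinity>" if M: "0 < M" for M
  proof -
    have "integrable lborel (\<lambda>x. exp (M * a) * (exp (M * b * norm x powr \<gamma>) * f x))"
      using int[of "M * b"] M ab by (intro integrable_mult_right) auto
    also have "(\<lambda>x. exp (M * a) * (exp (M * b * norm x powr \<gamma>) * f x)) = (\<lambda>x. exp (M * g x) * f x)"
      by (auto simp: g_def exp_add algebra_simps)
    finally show ?thesis
      using pos by (simp add: integrable_iff_bounded less_imp_le)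
  qed
  show ?thesis
    by (intro exI[of _ g] conjI allI impI g1 g2 g3 g4)
qed

text \<open>Write \<open>s\<close> for the perturbed density. Since both densities have integral one, the integral of
\<open>q\<^sup>2 / s\<close> equals one plus the integral of \<open>(q - s)\<^sup>2 / s\<close>. In the numerator,
\<open>\<bar>q - s\<bar>\<close> is at most \<open>\<eta> * q\<close> times an exponential of \<open>g\<close>: weights and atoms with
labels below \<open>K\<close> are close to the true ones, and the remaining components have total weight at most \<open>K * \<eta>\<close>
while each of their kernels is at most \<open>exp (2 * \<rho> * g y) * q y\<close>. In the denominator, \<open>s\<close> is at least
\<open>exp (- g y) / 2 * q y\<close>. The exponential moments of \<open>g\<close> absorb all these factors.\<close>

lemma chi_square_bound:
  fixes f g :: "real^'d \<Rightarrow> real" and K :: nat and ws :: "nat \<Rightarrow> real" and ts :: "nat \<Rightarrow> real^'d"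
  assumes [measurable]: "f \<in> borel_measurable borel" "g \<in> borel_measurable borel"
    and f_pos: "\<And>x. 0 < f x" and g: "\<And>x. 0 \<le> g x" and \<rho>: "0 < \<rho>"
    and ratio: "\<And>x \<theta> \<theta>'. norm \<theta> \<le> \<rho> \<Longrightarrow> norm \<theta>' \<le> \<rho> \<Longrightarrow>
      f (x - \<theta>) \<le> exp (g x * norm (\<theta> - \<theta>')) * f (x - \<theta>')"
    and ws: "\<And>k. k < K \<Longrightarrow> 0 < ws k" "(\<Sum>k<K. ws k) = 1" and ts: "\<And>k. k < K \<Longrightarrow> norm (ts k) \<le> \<rho>"
    and u: "\<And>k. 0 \<le> u k" "(\<Sum>k. ennreal (u k)) = 1" and \<tau>: "\<And>k. norm (\<tau> k) \<le> \<rho>"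
    and \<eta>: "0 \<le> \<eta>" "\<eta> \<le> 1" "\<And>k. k < K \<Longrightarrow> \<eta> \<le> ws k / 2"
    and close: "\<And>k. k < K \<Longrightarrow> \<bar>u k - ws k\<bar> \<le> \<eta>" "\<And>k. k < K \<Longrightarrow> norm (\<tau> k - ts k) \<le> \<eta>"
  defines "q \<equiv> \<lambda>y. \<Sum>k<K. ws k * f (y - ts k)"
    and "s \<equiv> \<lambda>y. \<Sum>k. ennreal (u k) * ennreal (f (y - \<tau> k))"
  assumes s_int: "(\<integral>\<^sup>+y. s y \<partial>lborel) = 1" and q_int: "(\<integral>\<^sup>+y. ennreal (q y) \<partial>lborel) = 1"
  shows "(\<integral>\<^sup>+y. ennreal (q y) / s y * ennreal (q y) \<partial>lborel) \<le>
    1 + ennreal (2 * (2 * real K + 1)\<^sup>2 * \<eta>\<^sup>2) * (\<integral>\<^sup>+y. ennreal (exp ((5 * \<rho> + 5) * g y) * f y) \<partial>lborel)"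
proof -
  define c where "c = 2 * (2 * real K + 1)\<^sup>2 * \<eta>\<^sup>2"
  have f0: "0 \<le> f x" for x using f_pos[of x] by simp
  have K: "0 < K" using ws(2) by (cases K) auto
  have q_pos: "0 < q y" for y
    unfolding q_def using K ws f_pos by (intro sum_pos mult_pos_pos) auto
  have [measurable]: "q \<in> borel_measurable borel" "s \<in> borel_measurable borel"
    unfolding q_def s_def by measurable
  have f_le_q: "f (y - \<theta>) \<le> exp (2 * \<rho> * g y) * q y" if "norm \<theta> \<le> \<rho>" for y \<theta>
  proof -
    have *: "f (y - \<theta>) \<le> exp (2 * \<rho> * g y) * f (y - ts k)" if "k < K" for k
    proof -
      have "norm (\<theta> - ts k) \<le> 2 * \<rho>"
        using norm_triangle_ineq4[of \<theta> "ts k"] ts[OF that] \<open>norm \<theta> \<le> \<rho>\<close> by simp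
      then have "g y * norm (\<theta> - ts k) \<le> 2 * \<rho> * g y"
        using g[of y] by (simp add: mult.commute mult_left_mono)
      then have "exp (g y * norm (\<theta> - ts k)) * f (y - ts k) \<le> exp (2 * \<rho> * g y) * f (y - ts k)"
        using f0 by (intro mult_right_mono) auto
      then show ?thesis using ratio[OF \<open>norm \<theta> \<le> \<rho>\<close> ts[OF that], of y] by simp
    qed
    have "f (y - \<theta>) = (\<Sum>k<K. ws k * f (y - \<theta>))" using ws(2) by (simp flip: sum_distrib_right)
    also have "\<dots> \<le> (\<Sum>k<K. ws k * (exp (2 * \<rho> * g y) * f (y - ts k)))"
      using * ws(1) by (intro sum_mono mult_left_mono) (auto intro: less_imp_le)
    also have "\<dots> = exp (2 * \<rho> * g y) * q y" by (simp add: q_def sum_distrib_left mult_ac)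
    finally show ?thesis .
  qed
  have q_le_f: "q y \<le> exp (\<rho> * g y) * f y" for y
  proof -
    have *: "f (y - ts k) \<le> exp (\<rho> * g y) * f y" if "k < K" for k
    proof -
      have "f (y - ts k) \<le> exp (g y * norm (ts k)) * f y"
        using ratio[OF ts[OF that], of 0 y] \<rho> by simp
      also have "\<dots> \<le> exp (\<rho> * g y) * f y"
        using f0 mult_right_mono[OF ts[OF that] g[of y]]
        by (intro mult_right_mono) (auto simp: mult.commute)
      finally show ?thesis .
    qed
    have "q y \<le> (\<Sum>k<K. ws k * (exp (\<rho> * g y) * f y))"
      unfolding q_def using * ws(1) by (intro sum_mono mult_left_mono) (auto intro: less_imp_le)
    also have "\<dots> = exp (\<rho> * g y) * f y" using ws(2) by (simp flip: sum_distrib_right)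
    finally show ?thesis .
  qed
  have tail_w: "(\<Sum>k. ennreal (u (k + K))) \<le> ennreal (real K * \<eta>)"
  proof -
    have "(\<Sum>k. ennreal (u (k + K))) + (\<Sum>k<K. ennreal (u k)) = 1"
      using suminf_offset[of "\<lambda>k. ennreal (u k)" K] u(2) by simp
    moreover have "(\<Sum>k<K. ennreal (u k)) = ennreal (\<Sum>k<K. u k)" using u(1) by simp
    ultimately have "(\<Sum>k. ennreal (u (k + K))) = 1 - ennreal (\<Sum>k<K. u k)"
      by (metis ennreal_add_diff_cancel_right ennreal_neq_top)
    also have "\<dots> = ennreal (1 - (\<Sum>k<K. u k))"
      using u(1) by (simp add: ennreal_minus sum_nonneg flip: ennreal_1)
    also have "1 - (\<Sum>k<K. u k) = (\<Sum>k<K. ws k - u k)" using ws(2) by (simp add: sum_subtractf)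
    also have "\<dots> \<le> (\<Sum>k<K. \<eta>)" using close(1) by (intro sum_mono) (auto simp: abs_le_iff)
    finally show ?thesis by (simp add: ennreal_leI)
  qed
  have main: "ennreal (q y) / s y * ennreal (q y) + s y \<le>
      ennreal c * ennreal (exp ((5 * \<rho> + 5) * g y) * f y) + 2 * ennreal (q y)" for y
  proof -
    let ?E = "exp (2 * \<rho> * g y)" and ?q = "q y"
    define r where "r = (\<Sum>k. ennreal (u (k + K)) * ennreal (f (y - \<tau> (k + K))))"
    define sK where "sK = (\<Sum>k<K. u k * f (y - \<tau> k))"
    have s_eq: "s y = r + ennreal sK"
    proof -
      have "s y = r + (\<Sum>k<K. ennreal (u k) * ennreal (f (y - \<tau> k)))"
        unfolding s_def r_def by (rule suminf_offset) auto
      also have "(\<Sum>k<K. ennreal (u k) * ennreal (f (y - \<tau> k))) = ennreal sK"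
        unfolding sK_def using u(1) f0 by (subst sum_ennreal[symmetric]) (auto simp: ennreal_mult)
      finally show ?thesis .
    qed
    have "r \<le> (\<Sum>k. ennreal (u (k + K)) * ennreal (?E * ?q))"
      unfolding r_def using f_le_q \<tau> by (intro suminf_le mult_left_mono ennreal_leI) auto
    also have "\<dots> \<le> ennreal (real K * \<eta>) * ennreal (?E * ?q)"
      using tail_w by (simp add: mult_right_mono)
    finally have r_le: "r \<le> ennreal (real K * \<eta> * (?E * ?q))"
      using \<eta>(1) by (simp add: ennreal_mult')
    then obtain r' where r': "0 \<le> r'" "r = ennreal r'" "r' \<le> real K * \<eta> * (?E * ?q)"
      using \<eta>(1) q_pos[of y] by (cases r) (auto simp: top_unique)
    have sK0: "0 \<le> sK" unfolding sK_def using u(1) f0 by (intro sum_nonneg) auto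
    define \<sigma> where "\<sigma> = r' + sK"
    have s_\<sigma>: "s y = ennreal \<sigma>" using s_eq r' sK0 by (simp add: \<sigma>_def)
    have e1: "1 \<le> exp (a * g y)" if "0 \<le> a" for a using that g[of y] by simp
    have comp_le: "\<bar>f (y - \<tau> k) - f (y - ts k)\<bar> \<le> \<eta> * exp (2 * g y) * f (y - ts k)"
      and comp_ge: "exp (- g y) * f (y - ts k) \<le> f (y - \<tau> k)" if k: "k < K" for k
    proof -
      define x where "x = g y * norm (\<tau> k - ts k)"
      have x: "0 \<le> x" "x \<le> \<eta> * g y" "x \<le> g y"
        using mult_left_mono[OF close(2)[OF k] g[of y]] g[of y]
          mult_left_mono[OF order_trans[OF close(2)[OF k] \<eta>(2)] g[of y]]
        by (simp_all add: x_def mult.commute)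
      have a: "f (y - \<tau> k) \<le> exp x * f (y - ts k)" unfolding x_def by (rule ratio[OF \<tau> ts[OF k]])
      have b: "f (y - ts k) \<le> exp x * f (y - \<tau> k)"
        unfolding x_def using ratio[OF ts[OF k] \<tau>, of y k] by (simp add: norm_minus_commute)
      have b': "exp (- x) * f (y - ts k) \<le> f (y - \<tau> k)"
        using mult_left_mono[OF b, of "exp (- x)"] by (simp flip: exp_add mult.assoc)
      have "exp (- g y) * f (y - ts k) \<le> exp (- x) * f (y - ts k)"
        using x f0 by (intro mult_right_mono) auto
      with b' show "exp (- g y) * f (y - ts k) \<le> f (y - \<tau> k)" by simp
      have gexp: "g y \<le> exp (g y)" using exp_ge_add_one_self[of "g y"] by linarith
      have "1 - exp (- x) \<le> x" using exp_ge_add_one_self[of "- x"] by simp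
      also have "\<dots> \<le> \<eta> * exp (2 * g y)"
      proof -
        have "g y \<le> exp (2 * g y)" using gexp g[of y] by (smt (verit) exp_le_cancel_iff)
        then show ?thesis using x \<eta>(1) by (meson mult_left_mono order_trans)
      qed
      finally have 1: "1 - exp (- x) \<le> \<eta> * exp (2 * g y)" .
      have "1 - x \<le> exp (- x)" using exp_ge_add_one_self[of "- x"] by simp
      then have "(1 - x) * exp x \<le> exp (- x) * exp x" by (intro mult_right_mono) auto
      then have "exp x - 1 \<le> x * exp x" by (simp add: left_diff_distrib flip: exp_add)
      also have "\<dots> \<le> (\<eta> * g y) * exp (g y)" using x \<eta>(1) g[of y] by (intro mult_mono) auto
      also have "\<dots> \<le> (\<eta> * exp (g y)) * exp (g y)"
        using gexp \<eta>(1) by (intro mult_right_mono mult_left_mono) auto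
      also have "\<dots> = \<eta> * exp (2 * g y)" by (simp add: mult.assoc flip: exp_add)
      finally have 2: "exp x - 1 \<le> \<eta> * exp (2 * g y)" .
      have "f (y - \<tau> k) - f (y - ts k) \<le> (exp x - 1) * f (y - ts k)" using a by (simp add: algebra_simps)
      also have "\<dots> \<le> \<eta> * exp (2 * g y) * f (y - ts k)" using 2 f0 by (intro mult_right_mono) auto
      finally have 3: "f (y - \<tau> k) - f (y - ts k) \<le> \<eta> * exp (2 * g y) * f (y - ts k)" .
      have "f (y - ts k) - f (y - \<tau> k) \<le> (1 - exp (- x)) * f (y - ts k)" using b' by (simp add: algebra_simps)
      also have "\<dots> \<le> \<eta> * exp (2 * g y) * f (y - ts k)" using 1 f0 by (intro mult_right_mono) auto
      finally show "\<bar>f (y - \<tau> k) - f (y - ts k)\<bar> \<le> \<eta> * exp (2 * g y) * f (y - ts k)"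
        using 3 by (simp add: abs_le_iff)
    qed
    have "\<bar>sK - ?q\<bar> \<le> (\<Sum>k<K. \<bar>u k * f (y - \<tau> k) - ws k * f (y - ts k)\<bar>)"
      unfolding sK_def q_def by (simp only: sum_subtractf[symmetric] sum_abs)
    also have "\<dots> \<le> (\<Sum>k<K. \<eta> * (?E * ?q) + \<eta> * exp (2 * g y) * (ws k * f (y - ts k)))"
    proof (intro sum_mono)
      fix k assume "k \<in> {..<K}"
      then have k: "k < K" by simp
      have "u k * f (y - \<tau> k) - ws k * f (y - ts k) =
        (u k - ws k) * f (y - \<tau> k) + ws k * (f (y - \<tau> k) - f (y - ts k))" by (simp add: algebra_simps)
      then have "\<bar>u k * f (y - \<tau> k) - ws k * f (y - ts k)\<bar> \<le>
        \<bar>u k - ws k\<bar> * f (y - \<tau> k) + ws k * \<bar>f (y - \<tau> k) - f (y - ts k)\<bar>"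
        using ws(1)[OF k] f0 by (metis abs_mult abs_of_nonneg abs_triangle_ineq less_imp_le)
      also have "\<dots> \<le> \<eta> * (?E * ?q) + ws k * (\<eta> * exp (2 * g y) * f (y - ts k))"
        using close(1)[OF k] f_le_q[OF \<tau>, of y k] comp_le[OF k] ws(1)[OF k] f0 \<eta>(1)
        by (intro add_mono mult_mono mult_left_mono) auto
      finally show "\<bar>u k * f (y - \<tau> k) - ws k * f (y - ts k)\<bar> \<le>
        \<eta> * (?E * ?q) + \<eta> * exp (2 * g y) * (ws k * f (y - ts k))" by (simp add: mult_ac)
    qed
    also have "\<dots> = real K * \<eta> * (?E * ?q) + \<eta> * exp (2 * g y) * ?q"
      by (simp add: sum.distrib q_def flip: sum_distrib_left)
    finally have "\<bar>\<sigma> - ?q\<bar> \<le> 2 * (real K * \<eta> * (?E * ?q)) + \<eta> * exp (2 * g y) * ?q"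
      using r' unfolding \<sigma>_def by (simp add: abs_le_iff)
    also have "\<dots> \<le> 2 * (real K * \<eta> * (exp ((2 * \<rho> + 2) * g y) * ?q)) + \<eta> * exp ((2 * \<rho> + 2) * g y) * ?q"
      using \<rho> g[of y] q_pos[of y] \<eta>(1)
      by (intro add_mono mult_left_mono mult_right_mono) (auto simp: algebra_simps)
    finally have diff: "\<bar>\<sigma> - ?q\<bar> \<le> \<eta> * (2 * real K + 1) * exp ((2 * \<rho> + 2) * g y) * ?q"
      by (simp add: algebra_simps)
    have "exp (- g y) / 2 * ?q = (\<Sum>k<K. ws k / 2 * (exp (- g y) * f (y - ts k)))"
      unfolding q_def sum_distrib_left by (intro sum.cong) auto
    also have "\<dots> \<le> sK"
      unfolding sK_def
    proof (intro sum_mono mult_mono)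
      fix k assume "k \<in> {..<K}"
      then show "ws k / 2 \<le> u k" using close(1)[of k] \<eta>(3)[of k] by (simp add: abs_le_iff)
    qed (use u(1) f0 comp_ge in auto)
    finally have low: "exp (- g y) / 2 * ?q \<le> \<sigma>" using r' by (simp add: \<sigma>_def)
    then have \<sigma>_pos: "0 < \<sigma>" using q_pos[of y] by (smt (verit) exp_gt_zero half_gt_zero mult_pos_pos)
    have E1: "(exp ((2 * \<rho> + 2) * g y))\<^sup>2 = exp ((4 * \<rho> + 4) * g y)"
    proof -
      have "exp ((4 * \<rho> + 4) * g y) = exp (2 * ((2 * \<rho> + 2) * g y))" by (simp add: algebra_simps)
      then show ?thesis by (simp only: exp_double)
    qed
    have E2: "exp ((4 * \<rho> + 4) * g y) = exp ((4 * \<rho> + 5) * g y) * exp (- g y)"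
      by (subst exp_add[symmetric]) (simp add: algebra_simps)
    have E3: "exp ((5 * \<rho> + 5) * g y) = exp ((4 * \<rho> + 5) * g y) * exp (\<rho> * g y)"
      by (subst exp_add[symmetric]) (simp add: algebra_simps)
    have c0: "0 \<le> c" by (simp add: c_def)
    have "(?q - \<sigma>)\<^sup>2 \<le> (\<eta> * (2 * real K + 1) * exp ((2 * \<rho> + 2) * g y) * ?q)\<^sup>2"
      using diff by (subst power2_abs[symmetric]) (intro power_mono, auto simp: abs_minus_commute)
    also have "\<dots> = c / 2 * exp ((4 * \<rho> + 4) * g y) * ?q * ?q"
      unfolding power_mult_distrib E1 c_def by (simp add: power2_eq_square[of "q y"])
    also have "\<dots> = c * exp ((4 * \<rho> + 5) * g y) * ?q * (exp (- g y) / 2 * ?q)"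
      unfolding E2 by simp
    also have "\<dots> \<le> c * exp ((4 * \<rho> + 5) * g y) * ?q * \<sigma>"
      using low q_pos[of y] c0 by (intro mult_left_mono) auto
    finally have "(?q - \<sigma>)\<^sup>2 / \<sigma> \<le> c * exp ((4 * \<rho> + 5) * g y) * ?q"
      using \<sigma>_pos by (simp add: pos_divide_le_eq)
    also have "\<dots> \<le> c * exp ((4 * \<rho> + 5) * g y) * (exp (\<rho> * g y) * f y)"
      using q_le_f c0 by (intro mult_left_mono) auto
    also have "\<dots> = c * (exp ((5 * \<rho> + 5) * g y) * f y)"
      unfolding E3 by simp
    finally have "(?q - \<sigma>)\<^sup>2 / \<sigma> \<le> c * (exp ((5 * \<rho> + 5) * g y) * f y)" .
    moreover have "?q / \<sigma> * ?q + \<sigma> = (?q - \<sigma>)\<^sup>2 / \<sigma> + 2 * ?q"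
    proof -
      have "(?q - \<sigma>)\<^sup>2 = ?q * ?q - 2 * ?q * \<sigma> + \<sigma> * \<sigma>" by (simp add: power2_eq_square algebra_simps)
      then show ?thesis using \<sigma>_pos by (simp add: add_divide_distrib diff_divide_distrib)
    qed
    ultimately have "?q / \<sigma> * ?q + \<sigma> \<le> c * (exp ((5 * \<rho> + 5) * g y) * f y) + 2 * ?q" by linarith
    then have "ennreal (?q / \<sigma> * ?q + \<sigma>) \<le> ennreal (c * (exp ((5 * \<rho> + 5) * g y) * f y) + 2 * ?q)"
      by (rule ennreal_leI)
    moreover have "ennreal (?q / \<sigma> * ?q + \<sigma>) = ennreal ?q / s y * ennreal ?q + s y"
      using \<sigma>_pos q_pos[of y] unfolding s_\<sigma>
      by (subst ennreal_plus) (simp_all add: divide_ennreal flip: ennreal_mult)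
    moreover have "ennreal (c * (exp ((5 * \<rho> + 5) * g y) * f y) + 2 * ?q) =
        ennreal c * ennreal (exp ((5 * \<rho> + 5) * g y) * f y) + 2 * ennreal ?q"
      using q_pos[of y] f0[of y] c0 by (subst ennreal_plus) (simp_all add: ennreal_mult)
    ultimately show ?thesis by simp
  qed
  have "(\<integral>\<^sup>+y. ennreal (q y) / s y * ennreal (q y) \<partial>lborel) + 1 =
    (\<integral>\<^sup>+y. ennreal (q y) / s y * ennreal (q y) + s y \<partial>lborel)"
    by (subst nn_integral_add) (auto simp: s_int)
  also have "\<dots> \<le> (\<integral>\<^sup>+y. ennreal c * ennreal (exp ((5 * \<rho> + 5) * g y) * f y) + 2 * ennreal (q y) \<partial>lborel)"
    by (intro nn_integral_mono main)
  also have "\<dots> = ennreal c * (\<integral>\<^sup>+y. ennreal (exp ((5 * \<rho> + 5) * g y) * f y) \<partial>lborel) + 1 + 1"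
    by (subst nn_integral_add) (auto simp: nn_integral_cmult q_int add.assoc)
  finally have "(\<integral>\<^sup>+y. ennreal (q y) / s y * ennreal (q y) \<partial>lborel) \<le>
      ennreal c * (\<integral>\<^sup>+y. ennreal (exp ((5 * \<rho> + 5) * g y) * f y) \<partial>lborel) + 1"
    by (simp add: ennreal_add_left_cancel_le add.commute[of _ 1])
  then show ?thesis unfolding c_def by (simp add: add.commute)
qed

section \<open>Prior mass near the truth\<close>

text \<open>Near \<open>t\<close> the density is at least half of its value at \<open>t\<close>, and \<open>\<Theta>\<close> fills a fixed proportion
of each small ball around \<open>t\<close>.\<close>

lemma base_density_ball_mass:
  fixes P0 :: "(real^'d) measure"
  assumes bd: "base_density_on \<Theta> p0 P0" and \<Theta>: "compact \<Theta>" and t: "t \<in> \<Theta>" "0 < p0 t"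
    and ld: "lower_density_pos \<Theta> t"
  shows "\<exists>c>0. \<exists>\<delta>0>0. \<forall>\<delta>. 0 < \<delta> \<and> \<delta> \<le> \<delta>0 \<longrightarrow> ennreal (c * \<delta> ^ CARD('d)) \<le> emeasure P0 (cball t \<delta>)"
proof -
  from bd have P0: "P0 = density lborel (\<lambda>\<theta>. ennreal (indicator \<Theta> \<theta> * p0 \<theta>))"
    and cont: "continuous_on \<Theta> p0" and nn: "\<And>\<theta>. \<theta> \<in> \<Theta> \<Longrightarrow> 0 \<le> p0 \<theta>"
    unfolding base_density_on_def by auto
  have \<Theta>b [measurable]: "\<Theta> \<in> sets borel" using \<Theta> by (simp add: borel_compact)
  have [measurable]: "(\<lambda>\<theta>. indicator \<Theta> \<theta> * p0 \<theta>) \<in> borel_measurable borel"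
    using borel_measurable_continuous_on_indicator[OF \<Theta>b cont] by simp
  from ld obtain c where c: "0 < c" and mass: "\<And>\<epsilon>. 0 < \<epsilon> \<Longrightarrow> \<epsilon> \<le> 1 \<Longrightarrow>
      c * \<epsilon> ^ CARD('d) \<le> measure lborel (\<Theta> \<inter> ball t \<epsilon>)"
    unfolding lower_density_pos_def by auto
  from cont t obtain d where d: "0 < d" "\<And>\<theta>. \<theta> \<in> \<Theta> \<Longrightarrow> dist \<theta> t < d \<Longrightarrow> dist (p0 \<theta>) (p0 t) < p0 t / 2"
    unfolding continuous_on_iff by (metis half_gt_zero)
  have "ennreal (p0 t / 2 * c * \<delta> ^ CARD('d)) \<le> emeasure P0 (cball t \<delta>)"
    if \<delta>: "0 < \<delta>" "\<delta> \<le> min 1 d" for \<delta>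
  proof -
    have fin: "emeasure lborel (\<Theta> \<inter> ball t \<delta>) \<noteq> \<infinity>"
      by (metis bounded_Int bounded_ball emeasure_bounded_finite infinity_ennreal_def less_irrefl)
    have "ennreal (p0 t / 2 * c * \<delta> ^ CARD('d)) \<le> ennreal (p0 t / 2) * ennreal (measure lborel (\<Theta> \<inter> ball t \<delta>))"
      using mass[of \<delta>] \<delta> t c
      by (subst ennreal_mult[symmetric]) (auto intro!: ennreal_leI simp: mult.assoc)
    also have "\<dots> = (\<integral>\<^sup>+\<theta>. ennreal (p0 t / 2) * indicator (\<Theta> \<inter> ball t \<delta>) \<theta> \<partial>lborel)"
      using fin by (subst nn_integral_cmult_indicator) (auto simp: emeasure_eq_ennreal_measure)
    also have "\<dots> \<le> (\<integral>\<^sup>+\<theta>. ennreal (indicator \<Theta> \<theta> * p0 \<theta>) * indicator (cball t \<delta>) \<theta> \<partial>lborel)"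
    proof (intro nn_integral_mono)
      fix \<theta>
      have "p0 t / 2 \<le> p0 \<theta>" if "\<theta> \<in> \<Theta>" "\<theta> \<in> ball t \<delta>"
      proof -
        have "dist \<theta> t < d" using that \<delta> by (simp add: dist_commute)
        then have "\<bar>p0 \<theta> - p0 t\<bar> < p0 t / 2" using d(2)[OF that(1)] by (simp add: dist_real_def)
        then show ?thesis by linarith
      qed
      then show "ennreal (p0 t / 2) * indicator (\<Theta> \<inter> ball t \<delta>) \<theta> \<le>
          ennreal (indicator \<Theta> \<theta> * p0 \<theta>) * indicator (cball t \<delta>) \<theta>"
        by (auto simp: indicator_def intro!: ennreal_leI)
    qed
    also have "\<dots> = emeasure P0 (cball t \<delta>)"
      unfolding P0 by (subst emeasure_density) auto
    finally show ?thesis .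
  qed
  moreover have "0 < p0 t / 2 * c" "0 < min 1 d" using t c d by auto
  ultimately show ?thesis by blast
qed

text \<open>The inverse of stick breaking: the proportion of the remaining mass that the weight \<open>k\<close> takes.\<close>

definition stick_of_weight :: "(nat \<Rightarrow> real) \<Rightarrow> nat \<Rightarrow> real" where
  "stick_of_weight ws k = ws k / (1 - (\<Sum>j<k. ws j))"

lemma stick_of_weight:
  assumes pos: "\<And>k. k < K \<Longrightarrow> 0 < ws k" and sum: "(\<Sum>k<K. ws k) = 1" and k: "k < K"
  shows "stick_weight (stick_of_weight ws) k = ws k" "0 < stick_of_weight ws k"
    "Suc k < K \<Longrightarrow> stick_of_weight ws k < 1" "Suc k = K \<Longrightarrow> stick_of_weight ws k = 1"
proof -
  have split: "(\<Sum>j<K. ws j) = (\<Sum>j<k. ws j) + (\<Sum>j\<in>{k..<K}. ws j)"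
    using k by (subst sum.union_disjoint[symmetric]) (auto intro!: sum.cong)
  have "(\<Sum>j\<in>{k..<K}. ws j) = ws k + (\<Sum>j\<in>{Suc k..<K}. ws j)"
    using k by (rule sum.atLeast_Suc_lessThan)
  then have r: "1 - (\<Sum>j<k. ws j) = ws k + (\<Sum>j\<in>{Suc k..<K}. ws j)" using split sum by simp
  have nn: "0 \<le> (\<Sum>j\<in>{Suc k..<K}. ws j)" using pos by (intro sum_nonneg) (auto intro: less_imp_le)
  show "0 < stick_of_weight ws k"
    unfolding stick_of_weight_def r using pos[OF k] nn by simp
  show "stick_of_weight ws k = 1" if "Suc k = K"
    unfolding stick_of_weight_def r using pos[OF k] that by simp
  show "stick_of_weight ws k < 1" if "Suc k < K"
  proof -
    have "0 < (\<Sum>j\<in>{Suc k..<K}. ws j)" using pos that by (intro sum_pos) auto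
    then show ?thesis unfolding stick_of_weight_def r using pos[OF k] by simp
  qed
  show "stick_weight (stick_of_weight ws) k = ws k"
    using k
  proof (induction k rule: less_induct)
    case (less k)
    have "(\<Sum>j<k. stick_weight (stick_of_weight ws) j) = (\<Sum>j<k. ws j)"
      using less by (intro sum.cong) auto
    then have "(\<Prod>j<k. 1 - stick_of_weight ws j) = 1 - (\<Sum>j<k. ws j)"
      using sum_stick_weight[of "stick_of_weight ws" k] by (simp add: stick_rest_def)
    moreover have "(\<Sum>j<k. ws j) < (\<Sum>j<K. ws j)"
      using less.prems pos by (intro sum_strict_mono2[where b=k]) (auto intro: less_imp_le)
    ultimately show ?case using sum by (simp add: stick_weight_def stick_of_weight_def)
  qed
qed

lemma stick_weight_close:
  assumes "\<And>j. j \<le> k \<Longrightarrow> 0 \<le> v j \<and> v j \<le> 1" "\<And>j. j \<le> k \<Longrightarrow> 0 \<le> v' j \<and> v' j \<le> (1::real)"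
    and "\<And>j. j \<le> k \<Longrightarrow> \<bar>v j - v' j\<bar> \<le> \<delta>"
  shows "\<bar>stick_weight v k - stick_weight v' k\<bar> \<le> real (Suc k) * \<delta>"
proof -
  let ?z = "\<lambda>v j. if j = k then v j else 1 - v j :: real"
  have eq: "stick_weight v k = (\<Prod>j<Suc k. ?z v j)" for v
    by (simp add: stick_weight_def mult.commute)
  have "norm ((\<Prod>j<Suc k. ?z v j) - (\<Prod>j<Suc k. ?z v' j)) \<le> (\<Sum>j<Suc k. norm (?z v j - ?z v' j))"
    using assms(1,2) by (intro norm_prod_diff) (auto simp: abs_le_iff less_Suc_eq_le)
  also have "\<dots> \<le> (\<Sum>j<Suc k. \<delta>)"
    using assms(3) by (intro sum_mono) (auto simp: abs_minus_commute less_Suc_eq_le)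
  finally show ?thesis unfolding eq by simp
qed

text \<open>The assumptions of the theorem for one fixed \<open>\<alpha>\<close> and one fixed model.\<close>

locale dp_setting =
  fixes \<alpha> :: real and f :: "real^'d \<Rightarrow> real" and \<Theta> P0 K ws ts
  assumes \<alpha>0: "0 < \<alpha>" and ma: "mixture_assumptions f \<Theta> P0 K ws ts"
begin

definition Fb :: real where "Fb = (SOME F. \<forall>x. 0 < f x \<and> f x < F)"

lemma f_bounds: "0 < f x" "f x < Fb"
proof -
  have "\<exists>F. \<forall>x. 0 < f x \<and> f x < F"
    using ma unfolding mixture_assumptions_def smooth_bounded_kernel_def by blast
  then have "\<forall>x. 0 < f x \<and> f x < Fb" unfolding Fb_def by (rule someI_ex)
  then show "0 < f x" "f x < Fb" by auto
qed

lemma f_borel: "f \<in> borel_measurable borel"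
proof -
  have "C_k_on_UNIV 3 f"
    using ma unfolding mixture_assumptions_def smooth_bounded_kernel_def by blast
  then have "continuous_on UNIV (partials [] f)" unfolding C_k_on_UNIV_def by (metis list.size(3) zero_le)
  then show ?thesis by (simp add: borel_measurable_continuous_onI)
qed

lemma f_int: "(\<integral>\<^sup>+y. ennreal (f y) \<partial>lborel) = 1"
proof -
  have "prob_space (density lborel (\<lambda>x. ennreal (f x)))"
    using ma unfolding mixture_assumptions_def by blast
  from prob_space.emeasure_space_1[OF this] show ?thesis
    using f_borel by (simp add: emeasure_density)
qed

lemma ws: "k < K \<Longrightarrow> 0 < ws k" "(\<Sum>k<K. ws k) = 1"
  using ma unfolding mixture_assumptions_def true_mixing_def by auto

lemma K_pos: "0 < K" using ws(2) by (cases K) auto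

lemma base_ex: "\<exists>p0. base_density_on \<Theta> p0 P0 \<and> (\<forall>k<K. 0 < p0 (ts k))"
  using ma unfolding mixture_assumptions_def by (elim conjE)

lemma compact_\<Theta>: "compact \<Theta>"
  using ma unfolding mixture_assumptions_def by (elim conjE)

lemma P0_facts: "prob_space P0 \<and> sets P0 = sets borel \<and> (AE \<theta> in P0. \<theta> \<in> \<Theta>)"
proof -
  from base_ex obtain p0 where "base_density_on \<Theta> p0 P0 \<and> (\<forall>k<K. 0 < p0 (ts k))" ..
  then have "base_density_on \<Theta> p0 P0" ..
  note b = this[unfolded base_density_on_def]
  note 1 = b[THEN conjunct1] and 2 = b[THEN conjunct2, THEN conjunct1]
    and 3 = b[THEN conjunct2, THEN conjunct2, THEN conjunct1]
  have "(\<lambda>\<theta>. indicator \<Theta> \<theta> *\<^sub>R p0 \<theta>) \<in> borel_measurable borel"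
    by (rule borel_measurable_continuous_on_indicator[OF borel_compact[OF compact_\<Theta>] 3])
  then have 4: "(\<lambda>\<theta>. indicator \<Theta> \<theta> * p0 \<theta>) \<in> borel_measurable borel" by simp
  have "AE \<theta> in density lborel (\<lambda>\<theta>. ennreal (indicator \<Theta> \<theta> * p0 \<theta>)). \<theta> \<in> \<Theta>"
    using 4 by (subst AE_density) (auto simp: indicator_def)
  then have "AE \<theta> in P0. \<theta> \<in> \<Theta>" by (subst 2)
  moreover have "sets P0 = sets borel" by (subst 2) simp
  ultimately show ?thesis using 1 by blast
qed

lemmas prob_P0 = P0_facts[THEN conjunct1]
  and sets_P0 = P0_facts[THEN conjunct2, THEN conjunct1]
  and P0_\<Theta> = P0_facts[THEN conjunct2, THEN conjunct2]

sublocale dp_prior \<alpha> P0 f Fb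
  by (rule dp_prior.intro[OF \<alpha>0 prob_P0 sets_P0 f_borel f_bounds(1) less_imp_le[OF f_bounds(2)]])

definition q :: "real^'d \<Rightarrow> real" where "q y = (\<Sum>k<K. ws k * f (y - ts k))"

lemma mixture_q: "mixture f (discrete_measure {..<K} ws ts) y = q y"
proof -
  have "mixture f (discrete_measure {..<K} ws ts) y =
    (\<integral>k. f (y - ts k) \<partial>point_measure {..<K} (\<lambda>k. ennreal (ws k)))"
    unfolding mixture_def discrete_measure_def using f_borel
    by (subst integral_distr) auto
  also have "\<dots> = q y"
    unfolding q_def using ws(1) by (subst lebesgue_integral_point_measure_finite) (auto intro: less_imp_le)
  finally show ?thesis .
qed

lemma data_law_eq: "data_law f K ws ts = PiM UNIV (\<lambda>_. density lborel (\<lambda>x. ennreal (q x)))"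
  unfolding data_law_def mixture_q ..

lemma q_borel [measurable]: "q \<in> borel_measurable borel"
  using f_borel unfolding q_def by measurable

lemma q_positive: "0 < q y"
  unfolding q_def using K_pos ws f_bounds by (intro sum_pos mult_pos_pos) auto

lemma q_integral: "(\<integral>\<^sup>+y. ennreal (q y) \<partial>lborel) = 1"
proof -
  have tr: "(\<integral>\<^sup>+y. ennreal (f (y - c)) \<partial>lborel) = 1" for c
    using f_borel f_int by (subst nn_integral_lborel_translate[where h="\<lambda>y. ennreal (f y)"]) auto
  have "(\<integral>\<^sup>+y. ennreal (q y) \<partial>lborel) = (\<integral>\<^sup>+y. (\<Sum>k<K. ennreal (ws k) * ennreal (f (y - ts k))) \<partial>lborel)"
  proof (intro nn_integral_cong)
    fix y
    have "ennreal (q y) = (\<Sum>k<K. ennreal (ws k * f (y - ts k)))"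
      unfolding q_def using ws(1) f_bounds(1) by (subst sum_ennreal) (auto intro: less_imp_le)
    also have "\<dots> = (\<Sum>k<K. ennreal (ws k) * ennreal (f (y - ts k)))"
      using ws(1) f_bounds(1) by (intro sum.cong ennreal_mult) (auto intro: less_imp_le)
    finally show "ennreal (q y) = (\<Sum>k<K. ennreal (ws k) * ennreal (f (y - ts k)))" .
  qed
  also have "\<dots> = (\<Sum>k<K. \<integral>\<^sup>+y. ennreal (ws k) * ennreal (f (y - ts k)) \<partial>lborel)"
    by (rule nn_integral_sum) measurable
  also have "\<dots> = (\<Sum>k<K. ennreal (ws k))"
    by (intro sum.cong) (simp_all add: nn_integral_cmult tr)
  also have "\<dots> = 1" using ws by (subst sum_ennreal) (auto intro: less_imp_le)
  finally show ?thesis .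
qed

lemma mixture_dataI:
  assumes "random_mixture S w t f Fb"
  shows "mixture_data S w t f Fb q"
  using assms q_borel q_positive q_integral f_int
  by (simp add: mixture_data_def mixture_data_axioms_def)

abbreviation "vs \<equiv> stick_of_weight ws"

text \<open>The sticks approach the true ones from below: the last true stick is \<open>1\<close>, and values above it have prior probability
zero.\<close>

definition near :: "real \<Rightarrow> ((nat \<Rightarrow> real) \<times> (nat \<Rightarrow> real^'d)) set" where
  "near \<delta> = {v \<in> space V. \<forall>k\<in>{..<K}. v k \<in> {vs k - \<delta>..vs k}} \<times>
    {t \<in> space T. \<forall>k\<in>{..<K}. t k \<in> cball (ts k) \<delta>}"

lemma near_factors:
  "{v \<in> space V. \<forall>k\<in>{..<K}. v k \<in> {vs k - \<delta>..vs k}} \<in> sets V"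
  "{t \<in> space T. \<forall>k\<in>{..<K}. t k \<in> cball (ts k) \<delta>} \<in> sets T"
proof -
  have "{v \<in> space V. v k \<in> {vs k - \<delta>..vs k}} \<in> sets V" for k
    by (rule sets_Collect_single') auto
  then show "{v \<in> space V. \<forall>k\<in>{..<K}. v k \<in> {vs k - \<delta>..vs k}} \<in> sets V"
    by (intro sets.sets_Collect_finite_All) auto
  have "{t \<in> space T. t k \<in> cball (ts k) \<delta>} \<in> sets T" for k
    by (rule sets_Collect_single') (auto simp: sets_P0)
  then show "{t \<in> space T. \<forall>k\<in>{..<K}. t k \<in> cball (ts k) \<delta>} \<in> sets T"
    by (intro sets.sets_Collect_finite_All) auto
qed

lemma near_sets: "near \<delta> \<in> sets (dp_sticks \<alpha> P0)"
  unfolding near_def dp_sticks_eq by (intro pair_measureI near_factors)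

lemma near_emeasure:
  "emeasure (dp_sticks \<alpha> P0) (near \<delta>) =
    (\<Prod>k<K. emeasure (beta_law 1 \<alpha>) {vs k - \<delta>..vs k}) * (\<Prod>k<K. emeasure P0 (cball (ts k) \<delta>))"
proof -
  interpret B: prob_space "beta_law 1 \<alpha>" using \<alpha>0 by (rule prob_space_beta_law)
  interpret BV: product_prob_space "\<lambda>_::nat. beta_law 1 \<alpha>" UNIV by unfold_locales
  interpret A: prob_space P0 by (rule prob_P0)
  interpret AT: product_prob_space "\<lambda>_::nat. P0" UNIV by unfold_locales
  have "emeasure V {v \<in> space V. \<forall>k\<in>{..<K}. v k \<in> {vs k - \<delta>..vs k}} =
      (\<Prod>k<K. emeasure (beta_law 1 \<alpha>) {vs k - \<delta>..vs k})"
    by (rule BV.emeasure_PiM_Collect) auto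
  moreover have "emeasure T {t \<in> space T. \<forall>k\<in>{..<K}. t k \<in> cball (ts k) \<delta>} =
      (\<Prod>k<K. emeasure P0 (cball (ts k) \<delta>))"
    by (rule AT.emeasure_PiM_Collect) (auto simp: sets_P0)
  ultimately show ?thesis
    unfolding near_def dp_sticks_eq T.emeasure_pair_measure_Times[OF near_factors] by simp
qed

lemma vs_weight:
  assumes "k < K"
  shows "stick_weight vs k = ws k" "0 < vs k" "Suc k < K \<Longrightarrow> vs k < 1" "Suc k = K \<Longrightarrow> vs k = 1"
  using stick_of_weight[of K ws k, OF _ ws(2) assms] ws(1) by blast+

text \<open>Each of the first \<open>K - 1\<close> sticks contributes one dimension and each of the \<open>K\<close> atoms contributes
\<open>CARD('d)\<close> dimensions. The \<open>K\<close>-th stick has to come close to \<open>1\<close>, which contributes \<open>\<alpha>\<close>.\<close>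

definition mass_exponent :: real where
  "mass_exponent = \<alpha> + real (K - 1) + real K * real CARD('d)"

lemma near_mass:
  "\<exists>c>0. \<exists>\<delta>0>0. \<forall>\<delta>. 0 < \<delta> \<and> \<delta> \<le> \<delta>0 \<longrightarrow>
    ennreal (c * \<delta> powr mass_exponent) \<le> emeasure (dp_sticks \<alpha> P0) (near \<delta>)"
proof -
  obtain K' where K': "K = Suc K'" using K_pos by (cases K) auto
  have vs: "0 < vs k" "vs k < 1" if "k < K'" for k
  proof -
    have "k < K" "Suc k < K" using that K' by linarith+
    then show "0 < vs k" "vs k < 1" by (blast intro: vs_weight)+
  qed
  have vsK: "vs K' = 1"
  proof -
    have "K' < K" "Suc K' = K" using K' by linarith+
    then show ?thesis by (rule vs_weight(4))
  qed
  have "\<forall>k\<in>{..<K'}. \<exists>c>0. \<forall>\<delta>. 0 < \<delta> \<and> \<delta> \<le> vs k / 2 \<longrightarrow>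
      ennreal (c * \<delta>) \<le> emeasure (beta_law 1 \<alpha>) {vs k - \<delta>..vs k}"
  proof
    fix k assume "k \<in> {..<K'}"
    then have k: "k < K'" by simp
    show "\<exists>c>0. \<forall>\<delta>. 0 < \<delta> \<and> \<delta> \<le> vs k / 2 \<longrightarrow>
        ennreal (c * \<delta>) \<le> emeasure (beta_law 1 \<alpha>) {vs k - \<delta>..vs k}"
      by (rule emeasure_beta_law_inner[OF \<alpha>0 vs[OF k]])
  qed
  from bchoice[OF this] obtain cb where cb': "\<forall>k\<in>{..<K'}. 0 < cb k \<and> (\<forall>\<delta>. 0 < \<delta> \<and> \<delta> \<le> vs k / 2 \<longrightarrow>
      ennreal (cb k * \<delta>) \<le> emeasure (beta_law 1 \<alpha>) {vs k - \<delta>..vs k})" ..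
  have cb: "\<And>k. k < K' \<Longrightarrow> 0 < cb k" "\<And>k \<delta>. k < K' \<Longrightarrow> 0 < \<delta> \<Longrightarrow> \<delta> \<le> vs k / 2 \<Longrightarrow>
      ennreal (cb k * \<delta>) \<le> emeasure (beta_law 1 \<alpha>) {vs k - \<delta>..vs k}"
    using cb' by simp_all
  from base_ex obtain p0 where p0': "base_density_on \<Theta> p0 P0 \<and> (\<forall>k<K. 0 < p0 (ts k))" ..
  then have p0: "base_density_on \<Theta> p0 P0" "\<And>k. k < K \<Longrightarrow> 0 < p0 (ts k)" by simp_all
  have ts: "ts k \<in> \<Theta>" "lower_density_pos \<Theta> (ts k)" if "k < K" for k
    using ma that by (simp_all add: mixture_assumptions_def)
  have "\<forall>k\<in>{..<K}. \<exists>c. 0 < c \<and> (\<exists>\<delta>0>0. \<forall>\<delta>. 0 < \<delta> \<and> \<delta> \<le> \<delta>0 \<longrightarrow>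
      ennreal (c * \<delta> ^ CARD('d)) \<le> emeasure P0 (cball (ts k) \<delta>))"
  proof
    fix k assume "k \<in> {..<K}"
    then have k: "k < K" by simp
    show "\<exists>c. 0 < c \<and> (\<exists>\<delta>0>0. \<forall>\<delta>. 0 < \<delta> \<and> \<delta> \<le> \<delta>0 \<longrightarrow>
        ennreal (c * \<delta> ^ CARD('d)) \<le> emeasure P0 (cball (ts k) \<delta>))"
      by (rule base_density_ball_mass[OF p0(1) compact_\<Theta> ts(1)[OF k] p0(2)[OF k] ts(2)[OF k]])
  qed
  from bchoice[OF this] obtain ca where ca: "\<forall>k\<in>{..<K}. 0 < ca k \<and> (\<exists>\<delta>0>0. \<forall>\<delta>. 0 < \<delta> \<and> \<delta> \<le> \<delta>0 \<longrightarrow>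
      ennreal (ca k * \<delta> ^ CARD('d)) \<le> emeasure P0 (cball (ts k) \<delta>))" ..
  then have "\<forall>k\<in>{..<K}. \<exists>d. 0 < d \<and> (\<forall>\<delta>. 0 < \<delta> \<and> \<delta> \<le> d \<longrightarrow>
      ennreal (ca k * \<delta> ^ CARD('d)) \<le> emeasure P0 (cball (ts k) \<delta>))" by blast
  from bchoice[OF this] obtain da where da: "\<forall>k\<in>{..<K}. 0 < da k \<and> (\<forall>\<delta>. 0 < \<delta> \<and> \<delta> \<le> da k \<longrightarrow>
      ennreal (ca k * \<delta> ^ CARD('d)) \<le> emeasure P0 (cball (ts k) \<delta>))" ..
  have ca: "\<And>k. k < K \<Longrightarrow> 0 < ca k" "\<And>k. k < K \<Longrightarrow> 0 < da k"
    "\<And>k \<delta>. k < K \<Longrightarrow> 0 < \<delta> \<Longrightarrow> \<delta> \<le> da k \<Longrightarrow>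
      ennreal (ca k * \<delta> ^ CARD('d)) \<le> emeasure P0 (cball (ts k) \<delta>)"
    using ca da by simp_all
  define D where "D = insert 1 ((\<lambda>k. vs k / 2) ` {..<K'} \<union> da ` {..<K})"
  have D: "finite D" "D \<noteq> {}" "\<forall>d\<in>D. 0 < d" using vs ca by (auto simp: D_def)
  define c where "c = (\<Prod>k<K'. cb k) * (\<Prod>k<K. ca k)"
  show ?thesis
  proof (rule exI[of _ c], rule conjI[rotated], rule exI[of _ "Min D"], intro conjI allI impI)
    show "0 < c" unfolding c_def using cb ca by (intro mult_pos_pos prod_pos) auto
    show "0 < Min D" using D by simp
    fix \<delta> assume "0 < \<delta> \<and> \<delta> \<le> Min D"
    then have \<delta>: "0 < \<delta>" "\<delta> \<le> Min D" by simp_all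
    then have \<delta>_le: "\<And>d. d \<in> D \<Longrightarrow> \<delta> \<le> d" using D by (meson Min_le order_trans)
    have d1: "\<delta> \<le> 1" and d2: "k < K' \<Longrightarrow> \<delta> \<le> vs k / 2" and d3: "k < K \<Longrightarrow> \<delta> \<le> da k" for k
      by (rule \<delta>_le; force simp: D_def)+
    have "(\<Prod>k<K'. ennreal (cb k * \<delta>)) \<le> (\<Prod>k<K'. emeasure (beta_law 1 \<alpha>) {vs k - \<delta>..vs k})"
      using cb(2)[OF _ \<delta>(1) d2] by (intro prod_mono_ennreal) simp
    moreover have "(\<Prod>k<K'. ennreal (cb k * \<delta>)) = ennreal (\<Prod>k<K'. cb k * \<delta>)"
      using cb(1) \<delta> by (intro prod_ennreal) (simp add: less_imp_le)
    ultimately have 1: "ennreal (\<Prod>k<K'. cb k * \<delta>) \<le> (\<Prod>k<K'. emeasure (beta_law 1 \<alpha>) {vs k - \<delta>..vs k})"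
      by simp
    have 2: "ennreal (\<delta> powr \<alpha>) \<le> emeasure (beta_law 1 \<alpha>) {vs K' - \<delta>..vs K'}"
      using emeasure_beta_law_top[OF \<alpha>0 \<delta>(1) d1] vsK by simp
    have "(\<Prod>k<K. ennreal (ca k * \<delta> ^ CARD('d))) \<le> (\<Prod>k<K. emeasure P0 (cball (ts k) \<delta>))"
      using ca(3)[OF _ \<delta>(1) d3] by (intro prod_mono_ennreal) simp
    moreover have "(\<Prod>k<K. ennreal (ca k * \<delta> ^ CARD('d))) = ennreal (\<Prod>k<K. ca k * \<delta> ^ CARD('d))"
      using ca(1) \<delta> by (intro prod_ennreal) (simp add: less_imp_le)
    ultimately have 3: "ennreal (\<Prod>k<K. ca k * \<delta> ^ CARD('d)) \<le> (\<Prod>k<K. emeasure P0 (cball (ts k) \<delta>))"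
      by simp
    have nn: "0 \<le> (\<Prod>k<K'. cb k * \<delta>)" "0 \<le> (\<Prod>k<K. ca k * \<delta> ^ CARD('d))"
      using cb(1) ca(1) \<delta> by (auto intro!: prod_nonneg mult_nonneg_nonneg simp: less_imp_le)
    have "\<delta> powr mass_exponent = \<delta> powr \<alpha> * \<delta> ^ K' * \<delta> ^ (K * CARD('d))"
    proof -
      have "mass_exponent = \<alpha> + real K' + real (K * CARD('d))" unfolding mass_exponent_def by (simp add: K' algebra_simps)
      then show ?thesis using \<delta>(1) by (simp only: powr_add powr_realpow)
    qed
    then have "c * \<delta> powr mass_exponent = (\<Prod>k<K'. cb k * \<delta>) * \<delta> powr \<alpha> * (\<Prod>k<K. ca k * \<delta> ^ CARD('d))"
      by (simp add: c_def prod.distrib power_mult[symmetric] mult_ac)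
    then have "ennreal (c * \<delta> powr mass_exponent) =
        ennreal (\<Prod>k<K'. cb k * \<delta>) * ennreal (\<delta> powr \<alpha>) * ennreal (\<Prod>k<K. ca k * \<delta> ^ CARD('d))"
      using nn by (simp add: ennreal_mult)
    also have "\<dots> \<le> (\<Prod>k<K'. emeasure (beta_law 1 \<alpha>) {vs k - \<delta>..vs k}) *
        emeasure (beta_law 1 \<alpha>) {vs K' - \<delta>..vs K'} * (\<Prod>k<K. emeasure P0 (cball (ts k) \<delta>))"
      by (intro mult_mono 1 2 3) auto
    also have "\<dots> = emeasure (dp_sticks \<alpha> P0) (near \<delta>)"
      unfolding near_emeasure by (simp add: K')
    finally show "ennreal (c * \<delta> powr mass_exponent) \<le> emeasure (dp_sticks \<alpha> P0) (near \<delta>)" .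
  qed
qed

end

section \<open>The evidence is at most polynomially small\<close>

lemma ennreal_inverse_antimono: "b \<le> c \<Longrightarrow> inverse c \<le> inverse (b :: ennreal)"
  including ennreal.lifting by transfer (rule ereal_inverse_antimono)

lemma ennreal_divide_left_mono: "b \<le> c \<Longrightarrow> a / c \<le> a / (b :: ennreal)"
  unfolding divide_ennreal_def by (intro mult_left_mono ennreal_inverse_antimono) simp_all

context dp_setting
begin

lemma AE_atoms: "AE s in dp_sticks \<alpha> P0. \<forall>k. snd s k \<in> \<Theta>"
  unfolding AE_all_countable
proof
  fix k
  interpret A: prob_space P0 by (rule prob_P0)
  interpret AT: product_prob_space "\<lambda>_::nat. P0" UNIV by unfold_locales
  have m: "{t \<in> space T. t k \<in> \<Theta>} \<in> sets T"
    by (rule sets_Collect_single') (use borel_compact[OF compact_\<Theta>] in \<open>simp_all add: sets_P0\<close>)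
  have "{s \<in> space (V \<Otimes>\<^sub>M T). snd s k \<in> \<Theta>} = space V \<times> {t \<in> space T. t k \<in> \<Theta>}"
    by (auto simp: space_pair_measure)
  also have "\<dots> \<in> sets (V \<Otimes>\<^sub>M T)" using m by (intro pair_measureI) auto
  finally have "{s \<in> space (V \<Otimes>\<^sub>M T). snd s k \<in> \<Theta>} \<in> sets (V \<Otimes>\<^sub>M T)" .
  moreover have "AE v in V. AE t in T. snd (v, t) k \<in> \<Theta>"
    using AT.AE_component[OF _ P0_\<Theta>, of k] by simp
  ultimately show "AE s in dp_sticks \<alpha> P0. snd s k \<in> \<Theta>"
    unfolding dp_sticks_eq by (rule VT.AE_pair_measure)
qed

abbreviation "Xlaw \<equiv> data_law f K ws ts"

text \<open>The radius \<open>1 / sqrt n\<close> balances the two factors: the chi-square divergences are of order \<open>1 / n\<close>, so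
that their \<open>n\<close>-fold product is bounded, and the prior mass of the neighbourhood is polynomial in \<open>n\<close>.
The bound is uniform over all weights that are stick-breaking weights for the labels below \<open>K\<close>, which covers the
Dirichlet process and its truncations at any level from \<open>K\<close> on.\<close>

lemma evidence_bound:
  "\<exists>C>0. \<exists>n0. \<forall>n\<ge>n0. \<forall>w. random_mixture (dp_sticks \<alpha> P0) w snd f Fb \<and>
      (\<forall>s. \<forall>k<K. w s k = stick_weight (fst s) k) \<longrightarrow>
      (\<integral>\<^sup>+x. (\<Prod>i<n. ennreal (q (x i))) / random_mixture.evidence (dp_sticks \<alpha> P0) w snd f n x \<partial>Xlaw)
        \<le> ennreal (C * real n powr (mass_exponent / 2))"
proof -
  obtain b where b: "\<And>\<theta>. \<theta> \<in> \<Theta> \<Longrightarrow> norm \<theta> \<le> b"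
    using compact_imp_bounded[OF compact_\<Theta>] unfolding bounded_iff by blast
  define \<rho> where "\<rho> = max 1 b"
  have \<rho>: "0 < \<rho>" "\<And>\<theta>. \<theta> \<in> \<Theta> \<Longrightarrow> norm \<theta> \<le> \<rho>" using b unfolding \<rho>_def by (auto simp: le_max_iff_disj)
  have sm: "smooth_bounded_kernel f" "log_deriv_growth f"
    using ma unfolding mixture_assumptions_def by simp_all
  have ts: "ts k \<in> \<Theta>" if "k < K" for k
    using ma that by (simp add: mixture_assumptions_def)
  from kernel_ratio_exists[OF sm \<rho>(1)] obtain g where g': "g \<in> borel_measurable borel \<and> (\<forall>x. 0 \<le> g x) \<and>
    (\<forall>x \<theta> \<theta>'. norm \<theta> \<le> \<rho> \<longrightarrow> norm \<theta>' \<le> \<rho> \<longrightarrow>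
      f (x - \<theta>) \<le> exp (g x * norm (\<theta> - \<theta>')) * f (x - \<theta>')) \<and>
    (\<forall>M>0. (\<integral>\<^sup>+x. ennreal (exp (M * g x) * f x) \<partial>lborel) < \<infinity>)" ..
  then have g: "g \<in> borel_measurable borel" "\<And>x. 0 \<le> g x"
    "\<And>x \<theta> \<theta>'. norm \<theta> \<le> \<rho> \<Longrightarrow> norm \<theta>' \<le> \<rho> \<Longrightarrow> f (x - \<theta>) \<le> exp (g x * norm (\<theta> - \<theta>')) * f (x - \<theta>')"
    "\<And>M. 0 < M \<Longrightarrow> (\<integral>\<^sup>+x. ennreal (exp (M * g x) * f x) \<partial>lborel) < \<infinity>"
    by blast+
  define I where "I = enn2real (\<integral>\<^sup>+x. ennreal (exp ((5 * \<rho> + 5) * g x) * f x) \<partial>lborel)"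
  have I: "(\<integral>\<^sup>+x. ennreal (exp ((5 * \<rho> + 5) * g x) * f x) \<partial>lborel) = ennreal I" "0 \<le> I"
    using g(4)[of "5 * \<rho> + 5"] \<rho>(1) by (simp_all add: I_def)
  from near_mass obtain c \<delta>0 where c: "0 < c" "0 < \<delta>0"
    "\<And>\<delta>. 0 < \<delta> \<Longrightarrow> \<delta> \<le> \<delta>0 \<Longrightarrow> ennreal (c * \<delta> powr mass_exponent) \<le> emeasure (dp_sticks \<alpha> P0) (near \<delta>)"
    by blast
  \<comment> \<open>If \<open>K * \<delta> \<le> w0\<close>, then \<open>\<eta> = K * \<delta>\<close> satisfies the smallness conditions of
    \<open>chi_square_bound\<close>.\<close>
  define w0 where "w0 = Min (insert 1 ((\<lambda>k. ws k / 2) ` {..<K}))"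
  have w0: "0 < w0" "w0 \<le> 1" "\<And>k. k < K \<Longrightarrow> w0 \<le> ws k / 2"
  proof -
    let ?A = "insert 1 ((\<lambda>k. ws k / 2) ` {..<K})"
    have "\<forall>a\<in>?A. 0 < a" using ws(1) by auto
    then show "0 < w0" unfolding w0_def by (subst Min_gr_iff) auto
    show "w0 \<le> 1" unfolding w0_def by (rule Min_le) auto
    show "w0 \<le> ws k / 2" if "k < K" for k unfolding w0_def by (rule Min_le) (use that in auto)
  qed
  define \<delta>1 where "\<delta>1 = min \<delta>0 (w0 / real K)"
  have \<delta>1: "0 < \<delta>1" "\<delta>1 \<le> \<delta>0" "real K * \<delta>1 \<le> w0"
    using c(2) w0(1) K_pos by (auto simp: \<delta>1_def min_def field_simps)
  define c' where "c' = 2 * (2 * real K + 1)\<^sup>2 * (real K)\<^sup>2 * I"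
  have c'0: "0 \<le> c'" using I(2) by (simp add: c'_def)
  show ?thesis
  proof (intro exI[of _ "exp c' / c"] exI[of _ "nat \<lceil>1 / \<delta>1\<^sup>2\<rceil> + 1"] conjI allI impI)
    show "0 < exp c' / c" using c by simp
    fix n w
    assume n: "nat \<lceil>1 / \<delta>1\<^sup>2\<rceil> + 1 \<le> n" and "random_mixture (dp_sticks \<alpha> P0) w snd f Fb \<and>
      (\<forall>s. \<forall>k<K. w s k = stick_weight (fst s) k)"
    then have rm: "random_mixture (dp_sticks \<alpha> P0) w snd f Fb"
      and w: "\<And>s k. k < K \<Longrightarrow> w s k = stick_weight (fst s) k" by blast+
    interpret mixture_data "dp_sticks \<alpha> P0" w snd f Fb q by (rule mixture_dataI[OF rm])
    define \<delta> where "\<delta> = 1 / sqrt (real n)"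
    have n1: "1 \<le> n" using n by simp
    have "1 / \<delta>1\<^sup>2 \<le> real n" using n by linarith
    then have "(1 / \<delta>1)\<^sup>2 \<le> real n" by (simp add: power_divide)
    then have "1 / \<delta>1 \<le> sqrt (real n)" by (rule real_le_rsqrt)
    then have \<delta>: "0 < \<delta>" "\<delta> \<le> \<delta>1" using n1 \<delta>1(1) by (auto simp: \<delta>_def field_simps)
    have \<delta>2: "\<delta>\<^sup>2 = 1 / real n" using n1 by (simp add: \<delta>_def power_divide)
    have \<eta>: "real K * \<delta> \<le> w0" using \<delta> \<delta>1(3) mult_left_mono[of \<delta> \<delta>1 "real K"] by simp
    \<comment> \<open>The almost sure properties are needed for each point of the neighbourhood, hence a null set
      is removed from it.\<close>
    define G where "G = (\<lambda>s. (\<forall>j. 0 < fst s j \<and> fst s j < 1) \<and> (\<forall>k. snd s k \<in> \<Theta>) \<and>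
      (\<forall>k. 0 \<le> w s k) \<and> (\<Sum>k. ennreal (w s k)) = 1)"
    have "AE s in dp_sticks \<alpha> P0. G s"
      using AE_sticks_dp AE_atoms w_nonneg w_sum unfolding G_def by eventually_elim blast
    then obtain N where N: "{s \<in> space (dp_sticks \<alpha> P0). \<not> G s} \<subseteq> N"
      "N \<in> null_sets (dp_sticks \<alpha> P0)"
      by (auto elim!: AE_E intro!: null_setsI)
    define B where "B = near \<delta> - N"
    have Bs: "B \<in> sets (dp_sticks \<alpha> P0)" unfolding B_def using near_sets N(2) by auto
    have Bm: "emeasure (dp_sticks \<alpha> P0) B = emeasure (dp_sticks \<alpha> P0) (near \<delta>)"
      unfolding B_def by (rule emeasure_Diff_null_set[OF N(2) near_sets])
    have low: "ennreal (c * \<delta> powr mass_exponent) \<le> emeasure (dp_sticks \<alpha> P0) B"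
      unfolding Bm using \<delta> \<delta>1(2) by (intro c(3)) auto
    have cpos: "0 < c * \<delta> powr mass_exponent" using c(1) \<delta>(1) by simp
    have Bpos: "0 < emeasure (dp_sticks \<alpha> P0) B"
      using low cpos by (metis ennreal_less_zero_iff less_le_trans)
    have chi: "(\<integral>\<^sup>+y. ennreal (q y) / label_lik UNIV s y * ennreal (q y) \<partial>lborel) \<le> ennreal (1 + c' / real n)"
      if s: "s \<in> B" for s
    proof -
      have sp: "s \<in> space (dp_sticks \<alpha> P0)" using s Bs sets.sets_into_space by blast
      then have Gs: "G s" using s N(1) unfolding B_def by blast
      obtain v t where vt: "s = (v, t)" by (cases s)
      have near: "\<And>k. k < K \<Longrightarrow> vs k - \<delta> \<le> v k \<and> v k \<le> vs k" "\<And>k. k < K \<Longrightarrow> dist (ts k) (t k) \<le> \<delta>"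
        using s unfolding B_def near_def vt by auto
      have v01: "\<And>j. 0 < v j \<and> v j < 1" and tT: "\<And>k. t k \<in> \<Theta>" and wn: "\<And>k. 0 \<le> w s k"
        and wsum: "(\<Sum>k. ennreal (w s k)) = 1"
        using Gs unfolding G_def vt by auto
      have vs01: "0 \<le> vs j \<and> vs j \<le> 1" if "j < K" for j
        using vs_weight(2)[OF that] vs_weight(3,4)[OF that] that by (cases "Suc j = K") auto
      have K\<delta>: "\<delta> \<le> real K * \<delta>" using K_pos \<delta>(1) by simp
      have close: "\<bar>w s k - ws k\<bar> \<le> real K * \<delta>" if k: "k < K" for k
      proof -
        have "\<bar>stick_weight v k - stick_weight vs k\<bar> \<le> real (Suc k) * \<delta>"
        proof (rule stick_weight_close)
          fix j assume "j \<le> k"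
          then have j: "j < K" using k by simp
          show "0 \<le> v j \<and> v j \<le> 1" using v01[of j] by simp
          show "0 \<le> vs j \<and> vs j \<le> 1" by (rule vs01[OF j])
          show "\<bar>v j - vs j\<bar> \<le> \<delta>" using near(1)[OF j] by (simp add: abs_le_iff)
        qed
        also have "\<dots> \<le> real K * \<delta>" using k \<delta>(1) by (intro mult_right_mono) auto
        finally show ?thesis using w[OF k, of s] vs_weight(1)[OF k] by (simp add: vt)
      qed
      have tclose: "norm (t k - ts k) \<le> real K * \<delta>" if "k < K" for k
        using near(2)[OF that] K\<delta> by (simp add: dist_norm norm_minus_commute)
      have lab: "label_lik UNIV s = (\<lambda>y. \<Sum>k. ennreal (w s k) * ennreal (f (y - t k)))"
        by (simp add: label_lik_def vt fun_eq_iff)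
      have s_int: "(\<integral>\<^sup>+y. (\<Sum>k. ennreal (w s k) * ennreal (f (y - t k))) \<partial>lborel) = 1"
        using nn_integral_label_lik[of UNIV s] wsum unfolding lab by simp
      have qi: "(\<integral>\<^sup>+y. ennreal (\<Sum>k<K. ws k * f (y - ts k)) \<partial>lborel) = 1"
        using q_integral unfolding q_def .
      have \<eta>0: "0 \<le> real K * \<delta>" using \<delta>(1) by simp
      have "(\<integral>\<^sup>+y. ennreal (q y) / label_lik UNIV s y * ennreal (q y) \<partial>lborel) \<le>
          1 + ennreal (2 * (2 * real K + 1)\<^sup>2 * (real K * \<delta>)\<^sup>2) *
            (\<integral>\<^sup>+y. ennreal (exp ((5 * \<rho> + 5) * g y) * f y) \<partial>lborel)"
        unfolding lab q_def
        by (rule chi_square_bound[OF f_borel g(1) f_bounds(1) g(2) \<rho>(1) g(3) ws(1) ws(2) \<rho>(2)[OF ts]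
            wn wsum \<rho>(2)[OF tT] \<eta>0 order_trans[OF \<eta> w0(2)] order_trans[OF \<eta> w0(3)] close tclose s_int qi])
      also have "\<dots> = ennreal (1 + c' / real n)"
        unfolding I(1) using I(2) \<delta>2 c'0
        by (subst ennreal_mult[symmetric]) (auto simp: c'_def power_mult_distrib simp flip: ennreal_1 ennreal_plus)
      finally show ?thesis .
    qed
    have "(\<integral>\<^sup>+x. (\<Prod>i<n. ennreal (q (x i))) / evidence n x \<partial>Xlaw) \<le>
        ennreal (1 + c' / real n) ^ n / emeasure (dp_sticks \<alpha> P0) B"
      unfolding data_law_eq by (rule expectation_inverse_evidence[OF Bs Bpos chi])
    also have "\<dots> \<le> ennreal (exp c') / ennreal (c * \<delta> powr mass_exponent)"
    proof (rule order_trans)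
      have "ennreal (1 + c' / real n) ^ n = ennreal ((1 + c' / real n) ^ n)"
        by (rule ennreal_power) (use c'0 in simp)
      also have "\<dots> \<le> ennreal (exp c')"
        using exp_ge_one_plus_x_over_n_power_n[of n c'] c'0 n1 by (intro ennreal_leI) auto
      finally show "ennreal (1 + c' / real n) ^ n / emeasure (dp_sticks \<alpha> P0) B \<le>
          ennreal (exp c') / emeasure (dp_sticks \<alpha> P0) B" by (rule divide_right_mono_ennreal)
      show "ennreal (exp c') / emeasure (dp_sticks \<alpha> P0) B \<le> ennreal (exp c') / ennreal (c * \<delta> powr mass_exponent)"
        using low by (rule ennreal_divide_left_mono)
    qed
    also have "\<dots> = ennreal (exp c' / (c * \<delta> powr mass_exponent))"
      using cpos by (simp add: divide_ennreal)
    also have "exp c' / (c * \<delta> powr mass_exponent) = exp c' / c * real n powr (mass_exponent / 2)"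
    proof -
      have "\<delta> = real n powr (- (1 / 2))" 
        unfolding \<delta>_def powr_minus powr_half_sqrt[OF of_nat_0_le_iff] by (simp only: inverse_eq_divide)
      then have "\<delta> powr mass_exponent = real n powr (- (1 / 2) * mass_exponent)" by (simp only: powr_powr)
      then have "\<delta> powr mass_exponent = real n powr (- (mass_exponent / 2))" by (simp only: mult_minus_left times_divide_eq_left mult_1_left)
      then have "\<delta> powr mass_exponent = inverse (real n powr (mass_exponent / 2))" by (simp only: powr_minus)
      then show ?thesis by (simp only: inverse_eq_divide times_divide_eq_right mult_1_right divide_divide_eq_right
            times_divide_eq_left)
    qed
    finally show "(\<integral>\<^sup>+x. (\<Prod>i<n. ennreal (q (x i))) / evidence n x \<partial>Xlaw) \<le>
      ennreal (exp c' / c * real n powr (mass_exponent / 2))" .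
  qed
qed

end

text \<open>If the product exceeds \<open>\<epsilon>\<close>, then \<open>U \<ge> \<epsilon> / \<tau>\<close> or \<open>V \<ge> \<tau>\<close>, and Markov's inequality
applies to both; \<open>\<tau> = sqrt (e / u)\<close> makes the two bounds of the same order.\<close>

lemma (in prob_space) prob_product_small:
  fixes U V :: "'a \<Rightarrow> ennreal" and Y :: "'a \<Rightarrow> real"
  assumes [measurable]: "U \<in> borel_measurable M" "V \<in> borel_measurable M"
    and U: "(\<integral>\<^sup>+x. U x \<partial>M) \<le> ennreal u" and V: "(\<integral>\<^sup>+x. V x \<partial>M) \<le> ennreal e"
    and pos: "0 < u" "0 < e" "0 < \<epsilon>"
    and Y: "\<And>x. x \<in> space M \<Longrightarrow> ennreal (Y x) \<le> U x * V x"
  shows "prob {x \<in> space M. \<epsilon> < Y x} \<le> sqrt (u * e) * (1 / \<epsilon> + 1)"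
proof -
  define \<tau> where "\<tau> = sqrt (e / u)"
  have \<tau>: "0 < \<tau>" using pos by (simp add: \<tau>_def)
  have markov: "emeasure M {x \<in> space M. 1 \<le> ennreal (1 / a) * h x} \<le> ennreal (m / a)"
    if [measurable]: "h \<in> borel_measurable M" and h: "(\<integral>\<^sup>+x. h x \<partial>M) \<le> ennreal m" and "0 < a" "0 < m" for h a m
  proof -
    have "emeasure M {x \<in> space M. 1 \<le> ennreal (1 / a) * h x} \<le> ennreal (1 / a) * (\<integral>\<^sup>+x. h x * indicator (space M) x \<partial>M)"
      by (rule nn_integral_Markov_inequality) measurable
    also have "\<dots> \<le> ennreal (1 / a) * ennreal m"
      using h by (intro mult_left_mono) (auto cong: nn_integral_cong)
    also have "\<dots> = ennreal (m / a)" using that by (subst ennreal_mult[symmetric]) auto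
    finally show ?thesis .
  qed
  let ?A = "{x \<in> space M. 1 \<le> ennreal (1 / (\<epsilon> / \<tau>)) * U x}" and ?B = "{x \<in> space M. 1 \<le> ennreal (1 / \<tau>) * V x}"
  have sub: "{x \<in> space M. \<epsilon> < Y x} \<subseteq> ?A \<union> ?B"
  proof
    fix x assume "x \<in> {x \<in> space M. \<epsilon> < Y x}"
    then have x: "x \<in> space M" "\<epsilon> < Y x" by auto
    show "x \<in> ?A \<union> ?B"
    proof (rule ccontr)
      assume "x \<notin> ?A \<union> ?B"
      then have "ennreal (1 / (\<epsilon> / \<tau>)) * U x \<le> 1" "ennreal (1 / \<tau>) * V x \<le> 1" using x by auto
      then have "(ennreal (1 / (\<epsilon> / \<tau>)) * U x) * (ennreal (1 / \<tau>) * V x) \<le> 1 * 1" by (intro mult_mono) auto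
      also have "(ennreal (1 / (\<epsilon> / \<tau>)) * U x) * (ennreal (1 / \<tau>) * V x) =
          (ennreal (1 / (\<epsilon> / \<tau>)) * ennreal (1 / \<tau>)) * (U x * V x)" by (simp add: mult_ac)
      also have "ennreal (1 / (\<epsilon> / \<tau>)) * ennreal (1 / \<tau>) = ennreal (1 / \<epsilon>)"
        using \<tau> pos by (subst ennreal_mult[symmetric]) auto
      finally have "ennreal (1 / \<epsilon>) * (U x * V x) \<le> 1" by simp
      then have "ennreal (1 / \<epsilon>) * ennreal (Y x) \<le> 1"
        using Y[OF x(1)] by (meson mult_left_mono order_trans zero_le)
      then have "ennreal (Y x / \<epsilon>) \<le> ennreal 1"
        using x pos by (subst (asm) ennreal_mult[symmetric]) auto
      then have "Y x / \<epsilon> \<le> 1" by (subst (asm) ennreal_le_iff) auto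
      then show False using x pos by (simp add: field_simps)
    qed
  qed
  have [measurable]: "?A \<in> sets M" "?B \<in> sets M" by measurable
  have "emeasure M {x \<in> space M. \<epsilon> < Y x} \<le> emeasure M (?A \<union> ?B)"
    using sub by (intro emeasure_mono) auto
  also have "\<dots> \<le> emeasure M ?A + emeasure M ?B" by (intro emeasure_subadditive) auto
  also have "\<dots> \<le> ennreal (u / (\<epsilon> / \<tau>)) + ennreal (e / \<tau>)"
    using \<tau> pos by (intro add_mono markov U V) auto
  also have "\<dots> = ennreal (u / (\<epsilon> / \<tau>) + e / \<tau>)" using \<tau> pos by (subst ennreal_plus) auto
  also have "u / (\<epsilon> / \<tau>) + e / \<tau> = sqrt (u * e) * (1 / \<epsilon> + 1)"
  proof -
    have "u * \<tau> = sqrt (u * e)"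
    proof -
      have "u * \<tau> = sqrt (u\<^sup>2) * sqrt (e / u)" using pos by (simp add: \<tau>_def)
      also have "\<dots> = sqrt (u\<^sup>2 * (e / u))" by (rule real_sqrt_mult[symmetric])
      also have "u\<^sup>2 * (e / u) = u * e" using pos by (simp add: power2_eq_square)
      finally show ?thesis .
    qed
    moreover have "e / \<tau> = sqrt (u * e)"
    proof -
      have "(u * \<tau>) * \<tau> = e" using pos by (simp add: \<tau>_def mult.assoc flip: real_sqrt_mult)
      then have "e / \<tau> = u * \<tau>" using \<tau> by (simp add: divide_eq_eq)
      then show ?thesis using calculation by simp
    qed
    ultimately show ?thesis by (simp add: algebra_simps)
  qed
  finally have "ennreal (prob {x \<in> space M. \<epsilon> < Y x}) \<le> ennreal (sqrt (u * e) * (1 / \<epsilon> + 1))"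
    by (simp add: emeasure_eq_measure)
  then show ?thesis using pos by (subst (asm) ennreal_le_iff) auto
qed

section \<open>Posterior mass of rare allocations\<close>

text \<open>The posterior probability is the product of \<open>b x / (\<Prod>i<n. q (x i))\<close> and
\<open>(\<Prod>i<n. q (x i)) / evidence n x\<close>.\<close>

lemma (in mixture_data) prob_posterior_small:
  assumes [measurable]: "b \<in> borel_measurable (PiM UNIV (\<lambda>_. borel))"
    and A: "\<And>x. emeasure (posterior n x) (A x) \<le> b x / evidence n x"
    and u: "(\<integral>\<^sup>+x. b x / (\<Prod>i<n. ennreal (q (x i))) \<partial>Q) \<le> ennreal u"
    and e: "(\<integral>\<^sup>+x. (\<Prod>i<n. ennreal (q (x i))) / evidence n x \<partial>Q) \<le> ennreal e"
    and pos: "0 < u" "0 < e" "0 < \<epsilon>"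
  shows "measure Q {x \<in> space Q. \<epsilon> < measure (posterior n x) (A x)} \<le> sqrt (u * e) * (1 / \<epsilon> + 1)"
proof (rule Q.prob_product_small[OF _ _ u e pos])
  fix x
  interpret P: prob_space "posterior n x" by (rule prob_space_posterior)
  let ?q = "\<Prod>i<n. ennreal (q (x i))"
  have "?q = ennreal (\<Prod>i<n. q (x i))" using q_pos by (intro prod_ennreal) (auto intro: less_imp_le)
  moreover have "0 < (\<Prod>i<n. q (x i))" using q_pos by (intro prod_pos) auto
  ultimately obtain r where r: "?q = ennreal r" "0 < r" by blast
  have q: "?q \<noteq> 0" "?q \<noteq> top" unfolding r(1) using r(2) by simp_all
  have "ennreal (measure (posterior n x) (A x)) \<le> b x / evidence n x"
    using A[of x] by (simp add: P.emeasure_eq_measure)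
  also have "b x / evidence n x = b x / ?q * (?q / evidence n x)"
    using q by (simp add: ennreal_times_divide ennreal_divide_times mult_divide_eq_ennreal)
  finally show "ennreal (measure (posterior n x) (A x)) \<le> b x / ?q * (?q / evidence n x)" .
qed measurable

context dp_setting
begin

lemma head_and_tail_weight:
  assumes rm: "random_mixture (dp_sticks \<alpha> P0) w snd f Fb"
    and w: "\<forall>s. \<forall>k<N. w s k = stick_weight (fst s) k"
  shows "AE s in dp_sticks \<alpha> P0. (\<Sum>k. indicator {N..} k * ennreal (w s k)) = ennreal (stick_rest N (fst s)) \<and>
    (\<Sum>k. indicator {..<N} k * ennreal (w s k)) = ennreal (1 - stick_rest N (fst s)) \<and>
    (\<Sum>k. indicator UNIV k * ennreal (w s k)) = 1"
proof -
  interpret random_mixture "dp_sticks \<alpha> P0" w snd f Fb by (rule rm)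
  show ?thesis
    using AE_sticks_dp w_sum
  proof eventually_elim
    case (elim s)
    note r = stick_rest_bounds[OF elim(1)]
    have h: "(\<Sum>k<N. ennreal (w s k)) = ennreal (1 - stick_rest N (fst s))"
      unfolding sum_ennreal_stick_weight[OF elim(1), symmetric]
      by (intro sum.cong refl) (metis w lessThan_iff)
    have "(\<Sum>k. indicator {..<N} k * ennreal (w s k)) = (\<Sum>k\<in>{..<N}. indicator {..<N} k * ennreal (w s k))"
      by (rule suminf_finite) auto
    then have 2: "(\<Sum>k. indicator {..<N} k * ennreal (w s k)) = ennreal (1 - stick_rest N (fst s))"
      using h by simp
    have "(\<Sum>k. indicator {N..} k * ennreal (w s k)) =
        (\<Sum>k. indicator {N..} (k + N) * ennreal (w s (k + N))) + (\<Sum>k<N. indicator {N..} k * ennreal (w s k))"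
      by (rule suminf_offset) auto
    then have 1: "(\<Sum>k. indicator {N..} k * ennreal (w s k)) = (\<Sum>k. ennreal (w s (k + N)))" by simp
    have "(\<Sum>k. ennreal (w s k)) = (\<Sum>k. ennreal (w s (k + N))) + (\<Sum>k<N. ennreal (w s k))"
      by (rule suminf_offset) auto
    then have "(\<Sum>k. ennreal (w s (k + N))) + ennreal (1 - stick_rest N (fst s)) = 1"
      using elim(2) h by simp
    then have "(\<Sum>k. ennreal (w s (k + N))) = 1 - ennreal (1 - stick_rest N (fst s))"
      by (metis ennreal_add_diff_cancel_right ennreal_neq_top)
    also have "\<dots> = ennreal (1 - (1 - stick_rest N (fst s)))"
      using r(1,2)[of N] by (subst ennreal_1[symmetric], subst ennreal_minus) auto
    finally show ?case using 1 2 elim(2) by simp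
  qed
qed

lemma overflow_expectation:
  assumes rm: "random_mixture (dp_sticks \<alpha> P0) w snd f Fb"
    and w: "\<forall>s. \<forall>k<N. w s k = stick_weight (fst s) k" and i: "i < (n :: nat)"
  shows "(\<integral>\<^sup>+s. (\<Prod>j<n. \<Sum>k. indicator (if j = i then {N..} else UNIV) k * ennreal (w s k)) \<partial>dp_sticks \<alpha> P0)
    = ennreal ((\<alpha> / (\<alpha> + 1)) ^ N)"
proof -
  have "(\<integral>\<^sup>+s. (\<Prod>j<n. \<Sum>k. indicator (if j = i then {N..} else UNIV) k * ennreal (w s k)) \<partial>dp_sticks \<alpha> P0) =
    (\<integral>\<^sup>+s. ennreal (stick_rest N (fst s) powr 1) \<partial>dp_sticks \<alpha> P0)"
  proof (intro nn_integral_cong_AE)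
    show "AE s in dp_sticks \<alpha> P0.
        (\<Prod>j<n. \<Sum>k. indicator (if j = i then {N..} else UNIV) k * ennreal (w s k)) =
        ennreal (stick_rest N (fst s) powr 1)"
      using head_and_tail_weight[OF rm w] AE_sticks_dp
    proof eventually_elim
      case (elim s)
      have "(\<Prod>j<n. \<Sum>k. indicator (if j = i then {N..} else UNIV) k * ennreal (w s k)) =
        (\<Prod>j<n. if j = i then ennreal (stick_rest N (fst s)) else 1)"
        using elim(1) by (intro prod.cong) auto
      also have "\<dots> = ennreal (stick_rest N (fst s))" 
        using i by (subst prod.remove[of _ i]) (auto intro!: prod.neutral)
      also have "\<dots> = ennreal (stick_rest N (fst s) powr 1)"
        using stick_rest_bounds(1)[OF elim(2), of N] by simp
      finally show ?case .
    qed
  qed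
  also have "\<dots> = (\<integral>\<^sup>+v. ennreal (stick_rest N v powr 1) \<partial>V)"
    by (rule nn_integral_dp) measurable
  also have "\<dots> = ennreal ((\<alpha> / (\<alpha> + 1)) ^ N)"
    using \<alpha>0 by (intro nn_integral_stick_rest_powr) auto
  finally show ?thesis .
qed

text \<open>Given the sticks, all labels are below \<open>N\<close> with probability \<open>(1 - r) ^ n \<le> exp (- n * r)\<close>, where
\<open>r\<close> is the rest of the stick. The exponential is at most \<open>(s / (n * r)) powr s\<close>, and the moment of \<open>r\<close> of
order \<open>- s\<close> is finite as long as \<open>s < \<alpha>\<close>.\<close>

lemma underflow_expectation:
  assumes rm: "random_mixture (dp_sticks \<alpha> P0) w snd f Fb"
    and w: "\<forall>s. \<forall>k<N. w s k = stick_weight (fst s) k" and s: "0 < s" "s < \<alpha>" and n: "0 < n"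
  shows "(\<integral>\<^sup>+\<omega>. (\<Prod>j<n. \<Sum>k. indicator {..<N} k * ennreal (w \<omega> k)) \<partial>dp_sticks \<alpha> P0)
    \<le> ennreal (s powr s * real n powr (- s) * (\<alpha> / (\<alpha> - s)) ^ N)"
proof -
  have key: "(1 - r) ^ n \<le> s powr s * real n powr (- s) * r powr (- s)" if r: "0 < r" "r \<le> 1" for r
  proof -
    let ?y = "real n * r"
    have y: "0 < ?y" using n r by simp
    have "(1 - r) ^ n \<le> exp (- r) ^ n"
      using r exp_ge_add_one_self[of "- r"] by (intro power_mono) auto
    also have "\<dots> = exp (- ?y)" by (simp flip: exp_of_nat_mult)
    also have "\<dots> \<le> exp (s * ln s - s * ln ?y)"
    proof -
      have "ln (?y / s) \<le> ?y / s - 1" using y s by (intro ln_le_minus_one divide_pos_pos) auto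
      then have "s * (ln ?y - ln s) \<le> s * (?y / s - 1)"
        unfolding ln_divide_pos[OF y s(1)] using s by (intro mult_left_mono) simp_all
      also have "s * (?y / s - 1) = ?y - s" using s by (simp add: right_diff_distrib)
      finally have "- ?y \<le> s * ln s - s * ln ?y" using s(1) unfolding right_diff_distrib by linarith
      then show ?thesis by (simp only: exp_le_cancel_iff)
    qed
    also have "\<dots> = s powr s * ?y powr (- s)"
      unfolding powr_def using y s
      by (simp only: exp_diff exp_minus divide_inverse mult_minus_left if_False less_imp_neq[THEN not_sym])
    also have "\<dots> = s powr s * real n powr (- s) * r powr (- s)"
      using r by (simp add: powr_mult)
    finally show ?thesis .
  qed
  have "(\<integral>\<^sup>+\<omega>. (\<Prod>j<n. \<Sum>k. indicator {..<N} k * ennreal (w \<omega> k)) \<partial>dp_sticks \<alpha> P0) \<le>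
    (\<integral>\<^sup>+\<omega>. ennreal (s powr s * real n powr (- s)) * ennreal (stick_rest N (fst \<omega>) powr (- s)) \<partial>dp_sticks \<alpha> P0)"
  proof (intro nn_integral_mono_AE)
    show "AE \<omega> in dp_sticks \<alpha> P0. (\<Prod>j<n. \<Sum>k. indicator {..<N} k * ennreal (w \<omega> k)) \<le>
        ennreal (s powr s * real n powr (- s)) * ennreal (stick_rest N (fst \<omega>) powr (- s))"
      using head_and_tail_weight[OF rm w] AE_sticks_dp
    proof eventually_elim
      case (elim \<omega>)
      note r = stick_rest_bounds[OF elim(2)]
      have "(\<Prod>j<n. \<Sum>k. indicator {..<N} k * ennreal (w \<omega> k)) = ennreal (1 - stick_rest N (fst \<omega>)) ^ n"
        using elim(1) by simp
      also have "\<dots> = ennreal ((1 - stick_rest N (fst \<omega>)) ^ n)"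
        using r(2) by (intro ennreal_power) simp
      also have "\<dots> \<le> ennreal (s powr s * real n powr (- s) * stick_rest N (fst \<omega>) powr (- s))"
        using r by (intro ennreal_leI key) auto
      also have "\<dots> = ennreal (s powr s * real n powr (- s)) * ennreal (stick_rest N (fst \<omega>) powr (- s))"
        by (rule ennreal_mult) auto
      finally show ?case .
    qed
  qed
  also have "\<dots> = (\<integral>\<^sup>+v. ennreal (s powr s * real n powr (- s)) * ennreal (stick_rest N v powr (- s)) \<partial>V)"
    by (rule nn_integral_dp) measurable
  also have "\<dots> = ennreal (s powr s * real n powr (- s)) * ennreal ((\<alpha> / (\<alpha> + - s)) ^ N)"
    using s \<alpha>0 nn_integral_stick_rest_powr[of \<alpha> "- s" N] by (subst nn_integral_cmult) auto
  also have "\<dots> = ennreal (s powr s * real n powr (- s) * (\<alpha> / (\<alpha> - s)) ^ N)"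
    using s by (subst ennreal_mult[symmetric]) auto
  finally show ?thesis .
qed

lemma overflow_prob:
  assumes rm: "random_mixture (dp_sticks \<alpha> P0) w snd f Fb"
    and w: "\<forall>s. \<forall>k<N. w s k = stick_weight (fst s) k"
    and e: "(\<integral>\<^sup>+x. (\<Prod>i<n. ennreal (q (x i))) / random_mixture.evidence (dp_sticks \<alpha> P0) w snd f n x \<partial>Xlaw) \<le> ennreal e"
    and pos: "0 < n" "0 < e" "0 < \<epsilon>"
  shows "measure Xlaw {x \<in> space Xlaw.
      \<epsilon> < measure (random_mixture.posterior (dp_sticks \<alpha> P0) w snd f n x)
        (({..<n} \<rightarrow>\<^sub>E UNIV) - ({..<n} \<rightarrow>\<^sub>E {..<N}))}
    \<le> sqrt (real n * (\<alpha> / (\<alpha> + 1)) ^ N * e) * (1 / \<epsilon> + 1)"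
proof -
  interpret mixture_data "dp_sticks \<alpha> P0" w snd f Fb q by (rule mixture_dataI[OF rm])
  let ?L = "\<lambda>i j. if j = i then {N..} else UNIV" and ?A = "({..<n} \<rightarrow>\<^sub>E UNIV) - ({..<n} \<rightarrow>\<^sub>E {..<N})"
  define b where "b = (\<lambda>x. \<Sum>i<n. box n (?L i) x)"
  have [measurable]: "b \<in> borel_measurable (PiM UNIV (\<lambda>_. borel))" unfolding b_def by measurable
  have A: "emeasure (posterior n x) ?A \<le> b x / evidence n x" for x
  proof -
    \<comment> \<open>Union bound over the observation that receives the large label.\<close>
    have "?A \<subseteq> (\<Union>i<n. Pi\<^sub>E {..<n} (?L i))"
      by (auto simp: PiE_iff not_less split: if_splits)
    then have "emeasure (posterior n x) ?A \<le> emeasure (posterior n x) (\<Union>i<n. Pi\<^sub>E {..<n} (?L i))"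
      by (rule emeasure_mono) (auto simp: sets_posterior PiE_iff)
    also have "\<dots> \<le> (\<Sum>i<n. emeasure (posterior n x) (Pi\<^sub>E {..<n} (?L i)))"
      by (rule emeasure_subadditive_finite) (auto simp: sets_posterior PiE_iff)
    also have "\<dots> = (\<Sum>i<n. box n (?L i) x / evidence n x)"
      by (intro sum.cong refl emeasure_posterior)
    also have "\<dots> = b x / evidence n x"
      unfolding b_def divide_ennreal_def by (rule sum_distrib_right[symmetric])
    finally show ?thesis .
  qed
  have "(\<integral>\<^sup>+x. b x / (\<Prod>i<n. ennreal (q (x i))) \<partial>Q) =
    (\<integral>\<^sup>+x. (\<Sum>i<n. box n (?L i) x / (\<Prod>i<n. ennreal (q (x i)))) \<partial>Q)"
    unfolding b_def divide_ennreal_def sum_distrib_right ..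
  also have "\<dots> = (\<Sum>i<n. \<integral>\<^sup>+x. box n (?L i) x / (\<Prod>i<n. ennreal (q (x i))) \<partial>Q)"
    by (rule nn_integral_sum) measurable
  also have "\<dots> = (\<Sum>i<n. ennreal ((\<alpha> / (\<alpha> + 1)) ^ N))"
    unfolding expectation_box using overflow_expectation[OF rm w] by (intro sum.cong) auto
  also have "\<dots> = ennreal (real n * (\<alpha> / (\<alpha> + 1)) ^ N)"
    using \<alpha>0 by (subst sum_ennreal) auto
  finally have u: "(\<integral>\<^sup>+x. b x / (\<Prod>i<n. ennreal (q (x i))) \<partial>Q) \<le> ennreal (real n * (\<alpha> / (\<alpha> + 1)) ^ N)" by simp
  show ?thesis
    unfolding data_law_eq
    by (rule prob_posterior_small[OF _ A u e[unfolded data_law_eq]]) (use pos \<alpha>0 in auto)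
qed

lemma underflow_prob:
  assumes rm: "random_mixture (dp_sticks \<alpha> P0) w snd f Fb"
    and w: "\<forall>s. \<forall>k<N. w s k = stick_weight (fst s) k"
    and e: "(\<integral>\<^sup>+x. (\<Prod>i<n. ennreal (q (x i))) / random_mixture.evidence (dp_sticks \<alpha> P0) w snd f n x \<partial>Xlaw) \<le> ennreal e"
    and pos: "0 < n" "0 < e" "0 < \<epsilon>" and s: "0 < s" "s < \<alpha>"
  shows "measure Xlaw {x \<in> space Xlaw.
      \<epsilon> < measure (random_mixture.posterior (dp_sticks \<alpha> P0) w snd f n x) ({..<n} \<rightarrow>\<^sub>E {..<N})}
    \<le> sqrt (s powr s * real n powr (- s) * (\<alpha> / (\<alpha> - s)) ^ N * e) * (1 / \<epsilon> + 1)"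
proof -
  interpret mixture_data "dp_sticks \<alpha> P0" w snd f Fb q by (rule mixture_dataI[OF rm])
  have A: "emeasure (posterior n x) ({..<n} \<rightarrow>\<^sub>E {..<N}) \<le> box n (\<lambda>_. {..<N}) x / evidence n x" for x
    unfolding emeasure_posterior ..
  have u: "(\<integral>\<^sup>+x. box n (\<lambda>_. {..<N}) x / (\<Prod>i<n. ennreal (q (x i))) \<partial>Q)
      \<le> ennreal (s powr s * real n powr (- s) * (\<alpha> / (\<alpha> - s)) ^ N)"
    unfolding expectation_box by (rule underflow_expectation[OF rm w s pos(1)])
  show ?thesis
    unfolding data_law_eq
    by (rule prob_posterior_small[OF _ A u e[unfolded data_law_eq]]) (use pos s in auto)
qed

abbreviation "\<Phi> \<equiv> random_mixture.posterior (dp_sticks \<alpha> P0) (\<lambda>s. stick_weight (fst s)) snd f"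
abbreviation "\<Phi>t N \<equiv> random_mixture.posterior (dp_sticks \<alpha> P0) (\<lambda>s. trunc_weight N (fst s)) snd f"

lemma dp_allocation_eq: "dp_allocation f \<alpha> P0 n x = \<Phi> n x"
  unfolding dp_allocation_def by (rule allocation_posterior_eq[OF random_mixture_dp])

lemma trunc_allocation_posterior: "trunc_allocation f \<alpha> P0 N n x = \<Phi>t N n x"
  unfolding trunc_allocation_eq by (rule allocation_posterior_eq[OF random_mixture_trunc])

lemma sets_Xlaw: "sets Xlaw = sets (PiM UNIV (\<lambda>_. borel))"
  unfolding data_law_eq by (intro sets_PiM_cong) auto

lemma borel_Xlaw: "borel_measurable Xlaw = borel_measurable (PiM UNIV (\<lambda>_. borel))"
  by (rule measurable_cong_sets[OF sets_Xlaw refl])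

lemma tv_measurable:
  "(\<lambda>x. tv_dist (dp_allocation f \<alpha> P0 n x) (trunc_allocation f \<alpha> P0 N n x)) \<in> borel_measurable Xlaw"
  unfolding dp_allocation_eq trunc_allocation_posterior borel_Xlaw
  by (rule tv_dist_posterior_measurable[OF random_mixture_dp random_mixture_trunc])

text \<open>The weights of the labels below \<open>N\<close> are the same in both models, so on tuples of such labels the
posteriors differ by the evidence only.\<close>

lemma tv_le_overflow:
  defines "R \<equiv> \<lambda>n N. ({..<n} \<rightarrow>\<^sub>E UNIV) - ({..<n} \<rightarrow>\<^sub>E {..<N})"
  shows "tv_dist (\<Phi> n x) (\<Phi>t N n x) \<le> 2 * (measure (\<Phi> n x) (R n N) + measure (\<Phi>t N n x) (R n N))"
proof -
  interpret A: random_mixture "dp_sticks \<alpha> P0" "\<lambda>s. stick_weight (fst s)" snd f Fb by (rule random_mixture_dp)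
  interpret B: random_mixture "dp_sticks \<alpha> P0" "\<lambda>s. trunc_weight N (fst s)" snd f Fb by (rule random_mixture_trunc)
  interpret PA: prob_space "\<Phi> n x" by (rule A.prob_space_posterior)
  interpret PB: prob_space "\<Phi>t N n x" by (rule B.prob_space_posterior)
  let ?L = "{..<n} \<rightarrow>\<^sub>E {..<N}" and ?C = "{..<n} \<rightarrow>\<^sub>E (UNIV :: nat set)"
  define m where "m = (\<lambda>D. \<integral>\<^sup>+c. indicator D c * A.box n (\<lambda>i. {c i}) x \<partial>count_space ?C)"
  have box: "A.box n (\<lambda>i. {c i}) x = B.box n (\<lambda>i. {c i}) x" if "c \<in> ?L" for c
    unfolding A.box_def B.box_def
  proof (intro nn_integral_cong prod.cong refl)
    fix s i assume "i \<in> {..<n}"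
    then have "c i < N" using that by (auto simp: PiE_iff)
    then show "A.label_lik {c i} s (x i) = B.label_lik {c i} s (x i)"
      unfolding A.label_lik_singleton B.label_lik_singleton by (simp add: trunc_weight_eq)
  qed
  have mA: "emeasure (\<Phi> n x) D = m D / A.evidence n x" if "D \<subseteq> ?L" for D
  proof -
    have "D \<subseteq> ?C" using that by (auto simp: PiE_iff)
    then show ?thesis
      unfolding A.posterior_def m_def
      by (subst emeasure_point_measure_nn_integral)
        (auto simp: A.label_post_def ennreal_times_divide nn_integral_divide)
  qed
  have mB: "emeasure (\<Phi>t N n x) D = m D / B.evidence n x" if D: "D \<subseteq> ?L" for D
  proof -
    have "D \<subseteq> ?C" using D by (auto simp: PiE_iff)
    then have "emeasure (\<Phi>t N n x) D =
        (\<integral>\<^sup>+c. indicator D c * B.box n (\<lambda>i. {c i}) x / B.evidence n x \<partial>count_space ?C)"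
      unfolding B.posterior_def
      by (subst emeasure_point_measure_nn_integral) (auto simp: B.label_post_def ennreal_times_divide)
    also have "\<dots> = (\<integral>\<^sup>+c. indicator D c * A.box n (\<lambda>i. {c i}) x / B.evidence n x \<partial>count_space ?C)"
      using D box by (intro nn_integral_cong) (auto simp: indicator_def)
    also have "\<dots> = m D / B.evidence n x" unfolding m_def by (subst nn_integral_divide) auto
    finally show ?thesis .
  qed
  have "measure (\<Phi> n x) D * measure (\<Phi>t N n x) ?L = measure (\<Phi>t N n x) D * measure (\<Phi> n x) ?L"
    if D: "D \<subseteq> ?L" for D
  proof -
    have "emeasure (\<Phi> n x) D * emeasure (\<Phi>t N n x) ?L = emeasure (\<Phi>t N n x) D * emeasure (\<Phi> n x) ?L"
      unfolding mA[OF D] mB[OF D] mA[OF order_refl] mB[OF order_refl] divide_ennreal_def by (simp add: mult_ac)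
    then show ?thesis
      unfolding PA.emeasure_eq_measure PB.emeasure_eq_measure
      by (simp flip: ennreal_mult)
  qed
  then have "tv_dist (\<Phi> n x) (\<Phi>t N n x) \<le>
      2 * (measure (\<Phi> n x) (space (\<Phi> n x) - ?L) + measure (\<Phi>t N n x) (space (\<Phi>t N n x) - ?L))"
    by (intro tv_dist_le_of_agree A.prob_space_posterior B.prob_space_posterior)
      (auto simp: A.sets_posterior B.sets_posterior PiE_iff)
  then show ?thesis unfolding A.space_posterior B.space_posterior R_def .
qed

lemma tv_ge_underflow:
  "\<bar>tv_dist (\<Phi> n x) (\<Phi>t N n x) - 1\<bar> \<le> measure (\<Phi> n x) ({..<n} \<rightarrow>\<^sub>E {..<Suc N})"
proof -
  interpret A: random_mixture "dp_sticks \<alpha> P0" "\<lambda>s. stick_weight (fst s)" snd f Fb by (rule random_mixture_dp)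
  interpret B: random_mixture "dp_sticks \<alpha> P0" "\<lambda>s. trunc_weight N (fst s)" snd f Fb by (rule random_mixture_trunc)
  interpret PB: prob_space "\<Phi>t N n x" by (rule B.prob_space_posterior)
  let ?L = "{..<n} \<rightarrow>\<^sub>E {..<Suc N}"
  have "B.label_lik {..<Suc N} s y = B.label_lik UNIV s y" for s y
    unfolding B.label_lik_def by (intro suminf_cong) (auto simp: trunc_weight_def indicator_def)
  then have "B.box n (\<lambda>_. {..<Suc N}) x = B.evidence n x" by (simp add: B.evidence_def B.box_def)
  then have "emeasure (\<Phi>t N n x) ?L = 1"
    unfolding B.emeasure_posterior using B.evidence_pos[of n x] B.evidence_finite[of n x] by simp
  then have 1: "measure (\<Phi>t N n x) ?L = 1" by (simp add: PB.emeasure_eq_measure)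
  have "\<bar>measure (\<Phi> n x) ?L - measure (\<Phi>t N n x) ?L\<bar> \<le> tv_dist (\<Phi> n x) (\<Phi>t N n x)"
    "tv_dist (\<Phi> n x) (\<Phi>t N n x) \<le> 1"
    by (intro tv_dist_bounds A.prob_space_posterior B.prob_space_posterior,
      auto simp: A.sets_posterior B.sets_posterior PiE_iff)+
  then show ?thesis using 1 by (simp add: abs_le_iff)
qed

end

section \<open>Truncation levels above and below the logarithmic scale\<close>

lemma (in random_mixture) measure_posterior_measurable:
  "(\<lambda>x. measure (posterior n x) (Pi\<^sub>E {..<n} L)) \<in> borel_measurable (PiM UNIV (\<lambda>_. borel))"
  "(\<lambda>x. measure (posterior n x) (({..<n} \<rightarrow>\<^sub>E UNIV) - Pi\<^sub>E {..<n} L)) \<in> borel_measurable (PiM UNIV (\<lambda>_. borel))"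
proof -
  show 1: "(\<lambda>x. measure (posterior n x) (Pi\<^sub>E {..<n} L)) \<in> borel_measurable (PiM UNIV (\<lambda>_. borel))"
    unfolding measure_def emeasure_posterior by measurable
  have "measure (posterior n x) (({..<n} \<rightarrow>\<^sub>E UNIV) - Pi\<^sub>E {..<n} L) = 1 - measure (posterior n x) (Pi\<^sub>E {..<n} L)" for x
  proof -
    interpret P: prob_space "posterior n x" by (rule prob_space_posterior)
    show ?thesis
      using P.prob_compl[of "Pi\<^sub>E {..<n} L"] by (auto simp: sets_posterior space_posterior PiE_iff)
  qed
  then show "(\<lambda>x. measure (posterior n x) (({..<n} \<rightarrow>\<^sub>E UNIV) - Pi\<^sub>E {..<n} L)) \<in> borel_measurable (PiM UNIV (\<lambda>_. borel))"
    using 1 by simp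
qed

context dp_setting
begin

lemma prob_Xlaw: "prob_space Xlaw"
proof -
  interpret mixture_data "dp_sticks \<alpha> P0" "\<lambda>s. stick_weight (fst s)" snd f Fb q
    by (rule mixture_dataI[OF random_mixture_dp])
  show ?thesis unfolding data_law_eq by unfold_locales
qed

text \<open>The constant in front of \<open>ln n\<close> is chosen such that the geometric factor outweighs the union bound and
the evidence, with a factor \<open>1 / n\<close> to spare.\<close>

lemma superlog_truncation_rate:
  assumes "(mass_exponent / 2 + 2) / ln ((\<alpha> + 1) / \<alpha>) * ln (real n) \<le> real N" and n: "0 < n" and C: "0 < C"
  shows "real n * (\<alpha> / (\<alpha> + 1)) ^ N * (C * real n powr (mass_exponent / 2)) \<le> C / real n"
proof -
  define \<kappa> where "\<kappa> = mass_exponent / 2"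
  define l where "l = ln ((\<alpha> + 1) / \<alpha>)"
  have l: "0 < l" unfolding l_def using \<alpha>0 by (intro ln_gt_zero) simp
  have "(\<kappa> + 2) * ln (real n) \<le> real N * l"
    using assms(1) l unfolding \<kappa>_def[symmetric] l_def[symmetric] by (simp add: field_simps)
  moreover have "\<alpha> / (\<alpha> + 1) = exp (- l)"
    unfolding l_def exp_minus using \<alpha>0 by (subst exp_ln) auto
  ultimately have "(\<alpha> / (\<alpha> + 1)) ^ N \<le> exp (- ((\<kappa> + 2) * ln (real n)))"
    by (simp flip: exp_of_nat_mult)
  also have "\<dots> = real n powr (- (\<kappa> + 2))"
    using n by (simp add: powr_def left_diff_distrib distrib_right)
  finally have "real n * (\<alpha> / (\<alpha> + 1)) ^ N * (C * real n powr \<kappa>) \<le>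
      real n * real n powr (- (\<kappa> + 2)) * (C * real n powr \<kappa>)"
    using C by (intro mult_right_mono mult_left_mono) auto
  also have "\<dots> = C * (real n powr 1 * real n powr (- (\<kappa> + 2)) * real n powr \<kappa>)" using n by simp
  also have "real n powr 1 * real n powr (- (\<kappa> + 2)) * real n powr \<kappa> = real n powr (- 1)"
    unfolding powr_add[symmetric] by simp
  also have "C * real n powr (- 1) = C / real n" using n by (simp add: powr_minus divide_inverse)
  finally show ?thesis unfolding \<kappa>_def .
qed

lemma superlog_truncation:
  fixes N :: "nat \<Rightarrow> nat"
  assumes N: "\<forall>\<^sub>F n in sequentially. \<lceil>(mass_exponent / 2 + 2) / ln ((\<alpha> + 1) / \<alpha>) * ln (real n)\<rceil> \<le> int (N n)"
  shows "conv_in_prob Xlaw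
    (\<lambda>n x. tv_dist (dp_allocation f \<alpha> P0 n x) (trunc_allocation f \<alpha> P0 (N n) n x)) 0"
  unfolding conv_in_prob_def
proof (intro conjI allI impI)
  fix n show "(\<lambda>x. tv_dist (dp_allocation f \<alpha> P0 n x) (trunc_allocation f \<alpha> P0 (N n) n x)) \<in> borel_measurable Xlaw"
    by (rule tv_measurable)
next
  fix \<epsilon> :: real assume \<epsilon>: "0 < \<epsilon>"
  interpret X: prob_space Xlaw by (rule prob_Xlaw)
  let ?\<beta> = "(mass_exponent / 2 + 2) / ln ((\<alpha> + 1) / \<alpha>)"
  have me: "0 < mass_exponent" unfolding mass_exponent_def using \<alpha>0 by (intro add_pos_nonneg) auto
  have \<beta>: "0 < ?\<beta>"
    using me \<alpha>0 by (intro divide_pos_pos ln_gt_zero add_pos_pos) auto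
  from evidence_bound obtain C n0 where C: "0 < C" and ev: "\<forall>n\<ge>n0. \<forall>w. random_mixture (dp_sticks \<alpha> P0) w snd f Fb \<and>
      (\<forall>s. \<forall>k<K. w s k = stick_weight (fst s) k) \<longrightarrow>
      (\<integral>\<^sup>+x. (\<Prod>i<n. ennreal (q (x i))) / random_mixture.evidence (dp_sticks \<alpha> P0) w snd f n x \<partial>Xlaw)
        \<le> ennreal (C * real n powr (mass_exponent / 2))" by blast
  let ?TV = "\<lambda>n x. tv_dist (dp_allocation f \<alpha> P0 n x) (trunc_allocation f \<alpha> P0 (N n) n x)"
  let ?bad = "\<lambda>n. {x \<in> space Xlaw. \<epsilon> < \<bar>?TV n x - 0\<bar>}"
  have large: "\<forall>\<^sub>F n in sequentially. real K \<le> ?\<beta> * ln (real n)"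
  proof -
    have "filterlim (\<lambda>n. ?\<beta> * ln (real n)) at_top sequentially"
      by (intro filterlim_tendsto_pos_mult_at_top[OF tendsto_const \<beta>]
          filterlim_compose[OF ln_at_top filterlim_real_sequentially])
    then show ?thesis unfolding filterlim_at_top by blast
  qed
  have bound: "\<forall>\<^sub>F n in sequentially. measure Xlaw (?bad n) \<le> 2 * (sqrt (C / real n) * (4 / \<epsilon> + 1))"
    using N large eventually_ge_at_top[of n0] eventually_gt_at_top[of 0]
  proof eventually_elim
    case (elim n)
    have NR: "?\<beta> * ln (real n) \<le> real (N n)" using elim(1) by linarith
    then have KN: "K \<le> N n" using elim(2) by linarith
    let ?R = "({..<n} \<rightarrow>\<^sub>E UNIV) - ({..<n} \<rightarrow>\<^sub>E {..<N n})"
    have one: "measure Xlaw {x \<in> space Xlaw. \<epsilon> / 4 < measure (random_mixture.posterior (dp_sticks \<alpha> P0) w snd f n x) ?R}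
        \<le> sqrt (C / real n) * (4 / \<epsilon> + 1)"
      if rm: "random_mixture (dp_sticks \<alpha> P0) w snd f Fb"
        and w: "\<forall>s. \<forall>k<N n. w s k = stick_weight (fst s) k" for w
    proof -
      have "\<forall>s. \<forall>k<K. w s k = stick_weight (fst s) k" using w KN by (meson less_le_trans)
      with rm elim(3) ev have e: "(\<integral>\<^sup>+x. (\<Prod>i<n. ennreal (q (x i))) /
          random_mixture.evidence (dp_sticks \<alpha> P0) w snd f n x \<partial>Xlaw)
        \<le> ennreal (C * real n powr (mass_exponent / 2))" by blast
      have "measure Xlaw {x \<in> space Xlaw. \<epsilon> / 4 < measure (random_mixture.posterior (dp_sticks \<alpha> P0) w snd f n x) ?R}
        \<le> sqrt (real n * (\<alpha> / (\<alpha> + 1)) ^ N n * (C * real n powr (mass_exponent / 2))) * (1 / (\<epsilon> / 4) + 1)"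
        by (rule overflow_prob[OF rm w e elim(4)]) (use C \<epsilon> elim(4) in auto)
      also have "\<dots> \<le> sqrt (C / real n) * (1 / (\<epsilon> / 4) + 1)"
        using \<epsilon> superlog_truncation_rate[OF NR elim(4) C] by (intro mult_right_mono) auto
      finally show ?thesis by simp
    qed
    let ?A = "{x \<in> space Xlaw. \<epsilon> / 4 < measure (\<Phi> n x) ?R}"
    let ?B = "{x \<in> space Xlaw. \<epsilon> / 4 < measure (\<Phi>t (N n) n x) ?R}"
    have mA: "?A \<in> sets Xlaw" and mB: "?B \<in> sets Xlaw"
      using random_mixture.measure_posterior_measurable(2)[OF random_mixture_dp, of n "\<lambda>_. {..<N n}"]
        random_mixture.measure_posterior_measurable(2)[OF random_mixture_trunc, of "N n" n "\<lambda>_. {..<N n}"]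
      unfolding borel_Xlaw[symmetric] by (auto intro: borel_measurable_less)
    have "?bad n \<subseteq> ?A \<union> ?B"
    proof
      fix x assume x: "x \<in> ?bad n"
      have "0 \<le> ?TV n x"
        unfolding dp_allocation_eq trunc_allocation_posterior
        by (rule order_trans[OF abs_ge_zero tv_dist_bounds(1)[where L="{}"]])
          (auto simp: random_mixture.prob_space_posterior[OF random_mixture_dp]
            random_mixture.prob_space_posterior[OF random_mixture_trunc]
            random_mixture.sets_posterior[OF random_mixture_dp]
            random_mixture.sets_posterior[OF random_mixture_trunc])
      then have "\<epsilon> < 2 * (measure (\<Phi> n x) ?R + measure (\<Phi>t (N n) n x) ?R)"
        using x tv_le_overflow[of n x "N n"] unfolding dp_allocation_eq trunc_allocation_posterior by simp
      then show "x \<in> ?A \<union> ?B" using x by auto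
    qed
    then have "measure Xlaw (?bad n) \<le> measure Xlaw (?A \<union> ?B)"
      using mA mB by (intro X.finite_measure_mono) auto
    also have "\<dots> \<le> measure Xlaw ?A + measure Xlaw ?B"
      using mA mB by (rule measure_Un_le)
    also have "\<dots> \<le> 2 * (sqrt (C / real n) * (4 / \<epsilon> + 1))"
      using one[OF random_mixture_dp] one[OF random_mixture_trunc[of "N n"]] by (simp add: trunc_weight_eq)
    finally show ?case .
  qed
  have "(\<lambda>n. 2 * (sqrt (C / real n) * (4 / \<epsilon> + 1))) \<longlonglongrightarrow> 2 * (sqrt 0 * (4 / \<epsilon> + 1))"
    by (intro tendsto_intros lim_const_over_n)
  then have lim: "(\<lambda>n. 2 * (sqrt (C / real n) * (4 / \<epsilon> + 1))) \<longlonglongrightarrow> 0" by simp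
  show "(\<lambda>n. measure Xlaw (?bad n)) \<longlonglongrightarrow> 0"
    by (rule tendsto_sandwich[OF _ bound tendsto_const lim]) simp
qed

text \<open>With \<open>s = 7 * \<alpha> / 8\<close> the ratio \<open>\<alpha> / (\<alpha> - s)\<close> is \<open>8\<close>, and \<open>8 ^ N \<le> n powr 3\<close> for \<open>N \<le> ln n\<close>.
Together with the evidence the total exponent is \<open>3 - 7 * \<alpha> / 8 + mass_exponent / 2\<close>, in which \<open>\<alpha>\<close> has the
coefficient \<open>- 3 / 8\<close>; the lower bound on \<open>\<alpha>\<close> makes it negative.\<close>

lemma sublog_truncation:
  fixes N :: "nat \<Rightarrow> nat"
  assumes \<alpha>: "8 + 2 * real K * (1 + real CARD('d)) < \<alpha>"
    and N: "\<forall>\<^sub>F n in sequentially. int (N n) < \<lceil>ln (real n)\<rceil>"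
  shows "conv_in_prob Xlaw
    (\<lambda>n x. tv_dist (dp_allocation f \<alpha> P0 n x) (trunc_allocation f \<alpha> P0 (N n) n x)) 1"
  unfolding conv_in_prob_def
proof (intro conjI allI impI)
  fix n show "(\<lambda>x. tv_dist (dp_allocation f \<alpha> P0 n x) (trunc_allocation f \<alpha> P0 (N n) n x)) \<in> borel_measurable Xlaw"
    by (rule tv_measurable)
next
  fix \<epsilon> :: real assume \<epsilon>: "0 < \<epsilon>"
  interpret X: prob_space Xlaw by (rule prob_Xlaw)
  define s where "s = 7 * \<alpha> / 8"
  have s: "0 < s" "s < \<alpha>" "\<alpha> / (\<alpha> - s) = 8" using \<alpha>0 by (simp_all add: s_def field_simps)
  define \<gamma> where "\<gamma> = 3 - s + mass_exponent / 2"
  have "real (K - 1) \<le> real K" by simp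
  then have "mass_exponent \<le> \<alpha> + real K * (1 + real CARD('d))"
    unfolding mass_exponent_def by (simp add: algebra_simps)
  moreover have "0 \<le> real K * (1 + real CARD('d))" by simp
  ultimately have \<gamma>: "\<gamma> < 0"
    using \<alpha> unfolding \<gamma>_def s_def by linarith
  from evidence_bound obtain C n0 where C: "0 < C" and ev: "\<forall>n\<ge>n0. \<forall>w. random_mixture (dp_sticks \<alpha> P0) w snd f Fb \<and>
      (\<forall>s. \<forall>k<K. w s k = stick_weight (fst s) k) \<longrightarrow>
      (\<integral>\<^sup>+x. (\<Prod>i<n. ennreal (q (x i))) / random_mixture.evidence (dp_sticks \<alpha> P0) w snd f n x \<partial>Xlaw)
        \<le> ennreal (C * real n powr (mass_exponent / 2))" by blast
  define c where "c = 8 * s powr s * C"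
  let ?TV = "\<lambda>n x. tv_dist (dp_allocation f \<alpha> P0 n x) (trunc_allocation f \<alpha> P0 (N n) n x)"
  let ?bad = "\<lambda>n. {x \<in> space Xlaw. \<epsilon> < \<bar>?TV n x - 1\<bar>}"
  have bound: "\<forall>\<^sub>F n in sequentially. measure Xlaw (?bad n) \<le> sqrt (c * real n powr \<gamma>) * (1 / \<epsilon> + 1)"
    using N eventually_ge_at_top[of n0] eventually_gt_at_top[of 0]
  proof eventually_elim
    case (elim n)
    have NR: "real (N n) \<le> ln (real n)" using elim(1) by (simp add: less_ceiling_iff)
    let ?L = "{..<n} \<rightarrow>\<^sub>E {..<Suc (N n)}"
    have "(8 :: real) \<le> exp 3"
    proof -
      have "(2 :: real) \<le> exp 1" using exp_ge_add_one_self[of "1::real"] by simp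
      then have "(2 :: real) ^ 3 \<le> exp 1 ^ 3" by (intro power_mono) auto
      then show ?thesis by (simp flip: exp_of_nat_mult)
    qed
    then have "(8 :: real) ^ N n \<le> exp 3 ^ N n" by (intro power_mono) auto
    also have "\<dots> = exp (3 * real (N n))" by (simp flip: exp_of_nat_mult add: mult.commute)
    also have "\<dots> \<le> exp (3 * ln (real n))" using NR by simp
    also have "\<dots> = real n powr 3" using elim(3) by (simp add: powr_def)
    finally have 8: "(8 :: real) ^ Suc (N n) \<le> 8 * real n powr 3" by simp
    have e: "(\<integral>\<^sup>+x. (\<Prod>i<n. ennreal (q (x i))) /
          random_mixture.evidence (dp_sticks \<alpha> P0) (\<lambda>s. stick_weight (fst s)) snd f n x \<partial>Xlaw)
        \<le> ennreal (C * real n powr (mass_exponent / 2))"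
      using ev elim(2) random_mixture_dp by blast
    let ?A = "{x \<in> space Xlaw. \<epsilon> < measure (\<Phi> n x) ?L}"
    have mA: "?A \<in> sets Xlaw"
      using random_mixture.measure_posterior_measurable(1)[OF random_mixture_dp, of n "\<lambda>_. {..<Suc (N n)}"]
      unfolding borel_Xlaw[symmetric] by (auto intro: borel_measurable_less)
    have "?bad n \<subseteq> ?A"
      using tv_ge_underflow[of n _ "N n"] unfolding dp_allocation_eq trunc_allocation_posterior
      by (auto intro: less_le_trans)
    then have "measure Xlaw (?bad n) \<le> measure Xlaw ?A"
      using mA by (intro X.finite_measure_mono) auto
    also have "\<dots> \<le> sqrt (s powr s * real n powr (- s) * (\<alpha> / (\<alpha> - s)) ^ Suc (N n) *
        (C * real n powr (mass_exponent / 2))) * (1 / \<epsilon> + 1)"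
      by (rule underflow_prob[OF random_mixture_dp _ e elim(3)]) (use C \<epsilon> elim(3) s in auto)
    also have "\<dots> \<le> sqrt (c * real n powr \<gamma>) * (1 / \<epsilon> + 1)"
    proof (intro mult_right_mono real_sqrt_le_mono)
      have "s powr s * real n powr (- s) * (\<alpha> / (\<alpha> - s)) ^ Suc (N n) * (C * real n powr (mass_exponent / 2)) \<le>
        s powr s * real n powr (- s) * (8 * real n powr 3) * (C * real n powr (mass_exponent / 2))"
        unfolding s(3) using 8 C by (intro mult_right_mono mult_left_mono) auto
      also have "\<dots> = c * (real n powr 3 * real n powr (- s) * real n powr (mass_exponent / 2))"
        unfolding c_def by (simp only: mult_ac)
      also have "\<dots> = c * real n powr \<gamma>" unfolding \<gamma>_def powr_add[symmetric] by simp
      finally show "s powr s * real n powr (- s) * (\<alpha> / (\<alpha> - s)) ^ Suc (N n) * (C * real n powr (mass_exponent / 2))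
        \<le> c * real n powr \<gamma>" .
    qed (use \<epsilon> in auto)
    finally show ?case .
  qed
  have "(\<lambda>n. sqrt (c * real n powr \<gamma>) * (1 / \<epsilon> + 1)) \<longlonglongrightarrow> sqrt (c * 0) * (1 / \<epsilon> + 1)"
    by (intro tendsto_intros tendsto_neg_powr[OF \<gamma>] filterlim_real_sequentially)
  then have lim: "(\<lambda>n. sqrt (c * real n powr \<gamma>) * (1 / \<epsilon> + 1)) \<longlonglongrightarrow> 0" by simp
  show "(\<lambda>n. measure Xlaw (?bad n)) \<longlonglongrightarrow> 0"
    by (rule tendsto_sandwich[OF _ bound tendsto_const lim]) simp
qed

end

theorem theorem6:
  fixes K :: nat
  shows
    "(\<forall>\<alpha>>0. \<exists>\<beta>'>0.
        \<forall>(f :: real^'d \<Rightarrow> real) \<Theta> P0 ws ts (N :: nat \<Rightarrow> nat).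
          mixture_assumptions f \<Theta> P0 K ws ts \<and> (\<forall>n. 1 \<le> N n) \<and>
          (\<forall>\<^sub>F n in sequentially. \<lceil>\<beta>' * ln (real n)\<rceil> \<le> int (N n)) \<longrightarrow>
          conv_in_prob (data_law f K ws ts)
            (\<lambda>n x. tv_dist (dp_allocation f \<alpha> P0 n x) (trunc_allocation f \<alpha> P0 (N n) n x)) 0)
     \<and>
     (\<exists>\<alpha>s. \<exists>\<beta>>0. \<forall>\<alpha>>0. \<alpha>s < \<alpha> \<longrightarrow>
        (\<forall>(f :: real^'d \<Rightarrow> real) \<Theta> P0 ws ts (N :: nat \<Rightarrow> nat).
          mixture_assumptions f \<Theta> P0 K ws ts \<and> (\<forall>n. 1 \<le> N n) \<and>
          (\<forall>\<^sub>F n in sequentially. int (N n) < \<lceil>\<beta> * ln (real n)\<rceil>) \<longrightarrow>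
          conv_in_prob (data_law f K ws ts)
            (\<lambda>n x. tv_dist (dp_allocation f \<alpha> P0 n x) (trunc_allocation f \<alpha> P0 (N n) n x)) 1))"
proof (rule conjI)
  show "\<forall>\<alpha>>0. \<exists>\<beta>'>0.
        \<forall>(f :: real^'d \<Rightarrow> real) \<Theta> P0 ws ts (N :: nat \<Rightarrow> nat).
          mixture_assumptions f \<Theta> P0 K ws ts \<and> (\<forall>n. 1 \<le> N n) \<and>
          (\<forall>\<^sub>F n in sequentially. \<lceil>\<beta>' * ln (real n)\<rceil> \<le> int (N n)) \<longrightarrow>
          conv_in_prob (data_law f K ws ts)
            (\<lambda>n x. tv_dist (dp_allocation f \<alpha> P0 n x) (trunc_allocation f \<alpha> P0 (N n) n x)) 0"
  proof (intro allI impI)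
    fix \<alpha> :: real assume \<alpha>: "0 < \<alpha>"
    let ?\<beta> = "((\<alpha> + real (K - 1) + real K * real CARD('d)) / 2 + 2) / ln ((\<alpha> + 1) / \<alpha>)"
    have "0 < \<alpha> + real (K - 1) + real K * real CARD('d)"
      by (intro add_pos_nonneg \<alpha> mult_nonneg_nonneg) simp_all
    then have "0 < (\<alpha> + real (K - 1) + real K * real CARD('d)) / 2 + 2"
      by (intro add_pos_pos[OF half_gt_zero]) simp_all
    moreover have "0 < ln ((\<alpha> + 1) / \<alpha>)" using \<alpha> by (intro ln_gt_zero) simp
    ultimately have \<beta>: "0 < ?\<beta>" by (rule divide_pos_pos)
    show "\<exists>\<beta>'>0. \<forall>(f :: real^'d \<Rightarrow> real) \<Theta> P0 ws ts (N :: nat \<Rightarrow> nat).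
          mixture_assumptions f \<Theta> P0 K ws ts \<and> (\<forall>n. 1 \<le> N n) \<and>
          (\<forall>\<^sub>F n in sequentially. \<lceil>\<beta>' * ln (real n)\<rceil> \<le> int (N n)) \<longrightarrow>
          conv_in_prob (data_law f K ws ts)
            (\<lambda>n x. tv_dist (dp_allocation f \<alpha> P0 n x) (trunc_allocation f \<alpha> P0 (N n) n x)) 0"
    proof (rule exI[of _ ?\<beta>], rule conjI[OF \<beta>], intro allI impI, elim conjE)
      fix f :: "real^'d \<Rightarrow> real" and \<Theta> P0 ws ts and N :: "nat \<Rightarrow> nat"
      assume ma: "mixture_assumptions f \<Theta> P0 K ws ts"
        and N: "\<forall>\<^sub>F n in sequentially. \<lceil>?\<beta> * ln (real n)\<rceil> \<le> int (N n)"
      interpret dp_setting \<alpha> f \<Theta> P0 K ws ts by (rule dp_setting.intro[OF \<alpha> ma])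
      show "conv_in_prob (data_law f K ws ts)
            (\<lambda>n x. tv_dist (dp_allocation f \<alpha> P0 n x) (trunc_allocation f \<alpha> P0 (N n) n x)) 0"
        by (rule superlog_truncation[unfolded mass_exponent_def, OF N])
    qed
  qed
next
  show "\<exists>\<alpha>s. \<exists>\<beta>>0. \<forall>\<alpha>>0. \<alpha>s < \<alpha> \<longrightarrow>
        (\<forall>(f :: real^'d \<Rightarrow> real) \<Theta> P0 ws ts (N :: nat \<Rightarrow> nat).
          mixture_assumptions f \<Theta> P0 K ws ts \<and> (\<forall>n. 1 \<le> N n) \<and>
          (\<forall>\<^sub>F n in sequentially. int (N n) < \<lceil>\<beta> * ln (real n)\<rceil>) \<longrightarrow>
          conv_in_prob (data_law f K ws ts)
            (\<lambda>n x. tv_dist (dp_allocation f \<alpha> P0 n x) (trunc_allocation f \<alpha> P0 (N n) n x)) 1)"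
  proof (rule exI[of _ "8 + 2 * real K * (1 + real CARD('d))"], rule exI[of _ 1], rule conjI[OF zero_less_one],
      intro allI impI, elim conjE)
    fix \<alpha> :: real and f :: "real^'d \<Rightarrow> real" and \<Theta> P0 ws ts and N :: "nat \<Rightarrow> nat"
    assume large: "0 < \<alpha>" "8 + 2 * real K * (1 + real CARD('d)) < \<alpha>" and ma: "mixture_assumptions f \<Theta> P0 K ws ts"
      and N: "\<forall>\<^sub>F n in sequentially. int (N n) < \<lceil>1 * ln (real n)\<rceil>"
    interpret dp_setting \<alpha> f \<Theta> P0 K ws ts by (rule dp_setting.intro[OF large(1) ma])
    show "conv_in_prob (data_law f K ws ts)
            (\<lambda>n x. tv_dist (dp_allocation f \<alpha> P0 n x) (trunc_allocation f \<alpha> P0 (N n) n x)) 1"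
      using N by (intro sublog_truncation[OF large(2)]) simp
  qed
qed

end
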